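(* Let $n\ge1$ and consider an exceptional set for the quiver of type $\mathbb A_n$ with straight orientation, together with its rooted ternary tree, whose nodes are the objects of the set and are labeled by words in $a,b,c$. A node in the ternary tree corresponds to a relatively injective object in the exceptional set if and only if it has an even number of letters $b$ in its label.
   Context: The quiver is $1\to2\to\cdots\to n$ over a field $\Bbbk$; modules are finite dimensional. For $0\le i<j\le n$, $M_{i,j}$ is the indecomposable module with support $(i,j]=\{i+1,\dots,j\}$. An exceptional sequence is a sequence $(E_1,\dots,E_n)$ of indecomposable modules with $\mathrm{Ext}^1(E_p,E_p)=0$ and $\mathrm{Hom}(E_p,E_q)=0=\mathrm{Ext}^1(E_p,E_q)$ for all $q<p$; an exceptional set is a set of $n$ modules which can be so ordered. $E_p$ is relatively injective if it is an injective object of ${}^\perp(E_1\oplus\cdots\oplus E_{p-1})$, where ${}^\perp V$ is the full subcategory of modules $W$ with $\mathrm{Hom}(W,V)=0=\mathrm{Ext}^1(W,V)$; this does not depend on the chosen ordering of the exceptional set. The strand diagram of an exceptional set is the graph with vertex set $\{0,\dots,n\}$ and an edge (strand) $c(i,j)$ for each object $M_{i,j}$; it is a tree. A strand $c(i,j)$, $i<j$, is oriented to the right if the unique path from $0$ to $j$ passes through $i$, and to the left otherwise. The ternary tree has root $R=c(0,k)$, with $k$ maximal such that $M_{0,k}$ is in the set, and the three ordered children of a node $X=c(i,j)$ ($i<j$) are $Xa,Xb,Xc$: - if $X$ is oriented to the right: $Xa=c(i,x)$ with $i<x<j$ maximal; $Xb=c(y,j)$ the longest strand with $i<y<j$; $Xc=c(j,z)$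 with $z>j$ maximal; - if $X$ is oriented to the left: $Xa=c(x,j)$ with $i<x<j$ minimal; $Xb=c(i,y)$ the longest strand with $i<y<j$; $Xc=c(z,i)$ the longest strand with $z<i$; in each case among strands of the diagram, a leaf being used if no such strand exists. Every object occurs as exactly one node. The label of a node is the word in $a,b,c$ recording the path from $R$ to it ($R$ itself has no letters); the children $Ra,Rb,Rc$ of $R$ are written $A,B,C$, the capital $B$ counting as a letter $b$ (e.g. $Cc$ and $Bb$ have an even number of $b$'s, $Cb$ and $Bbb$ an odd number). *)

theory Defs
  imports Jordan_Normal_Form.Matrix_Kernel
begin

section \<open>Representations of the quiver 1 \<rightarrow> 2 \<rightarrow> ... \<rightarrow> n\<close>

text \<open>
  A finite dimensional module is a representation in coordinates: the space at vertex \<open>x\<close> is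
  \<open>'k\<close> to the power \<open>dimv V x\<close>, and \<open>act V x\<close> is the matrix of the arrow from \<open>x\<close> to \<open>x + 1\<close>.
  Only vertices \<open>1..n\<close> and arrows \<open>1..<n\<close> carry meaning; values elsewhere are junk, so morphisms
  are compared by \<open>mor_eq\<close> and not by HOL equality. A vertex may have dimension 0.
\<close>

record 'k quiver_rep =
  dimv :: "nat \<Rightarrow> nat"
  act :: "nat \<Rightarrow> 'k mat"

definition is_rep :: "nat \<Rightarrow> 'k quiver_rep \<Rightarrow> bool" where
  "is_rep n V \<longleftrightarrow> (\<forall>x\<in>{1..<n}. act V x \<in> carrier_mat (dimv V (x + 1)) (dimv V x))"

definition is_zero_rep :: "nat \<Rightarrow> 'k quiver_rep \<Rightarrow> bool" where
  "is_zero_rep n V \<longleftrightarrow> (\<forall>x\<in>{1..n}. dimv V x = 0)"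

definition morphism ::
    "nat \<Rightarrow> 'k::field quiver_rep \<Rightarrow> 'k quiver_rep \<Rightarrow> (nat \<Rightarrow> 'k mat) \<Rightarrow> bool" where
  "morphism n V W f \<longleftrightarrow>
     (\<forall>x\<in>{1..n}. f x \<in> carrier_mat (dimv W x) (dimv V x)) \<and>
     (\<forall>x\<in>{1..<n}. f (x + 1) * act V x = act W x * f x)"

definition mor_eq :: "nat \<Rightarrow> (nat \<Rightarrow> 'k mat) \<Rightarrow> (nat \<Rightarrow> 'k mat) \<Rightarrow> bool" where
  "mor_eq n f g \<longleftrightarrow> (\<forall>x\<in>{1..n}. f x = g x)"

definition mor_comp :: "(nat \<Rightarrow> 'k::field mat) \<Rightarrow> (nat \<Rightarrow> 'k mat) \<Rightarrow> nat \<Rightarrow> 'k mat" where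
  "mor_comp g f = (\<lambda>x. g x * f x)"

definition id_mor :: "'k::field quiver_rep \<Rightarrow> nat \<Rightarrow> 'k mat" where
  "id_mor V = (\<lambda>x. 1\<^sub>m (dimv V x))"

definition zero_mor :: "'k::field quiver_rep \<Rightarrow> 'k quiver_rep \<Rightarrow> nat \<Rightarrow> 'k mat" where
  "zero_mor V W = (\<lambda>x. 0\<^sub>m (dimv W x) (dimv V x))"

definition rep_iso :: "nat \<Rightarrow> 'k::field quiver_rep \<Rightarrow> 'k quiver_rep \<Rightarrow> bool" where
  "rep_iso n V W \<longleftrightarrow>
     (\<exists>f g. morphism n V W f \<and> morphism n W V g \<and>
        mor_eq n (mor_comp g f) (id_mor V) \<and> mor_eq n (mor_comp f g) (id_mor W))"

definition zero_rep :: "'k::field quiver_rep" where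
  "zero_rep = \<lparr>dimv = (\<lambda>_. 0), act = (\<lambda>_. 0\<^sub>m 0 0)\<rparr>"

definition direct_sum :: "'k::field quiver_rep \<Rightarrow> 'k quiver_rep \<Rightarrow> 'k quiver_rep" where
  "direct_sum V W =
     \<lparr>dimv = (\<lambda>x. dimv V x + dimv W x),
      act = (\<lambda>x. four_block_mat
                   (act V x) (0\<^sub>m (dimv V (x + 1)) (dimv W x))
                   (0\<^sub>m (dimv W (x + 1)) (dimv V x)) (act W x))\<rparr>"

definition direct_sum_list :: "'k::field quiver_rep list \<Rightarrow> 'k quiver_rep" where
  "direct_sum_list Vs = foldr direct_sum Vs zero_rep"

definition indecomposable_rep :: "nat \<Rightarrow> 'k::field quiver_rep \<Rightarrow> bool" where
  "indecomposable_rep n V \<longleftrightarrow>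
     is_rep n V \<and> \<not> is_zero_rep n V \<and>
     (\<forall>X Y. is_rep n X \<and> is_rep n Y \<and> rep_iso n V (direct_sum X Y) \<longrightarrow>
            is_zero_rep n X \<or> is_zero_rep n Y)"

text \<open>The module \<open>M\<^sub>i\<^sub>,\<^sub>j\<close> with support \<open>{i+1..j}\<close> and identity maps between its one-dimensional spaces.\<close>

definition interval_rep :: "nat \<Rightarrow> nat \<Rightarrow> 'k::field quiver_rep" where
  "interval_rep i j =
     (let d = (\<lambda>x. if i < x \<and> x \<le> j then 1 else 0)
      in \<lparr>dimv = d,
          act = (\<lambda>x. if i < x \<and> x + 1 \<le> j then 1\<^sub>m 1 else 0\<^sub>m (d (x + 1)) (d x))\<rparr>)"

section \<open>Hom and Ext\<close>

definition hom_vanishes :: "nat \<Rightarrow> 'k::field quiver_rep \<Rightarrow> 'k quiver_rep \<Rightarrow> bool" where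
  "hom_vanishes n V W \<longleftrightarrow> (\<forall>f. morphism n V W f \<longrightarrow> mor_eq n f (zero_mor V W))"

definition short_exact ::
    "nat \<Rightarrow> 'k::field quiver_rep \<Rightarrow> (nat \<Rightarrow> 'k mat) \<Rightarrow> 'k quiver_rep \<Rightarrow> (nat \<Rightarrow> 'k mat)
      \<Rightarrow> 'k quiver_rep \<Rightarrow> bool" where
  "short_exact n W f E g V \<longleftrightarrow>
     is_rep n W \<and> is_rep n E \<and> is_rep n V \<and> morphism n W E f \<and> morphism n E V g \<and>
     (\<forall>x\<in>{1..n}.
        mat_kernel (f x) = {0\<^sub>v (dimv W x)} \<and>
        (\<lambda>v. f x *\<^sub>v v) ` carrier_vec (dimv W x) = mat_kernel (g x) \<and>
        (\<lambda>v. g x *\<^sub>v v) ` carrier_vec (dimv E x) = carrier_vec (dimv V x))"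

text \<open>
  \<open>Ext\<^sup>1(V, W)\<close> is the group of extensions (Yoneda), with zero element the class of
  the split extension: it vanishes iff every \<open>0 \<rightarrow> W \<rightarrow> E \<rightarrow> V \<rightarrow> 0\<close> splits.
\<close>

definition ext1_vanishes :: "nat \<Rightarrow> 'k::field quiver_rep \<Rightarrow> 'k quiver_rep \<Rightarrow> bool" where
  "ext1_vanishes n V W \<longleftrightarrow>
     (\<forall>E f g. short_exact n W f E g V \<longrightarrow>
        (\<exists>s. morphism n V E s \<and> mor_eq n (mor_comp g s) (id_mor V)))"

section \<open>Exceptional sequences and relatively injective objects\<close>

definition exceptional_sequence :: "nat \<Rightarrow> 'k::field quiver_rep list \<Rightarrow> bool" where
  "exceptional_sequence n Es \<longleftrightarrow>
     length Es = n \<and>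
     (\<forall>p<n. indecomposable_rep n (Es ! p) \<and> ext1_vanishes n (Es ! p) (Es ! p)) \<and>
     (\<forall>p<n. \<forall>q<p. hom_vanishes n (Es ! p) (Es ! q) \<and> ext1_vanishes n (Es ! p) (Es ! q))"

text \<open>
  The members of an exceptional sequence are pairwise non-isomorphic, so \<open>set Es\<close> has
  exactly \<open>n\<close> elements, also up to isomorphism.
\<close>

definition exceptional_set :: "nat \<Rightarrow> 'k::field quiver_rep set \<Rightarrow> bool" where
  "exceptional_set n S \<longleftrightarrow> (\<exists>Es. exceptional_sequence n Es \<and> set Es = S)"

definition left_perp :: "nat \<Rightarrow> 'k::field quiver_rep \<Rightarrow> 'k quiver_rep set" where
  "left_perp n V = {W. is_rep n W \<and> hom_vanishes n W V \<and> ext1_vanishes n W V}"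

text \<open>
  Injective objects of a full subcategory, given by its class \<open>C\<close> of objects. Monomorphisms
  are the categorical ones of the subcategory, i.e. tested on objects of \<open>C\<close> only.
\<close>

definition mono_in ::
    "nat \<Rightarrow> 'k::field quiver_rep set \<Rightarrow> 'k quiver_rep \<Rightarrow> 'k quiver_rep \<Rightarrow> (nat \<Rightarrow> 'k mat) \<Rightarrow> bool" where
  "mono_in n C X Y f \<longleftrightarrow>
     morphism n X Y f \<and>
     (\<forall>Z\<in>C. \<forall>u v. morphism n Z X u \<and> morphism n Z X v \<and>
        mor_eq n (mor_comp f u) (mor_comp f v) \<longrightarrow> mor_eq n u v)"

definition injective_in :: "nat \<Rightarrow> 'k::field quiver_rep set \<Rightarrow> 'k quiver_rep \<Rightarrow> bool" where
  "injective_in n C I \<longleftrightarrow>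
     I \<in> C \<and>
     (\<forall>X\<in>C. \<forall>Y\<in>C. \<forall>f g. mono_in n C X Y f \<and> morphism n X I g \<longrightarrow>
        (\<exists>h. morphism n Y I h \<and> mor_eq n (mor_comp h f) g))"

text \<open>Lists are indexed from 0, so \<open>take p Es\<close> are the objects before \<open>Es ! p\<close>.\<close>

definition relatively_injective :: "nat \<Rightarrow> 'k::field quiver_rep list \<Rightarrow> nat \<Rightarrow> bool" where
  "relatively_injective n Es p \<longleftrightarrow>
     injective_in n (left_perp n (direct_sum_list (take p Es))) (Es ! p)"

section \<open>Strand diagrams and the ternary tree\<close>

text \<open>The strand \<open>c(i,j)\<close> with \<open>i < j\<close> is the pair \<open>(i, j)\<close>; as an edge it is undirected.\<close>

definition strand_diagram :: "nat \<Rightarrow> 'k::field quiver_rep set \<Rightarrow> (nat \<times> nat) set" where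
  "strand_diagram n S = {(i, j). i < j \<and> j \<le> n \<and> (\<exists>E\<in>S. rep_iso n E (interval_rep i j))}"

definition simple_path :: "(nat \<times> nat) set \<Rightarrow> nat \<Rightarrow> nat list \<Rightarrow> nat \<Rightarrow> bool" where
  "simple_path D u xs v \<longleftrightarrow>
     xs \<noteq> [] \<and> hd xs = u \<and> last xs = v \<and> distinct xs \<and>
     successively (\<lambda>x y. (x, y) \<in> D \<or> (y, x) \<in> D) xs"

text \<open>The diagram of an exceptional set is a tree, so the path below is the unique one.\<close>

definition oriented_right :: "(nat \<times> nat) set \<Rightarrow> nat \<Rightarrow> nat \<Rightarrow> bool" where
  "oriented_right D i j \<longleftrightarrow> (\<exists>xs. simple_path D 0 xs j \<and> i \<in> set xs)"

definition is_greatest :: "nat set \<Rightarrow> nat \<Rightarrow> bool" where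
  "is_greatest A x \<longleftrightarrow> x \<in> A \<and> (\<forall>y\<in>A. y \<le> x)"

definition is_smallest :: "nat set \<Rightarrow> nat \<Rightarrow> bool" where
  "is_smallest A x \<longleftrightarrow> x \<in> A \<and> (\<forall>y\<in>A. x \<le> y)"

datatype letter = LA | LB | LC

text \<open>
  \<open>child D (i, j) l Y\<close>: the child of \<open>c(i,j)\<close> in direction \<open>l\<close> is the strand \<open>Y\<close> (there is
  none if that child is a leaf). The longest strand with a given right (left) end
  is the one with the smallest (greatest) other end.
\<close>

inductive child :: "(nat \<times> nat) set \<Rightarrow> nat \<times> nat \<Rightarrow> letter \<Rightarrow> nat \<times> nat \<Rightarrow> bool" for D where
  right_a: "oriented_right D i j \<Longrightarrow> is_greatest {x. i < x \<and> x < j \<and> (i, x) \<in> D} x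
              \<Longrightarrow> child D (i, j) LA (i, x)"
| right_b: "oriented_right D i j \<Longrightarrow> is_smallest {y. i < y \<and> y < j \<and> (y, j) \<in> D} y
              \<Longrightarrow> child D (i, j) LB (y, j)"
| right_c: "oriented_right D i j \<Longrightarrow> is_greatest {z. j < z \<and> (j, z) \<in> D} z
              \<Longrightarrow> child D (i, j) LC (j, z)"
| left_a: "\<not> oriented_right D i j \<Longrightarrow> is_smallest {x. i < x \<and> x < j \<and> (x, j) \<in> D} x
              \<Longrightarrow> child D (i, j) LA (x, j)"
| left_b: "\<not> oriented_right D i j \<Longrightarrow> is_greatest {y. i < y \<and> y < j \<and> (i, y) \<in> D} y
              \<Longrightarrow> child D (i, j) LB (i, y)"
| left_c: "\<not> oriented_right D i j \<Longrightarrow> is_smallest {z. z < i \<and> (z, i) \<in> D} z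
              \<Longrightarrow> child D (i, j) LC (z, i)"

text \<open>
  \<open>tree_node D w X\<close>: the node with label \<open>w\<close> (read from the root, so capital and small letters
  are not distinguished) is the strand \<open>X\<close>.
\<close>

inductive tree_node :: "(nat \<times> nat) set \<Rightarrow> letter list \<Rightarrow> nat \<times> nat \<Rightarrow> bool" for D where
  root: "is_greatest {k. (0, k) \<in> D} k \<Longrightarrow> tree_node D [] (0, k)"
| step: "tree_node D w X \<Longrightarrow> child D X l Y \<Longrightarrow> tree_node D (w @ [l]) Y"

end

theory Submission
  imports Defs
begin

text \<open>
  Put a zero space at vertex \<open>0\<close>. For a module \<open>W\<close>, \<open>Hom(W, M\<^sub>i\<^sub>,\<^sub>j) = 0\<close> says that the map
  \<open>W\<^sub>i \<rightarrow> W\<^sub>j\<close> is surjective and \<open>Ext\<^sup>1(W, M\<^sub>i\<^sub>,\<^sub>j) = 0\<close> that it is injective. Hence \<open>W\<close> lies in the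
  perpendicular category before \<open>E\<^sub>p = M\<^sub>i\<^sub>,\<^sub>j\<close> iff \<open>W\<^sub>k \<rightarrow> W\<^sub>l\<close> is bijective for every earlier strand
  \<open>c(k,l)\<close>. Testing this on \<open>M\<^sub>i\<^sub>,\<^sub>j\<close> itself, where \<open>W\<^sub>i = 0 \<noteq> W\<^sub>j\<close>, shows that each strand joins
  two different components of the graph \<open>D\<^sub>p\<close> of earlier strands, so the diagram is a noncrossing tree.

  If the component of \<open>i\<close> in \<open>D\<^sub>p\<close> contains \<open>0\<close> or a vertex \<open>z > j\<close>, then \<open>W\<^sub>i \<rightarrow> W\<^sub>j\<close> is injective
  for all \<open>W\<close> in the perpendicular category, and functionals extend along monomorphisms: \<open>M\<^sub>i\<^sub>,\<^sub>j\<close> is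
  relatively injective. Otherwise let \<open>m \<ge> 1\<close> be the least vertex of that component. By
  noncrossingness \<open>{m..j}\<close> is a union of components, so \<open>M\<^bsub>m-1,j\<^esub>\<close> is perpendicular and the
  inclusion of \<open>M\<^sub>i\<^sub>,\<^sub>j\<close> into it does not split. In the tree the first case means that \<open>c(i,j)\<close>
  is oriented to the right, and passing to a child changes the orientation exactly in direction \<open>b\<close>.
\<close>

section \<open>Matrices\<close>

text \<open>Objects live in arbitrary bases and are interval modules only up to isomorphism, so the
  conditions are first put into a form that survives changes of basis: a kernel is a basis with
  split coordinates, injectivity is a left inverse, and vanishing of Ext is solvability of a cocycle
  equation. Monomorphisms are tested inside the perpendicular category only; they are injective at
  every vertex because the category contains their kernels.

  The dichotomy of the overview comes from one compatibility condition. To extend a map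
  \<open>X \<rightarrow> M\<close> along \<open>f : X \<rightarrow> Y\<close>, with \<open>M\<close>
  the module of \<open>c(i,j)\<close>, one needs a functional at \<open>j\<close> that is prescribed
  on the image of \<open>f\<close> and zero on the image of the space of \<open>Y\<close> at
  \<open>i\<close>. The two demands agree if whatever lies in both images already comes from the
  space of \<open>X\<close> at \<open>i\<close>. A bijection from \<open>i\<close> to a vertex
  beyond \<open>j\<close> provides this, and so does a zero space at \<open>i\<close>.

  In the tree rooted at \<open>0\<close>, orientation to the right says that \<open>i\<close> is the
  parent of \<open>j\<close>. The parity count then rests on two facts: parents are unique, and the
  root is never strictly inside a strand.\<close>

text \<open>Associativity is needed in both directions, with side conditions the simplifier can solve.\<close>

declare assoc_mult_mat [simp del]

lemma mult_assoc_dim: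
  fixes A B C :: "'a::semiring_0 mat"
  assumes "dim_col A = dim_row B" "dim_col B = dim_row C"
  shows "A * B * C = A * (B * C)"
  by (rule assoc_mult_mat[of A "dim_row A" "dim_col A" B "dim_col B" C "dim_col C"])
    (auto intro!: carrier_matI simp: assms)

lemma zero_mult_dim: "dim_row A = n \<Longrightarrow> 0\<^sub>m m n * A = 0\<^sub>m m (dim_col (A :: 'a::semiring_0 mat))"
  by (rule left_mult_zero_mat) (auto intro: carrier_matI)

lemma mult_zero_dim: "dim_col A = n \<Longrightarrow> A * 0\<^sub>m n m = 0\<^sub>m (dim_row (A :: 'a::semiring_0 mat)) m"
  by (rule right_mult_zero_mat) (auto intro: carrier_matI)

lemma add_mult_dim:
  fixes A B C :: "'a::semiring_0 mat"
  assumes "dim_row A = dim_row B" "dim_col A = dim_row C" "dim_col B = dim_row C"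
  shows "(A + B) * C = A * C + B * C"
  by (rule add_mult_distrib_mat[of A "dim_row A" "dim_col A"]) (auto intro!: carrier_matI simp: assms)

lemma mult_add_dim:
  fixes A B C :: "'a::semiring_0 mat"
  assumes "dim_row B = dim_row C" "dim_col B = dim_col C" "dim_col A = dim_row B"
  shows "A * (B + C) = A * B + A * C"
  by (rule mult_add_distrib_mat[of A "dim_row A" "dim_col A"]) (auto intro!: carrier_matI simp: assms)

lemma diff_mult_dim:
  fixes A B C :: "'a::ring mat"
  assumes "dim_row A = dim_row B" "dim_col A = dim_row C" "dim_col B = dim_row C"
  shows "(A - B) * C = A * C - B * C"
  by (rule minus_mult_distrib_mat[of A "dim_row A" "dim_col A"]) (auto intro!: carrier_matI simp: assms)

lemma mult_diff_dim:
  fixes A B C :: "'a::ring mat"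
  assumes "dim_row B = dim_row C" "dim_col B = dim_col C" "dim_col A = dim_row B"
  shows "A * (B - C) = A * B - A * C"
  by (rule mult_minus_distrib_mat[of A "dim_row A" "dim_col A"]) (auto intro!: carrier_matI simp: assms)

lemmas mat_dim_simps = mult_assoc_dim zero_mult_dim mult_zero_dim
  add_mult_dim mult_add_dim diff_mult_dim mult_diff_dim

section \<open>Kernels of matrices in split form\<close>

lemma mult_index_sum:
  assumes "A \<in> carrier_mat m n" "B \<in> carrier_mat n k" "i < m" "j < k"
  shows "(A * B) $$ (i, j) = (\<Sum>l<n. A $$ (i, l) * B $$ (l, j))"
  using assms by (auto simp: scalar_prod_def atLeast0LessThan intro!: sum.cong)

text \<open>The hyperplane given by a functional \<open>\<phi>\<close> that is nonzero at
  \<open>t\<close> is a graph over the other coordinates, which \<open>ins\<close> enumerates.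
  \<open>L\<close> forgets coordinate \<open>t\<close>, the columns of \<open>B\<close> restore it,
  and \<open>v\<close> is the multiple of the \<open>t\<close>-th unit vector on which
  \<open>\<phi>\<close> has value 1.\<close>

lemma row_kernel_split:
  fixes \<phi> :: "'k::field mat"
  assumes \<phi>: "\<phi> \<in> carrier_mat 1 (Suc n)" and t: "t < Suc n" "\<phi> $$ (0, t) \<noteq> 0"
  obtains B L v where "B \<in> carrier_mat (Suc n) n" "L \<in> carrier_mat n (Suc n)" "v \<in> carrier_mat (Suc n) 1"
    "L * B = 1\<^sub>m n" "B * L + v * \<phi> = 1\<^sub>m (Suc n)"
proof -
  define ins where "ins a = (if a < t then a else Suc a)" for a
  have ins_ne: "ins a \<noteq> t" for a by (auto simp: ins_def)
  have ins_lt: "ins a < Suc n" if "a < n" for a using that by (auto simp: ins_def)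
  have ins_inj: "ins a = ins b \<longleftrightarrow> a = b" for a b by (auto simp: ins_def split: if_splits)
  define B where "B = mat (Suc n) n (\<lambda>(r, c). if r = t then - \<phi> $$ (0, ins c) / \<phi> $$ (0, t)
    else if r = ins c then 1 else 0)"
  define L :: "'k mat" where "L = mat n (Suc n) (\<lambda>(a, b). if b = ins a then 1 else 0)"
  define v where "v = mat (Suc n) 1 (\<lambda>(r, c). if r = t then 1 / \<phi> $$ (0, t) else 0)"
  have c: "B \<in> carrier_mat (Suc n) n" "L \<in> carrier_mat n (Suc n)" "v \<in> carrier_mat (Suc n) 1"
    by (auto simp: B_def L_def v_def)
  have "L * B = 1\<^sub>m n"
  proof (rule eq_matI)
    fix i j assume ij: "i < dim_row (1\<^sub>m n :: 'k mat)" "j < dim_col (1\<^sub>m n :: 'k mat)"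
    have "(L * B) $$ (i, j) = (\<Sum>l<Suc n. L $$ (i, l) * B $$ (l, j))"
      using ij by (intro mult_index_sum[OF c(2) c(1)]) auto
    also have "\<dots> = (\<Sum>l<Suc n. if l = ins i then B $$ (l, j) else 0)"
      using ij by (intro sum.cong) (auto simp: L_def)
    also have "\<dots> = B $$ (ins i, j)" using ij ins_lt[of i] by (subst sum.delta) auto
    also have "\<dots> = 1\<^sub>m n $$ (i, j)" using ij ins_lt ins_ne by (auto simp: B_def ins_inj)
    finally show "(L * B) $$ (i, j) = 1\<^sub>m n $$ (i, j)" .
  qed (use c in auto)
  moreover have "B * L + v * \<phi> = 1\<^sub>m (Suc n)"
  proof (rule eq_matI)
    fix i j assume "i < dim_row (1\<^sub>m (Suc n) :: 'k mat)" "j < dim_col (1\<^sub>m (Suc n) :: 'k mat)"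
    then have ij: "i < Suc n" "j < Suc n" by auto
    have BL: "(B * L) $$ (i, j) = (\<Sum>l<n. B $$ (i, l) * L $$ (l, j))"
      using ij by (intro mult_index_sum[OF c(1) c(2)]) auto
    have vp: "(v * \<phi>) $$ (i, j) = v $$ (i, 0) * \<phi> $$ (0, j)"
      using mult_index_sum[OF c(3) \<phi> ij] by simp
    have "(\<Sum>l<n. B $$ (i, l) * L $$ (l, j)) + v $$ (i, 0) * \<phi> $$ (0, j) = 1\<^sub>m (Suc n) $$ (i, j)"
    proof (cases "j = t")
      case True
      have "(\<Sum>l<n. B $$ (i, l) * L $$ (l, j)) = 0"
        using ij True ins_ne by (intro sum.neutral) (auto simp: L_def)
      then show ?thesis using ij True t by (auto simp: v_def)
    next
      case False
      define d where "d = (if j < t then j else j - 1)"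
      have d: "d < n" "ins d = j" using False ij t by (auto simp: d_def ins_def)
      have "(\<Sum>l<n. B $$ (i, l) * L $$ (l, j)) = (\<Sum>l<n. if l = d then B $$ (i, l) else 0)"
        using ij d ins_inj by (intro sum.cong) (auto simp: L_def)
      also have "\<dots> = B $$ (i, d)" using d by (simp add: sum.delta)
      finally show ?thesis using ij False d by (auto simp: v_def B_def)
    qed
    then show "(B * L + v * \<phi>) $$ (i, j) = 1\<^sub>m (Suc n) $$ (i, j)"
      using BL vp ij c \<phi> by simp
  qed (use c \<phi> in auto)
  ultimately show ?thesis using that c by blast
qed

text \<open>The columns of \<open>B\<close> form a basis of the kernel of \<open>A\<close>, \<open>L\<close> computes coordinates in it, and
  \<open>G\<close> is a generalized inverse: \<open>A = A (B L + G A) = A G A\<close>.\<close>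

lemma kernel_split:
  fixes A :: "'k::field mat"
  assumes "A \<in> carrier_mat m n"
  shows "\<exists>r G B L. G \<in> carrier_mat n m \<and> B \<in> carrier_mat n r \<and> L \<in> carrier_mat r n \<and>
     A * B = 0\<^sub>m m r \<and> L * B = 1\<^sub>m r \<and> B * L + G * A = 1\<^sub>m n"
  using assms
proof (induction n arbitrary: A)
  case 0
  show ?case
    by (rule exI[of _ 0], rule exI[of _ "0\<^sub>m 0 m"], rule exI[of _ "0\<^sub>m 0 0"], rule exI[of _ "0\<^sub>m 0 0"])
      (use 0 in \<open>auto intro!: eq_matI\<close>)
next
  case (Suc n)
  show ?case
  proof (cases "A = 0\<^sub>m m (Suc n)")
    case True
    show ?thesis
      by (rule exI[of _ "Suc n"], rule exI[of _ "0\<^sub>m (Suc n) m"], rule exI[of _ "1\<^sub>m (Suc n)"],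
          rule exI[of _ "1\<^sub>m (Suc n)"]) (simp add: True)
  next
    case False
    then obtain s t where st: "s < m" "t < Suc n" "A $$ (s, t) \<noteq> 0"
      using Suc.prems by (metis carrier_matD eq_matI index_zero_mat)
    \<comment> \<open>\<open>\<epsilon> * A\<close> is row \<open>s\<close> of \<open>A\<close>,
      nonzero at \<open>t\<close>. Restricting \<open>A\<close> to the kernel of this row leaves
      \<open>A * B1\<close>, which has one column fewer.\<close>
    define \<epsilon> :: "'k mat" where "\<epsilon> = mat 1 m (\<lambda>(i, j). if j = s then 1 else 0)"
    have \<epsilon>: "\<epsilon> \<in> carrier_mat 1 m" by (simp add: \<epsilon>_def)
    have "(\<epsilon> * A) $$ (0, t) = (\<Sum>l<m. \<epsilon> $$ (0, l) * A $$ (l, t))"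
      using st by (intro mult_index_sum[OF \<epsilon> Suc.prems]) auto
    also have "\<dots> = (\<Sum>l<m. if l = s then A $$ (l, t) else 0)"
      by (intro sum.cong) (auto simp: \<epsilon>_def)
    also have "\<dots> = A $$ (s, t)" using st by (simp add: sum.delta)
    finally have ne: "(\<epsilon> * A) $$ (0, t) \<noteq> 0" using st by simp
    have "\<epsilon> * A \<in> carrier_mat 1 (Suc n)" using \<epsilon> Suc.prems by simp
    then obtain B1 L1 v where c1: "B1 \<in> carrier_mat (Suc n) n" "L1 \<in> carrier_mat n (Suc n)"
      "v \<in> carrier_mat (Suc n) 1" and LB: "L1 * B1 = 1\<^sub>m n" and BL: "B1 * L1 + v * (\<epsilon> * A) = 1\<^sub>m (Suc n)"
      using row_kernel_split[OF _ st(2) ne] by blast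
    have "A * B1 \<in> carrier_mat m n" using Suc.prems c1 by simp
    from Suc.IH[OF this] obtain r G B L where c2: "G \<in> carrier_mat n m" "B \<in> carrier_mat n r"
      "L \<in> carrier_mat r n" and 2: "A * B1 * B = 0\<^sub>m m r" "L * B = 1\<^sub>m r" "B * L + G * (A * B1) = 1\<^sub>m n"
      by blast
    note c = c1 c2 \<epsilon> Suc.prems
    note d = c[THEN carrier_matD(1)] c[THEN carrier_matD(2)]
    \<comment> \<open>Of a vector \<open>x\<close>, the part \<open>v * \<epsilon> * A * x\<close>
      is recovered from row \<open>s\<close>. What remains of \<open>A * x\<close> is
      \<open>A * x - A * v * \<epsilon> * A * x\<close>, which equals
      \<open>A * B1 * (L1 * x)\<close>, and there the generalized inverse \<open>G\<close> of
      \<open>A * B1\<close> takes over.\<close>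
    define G' where "G' = B1 * G * (1\<^sub>m m - A * v * \<epsilon>) + v * \<epsilon>"
    have AvA: "A - A * v * \<epsilon> * A = A * B1 * L1"
    proof -
      have "A = A * (B1 * L1 + v * (\<epsilon> * A))" using d by (simp add: BL mat_dim_simps)
      also have "\<dots> = A * B1 * L1 + A * v * \<epsilon> * A" using d by (simp add: mat_dim_simps)
      finally have e: "A = A * B1 * L1 + A * v * \<epsilon> * A" .
      show ?thesis by (subst (1) e) (rule eq_matI, use d in auto)
    qed
    have "G' * A = B1 * G * ((1\<^sub>m m - A * v * \<epsilon>) * A) + v * \<epsilon> * A"
      using d by (simp add: G'_def mat_dim_simps)
    also have "(1\<^sub>m m - A * v * \<epsilon>) * A = A * B1 * L1"
      using d AvA by (simp add: diff_mult_dim)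
    finally have GA: "G' * A = B1 * G * (A * B1 * L1) + v * \<epsilon> * A" .
    have "(B1 * B) * (L * L1) + G' * A = B1 * ((B * L + G * (A * B1)) * L1) + v * \<epsilon> * A"
      unfolding GA using d by (simp add: mat_dim_simps) (rule eq_matI, auto)
    also have "\<dots> = 1\<^sub>m (Suc n)" using d BL by (simp add: 2 mat_dim_simps)
    finally have r3: "(B1 * B) * (L * L1) + G' * A = 1\<^sub>m (Suc n)" .
    have r1: "A * (B1 * B) = 0\<^sub>m m r" using 2(1) d by (simp add: mat_dim_simps)
    have "(L * L1) * (B1 * B) = L * ((L1 * B1) * B)" using d by (simp add: mult_assoc_dim)
    then have r2: "(L * L1) * (B1 * B) = 1\<^sub>m r" using d by (simp add: LB 2 mat_dim_simps)
    show ?thesis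
      by (rule exI[of _ r], rule exI[of _ G'], rule exI[of _ "B1 * B"], rule exI[of _ "L * L1"])
        (use c r1 r2 r3 in \<open>auto simp: G'_def intro!: carrier_matI\<close>)
  qed
qed

lemma zero_mat_eq:
  "A \<in> carrier_mat m n \<Longrightarrow> B \<in> carrier_mat m n \<Longrightarrow> m = 0 \<or> n = 0 \<Longrightarrow> A = B"
  by (rule eq_matI) auto

lemma zero_add_dim: "dim_row A = m \<Longrightarrow> dim_col A = n \<Longrightarrow> 0\<^sub>m m n + A = (A :: 'a::monoid_add mat)"
  by (rule left_add_zero_mat) (auto intro: carrier_matI)

lemma add_zero_dim: "dim_row A = m \<Longrightarrow> dim_col A = n \<Longrightarrow> A + 0\<^sub>m m n = (A :: 'a::monoid_add mat)"
  by (rule right_add_zero_mat) (auto intro: carrier_matI)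

section \<open>Injective, surjective and bijective matrices\<close>

text \<open>Over a field one-sided inverses amount to injectivity and surjectivity. In this form
  both are used by cancellation, also for empty matrices.\<close>

definition linv :: "'k::field mat \<Rightarrow> bool" where
  "linv A \<longleftrightarrow> (\<exists>N\<in>carrier_mat (dim_col A) (dim_row A). N * A = 1\<^sub>m (dim_col A))"

definition rinv :: "'k::field mat \<Rightarrow> bool" where
  "rinv A \<longleftrightarrow> (\<exists>N\<in>carrier_mat (dim_col A) (dim_row A). A * N = 1\<^sub>m (dim_row A))"

definition bij_mat :: "'k::field mat \<Rightarrow> bool" where
  "bij_mat A \<longleftrightarrow> (\<exists>N\<in>carrier_mat (dim_col A) (dim_row A). N * A = 1\<^sub>m (dim_col A) \<and> A * N = 1\<^sub>m (dim_row A))"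

lemma bij_mat_iff: "bij_mat A \<longleftrightarrow> linv A \<and> rinv A"
proof
  assume "linv A \<and> rinv A"
  then obtain N M where N: "N \<in> carrier_mat (dim_col A) (dim_row A)" "N * A = 1\<^sub>m (dim_col A)"
    and M: "M \<in> carrier_mat (dim_col A) (dim_row A)" "A * M = 1\<^sub>m (dim_row A)"
    unfolding linv_def rinv_def by blast
  have "N = N * (A * M)" using N(1) by (simp add: M(2))
  also have "\<dots> = (N * A) * M" using N(1) M(1) by (simp add: mult_assoc_dim)
  also have "\<dots> = M" using M(1) by (simp add: N(2))
  finally show "bij_mat A" using N M unfolding bij_mat_def by blast
qed (auto simp: bij_mat_def linv_def rinv_def)

lemma bij_mat_one: "bij_mat (1\<^sub>m n)"
  unfolding bij_mat_def by (rule bexI[of _ "1\<^sub>m n"]) auto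

lemma linv_cancel:
  assumes "linv A" "A * B = A * C" "dim_row B = dim_col A" "dim_row C = dim_col A"
  shows "B = C"
proof -
  obtain N where N: "N \<in> carrier_mat (dim_col A) (dim_row A)" "N * A = 1\<^sub>m (dim_col A)"
    using assms(1) by (auto simp: linv_def)
  have "N * (A * B) = B" "N * (A * C) = C"
    using N assms(3,4) by (simp_all flip: mult_assoc_dim)
  then show ?thesis using assms(2) by metis
qed

lemma rinv_cancel:
  assumes "rinv A" "B * A = C * A" "dim_col B = dim_row A" "dim_col C = dim_row A"
  shows "B = C"
proof -
  obtain N where N: "N \<in> carrier_mat (dim_col A) (dim_row A)" "A * N = 1\<^sub>m (dim_row A)"
    using assms(1) by (auto simp: rinv_def)
  have "(B * A) * N = B" "(C * A) * N = C"
    using N assms(3,4) by (simp_all add: mult_assoc_dim)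
  then show ?thesis using assms(2) by metis
qed

lemma bij_mat_mult:
  assumes "bij_mat A" "bij_mat B" "dim_col A = dim_row B"
  shows "bij_mat (A * B)"
proof -
  obtain M N where M: "M \<in> carrier_mat (dim_col A) (dim_row A)" "M * A = 1\<^sub>m (dim_col A)" "A * M = 1\<^sub>m (dim_row A)"
    and N: "N \<in> carrier_mat (dim_col B) (dim_row B)" "N * B = 1\<^sub>m (dim_col B)" "B * N = 1\<^sub>m (dim_row B)"
    using assms(1,2) by (auto simp: bij_mat_def)
  have "(N * M) * (A * B) = N * ((M * A) * B)" "(A * B) * (N * M) = A * ((B * N) * M)"
    using M(1) N(1) assms(3) by (simp_all add: mult_assoc_dim)
  then have "(N * M) * (A * B) = 1\<^sub>m (dim_col B)" "(A * B) * (N * M) = 1\<^sub>m (dim_row A)"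
    using M(1) N(1) assms(3) by (simp_all add: M(2,3) N(2,3))
  then show ?thesis unfolding bij_mat_def
    by (intro bexI[of _ "N * M"]) (use M(1) N(1) assms(3) in \<open>auto intro!: carrier_matI\<close>)
qed

lemma bij_mat_inverse:
  assumes "bij_mat A"
  obtains N where "bij_mat N" "N \<in> carrier_mat (dim_col A) (dim_row A)"
    "N * A = 1\<^sub>m (dim_col A)" "A * N = 1\<^sub>m (dim_row A)"
proof -
  obtain N where N: "N \<in> carrier_mat (dim_col A) (dim_row A)" "N * A = 1\<^sub>m (dim_col A)" "A * N = 1\<^sub>m (dim_row A)"
    using assms by (auto simp: bij_mat_def)
  moreover have "bij_mat N" unfolding bij_mat_def
    by (rule bexI[of _ A]) (use N in \<open>auto intro!: carrier_matI\<close>)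
  ultimately show ?thesis using that by blast
qed

lemma bij_mat_cancel_right:
  assumes "bij_mat (A * B)" "bij_mat B" "dim_col A = dim_row B"
  shows "bij_mat A"
proof -
  obtain N where N: "bij_mat N" "N \<in> carrier_mat (dim_col B) (dim_row B)" "B * N = 1\<^sub>m (dim_row B)"
    using bij_mat_inverse[OF assms(2)] by metis
  have "bij_mat ((A * B) * N)" by (rule bij_mat_mult[OF assms(1) N(1)]) (use N in simp)
  moreover have "(A * B) * N = A" using N assms(3) by (simp add: mult_assoc_dim)
  ultimately show ?thesis by (simp only:)
qed

lemma bij_mat_cancel_left:
  assumes "bij_mat (A * B)" "bij_mat A" "dim_col A = dim_row B"
  shows "bij_mat B"
proof -
  obtain N where N: "bij_mat N" "N \<in> carrier_mat (dim_col A) (dim_row A)" "N * A = 1\<^sub>m (dim_col A)"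
    using bij_mat_inverse[OF assms(2)] by metis
  have "bij_mat (N * (A * B))" by (rule bij_mat_mult[OF N(1) assms(1)]) (use N in simp)
  moreover have "N * (A * B) = B" using N assms(3) by (simp flip: mult_assoc_dim)
  ultimately show ?thesis by (simp only:)
qed

text \<open>Applied to the unit rows, the hypothesis yields the rows of a left inverse. Vanishing of
  Ext delivers injectivity in this form, as a factorization of every functional.\<close>

lemma linvI_rows:
  fixes A :: "'k::field mat"
  assumes A: "A \<in> carrier_mat m n"
    and rows: "\<And>\<rho>. \<rho> \<in> carrier_mat 1 n \<Longrightarrow> \<exists>s\<in>carrier_mat 1 m. \<rho> = s * A"
  shows "linv A"
proof -
  define u :: "nat \<Rightarrow> 'k mat" where "u i = mat 1 n (\<lambda>(a, j). if j = i then 1 else 0)" for i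
  have "\<exists>s\<in>carrier_mat 1 m. u i = s * A" for i by (rule rows) (simp add: u_def)
  then obtain s where s: "\<And>i. s i \<in> carrier_mat 1 m" "\<And>i. u i = s i * A" by metis
  define N where "N = mat n m (\<lambda>(i, j). s i $$ (0, j))"
  have N: "N \<in> carrier_mat n m" by (simp add: N_def)
  have "N * A = 1\<^sub>m n"
  proof (rule eq_matI)
    fix i j assume "i < dim_row (1\<^sub>m n :: 'k mat)" "j < dim_col (1\<^sub>m n :: 'k mat)"
    then have ij: "i < n" "j < n" by auto
    have "(N * A) $$ (i, j) = (\<Sum>l<m. N $$ (i, l) * A $$ (l, j))"
      by (rule mult_index_sum[OF N A ij])
    also have "\<dots> = (\<Sum>l<m. s i $$ (0, l) * A $$ (l, j))"
      by (intro sum.cong) (use ij in \<open>auto simp: N_def\<close>)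
    also have "\<dots> = (s i * A) $$ (0, j)" using mult_index_sum[OF s(1) A _ ij(2), of 0] by simp
    also have "\<dots> = 1\<^sub>m n $$ (i, j)" using ij by (simp add: s(2)[symmetric] u_def)
    finally show "(N * A) $$ (i, j) = 1\<^sub>m n $$ (i, j)" .
  qed (use N A in auto)
  then show ?thesis using A N by (auto simp: linv_def)
qed

text \<open>The matrix \<open>B\<close> of \<open>kernel_split\<close> has kernel vectors as
  columns, so it is zero, and the splitting of the identity reduces to \<open>G * A\<close>.\<close>

lemma linvI_kernel:
  fixes A :: "'k::field mat"
  assumes A: "A \<in> carrier_mat m n"
    and ker: "\<And>v. v \<in> carrier_mat n 1 \<Longrightarrow> A * v = 0\<^sub>m m 1 \<Longrightarrow> v = 0\<^sub>m n 1"
  shows "linv A"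
proof -
  obtain r G B L where c: "G \<in> carrier_mat n m" "B \<in> carrier_mat n r" "L \<in> carrier_mat r n"
    and *: "A * B = 0\<^sub>m m r" "B * L + G * A = 1\<^sub>m n"
    using kernel_split[OF A] by blast
  have "B = 0\<^sub>m n r"
  proof (rule eq_matI)
    fix i j assume "i < dim_row (0\<^sub>m n r :: 'k mat)" "j < dim_col (0\<^sub>m n r :: 'k mat)"
    then have ij: "i < n" "j < r" by auto
    define v where "v = mat n 1 (\<lambda>(a, _). B $$ (a, j))"
    have v: "v \<in> carrier_mat n 1" by (simp add: v_def)
    have "A * v = 0\<^sub>m m 1"
    proof (rule eq_matI)
      fix a b assume ab: "a < dim_row (0\<^sub>m m 1 :: 'k mat)" "b < dim_col (0\<^sub>m m 1 :: 'k mat)"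
      have "(A * v) $$ (a, b) = (\<Sum>l<n. A $$ (a, l) * v $$ (l, b))"
        using ab by (intro mult_index_sum[OF A v]) auto
      also have "\<dots> = (\<Sum>l<n. A $$ (a, l) * B $$ (l, j))"
        using ab by (intro sum.cong) (auto simp: v_def)
      also have "\<dots> = (A * B) $$ (a, j)" using mult_index_sum[OF A c(2) _ ij(2), of a] ab by simp
      finally show "(A * v) $$ (a, b) = 0\<^sub>m m 1 $$ (a, b)" using * ab ij by simp
    qed (use A v in auto)
    then have "v $$ (i, 0) = 0" using ker[OF v] ij by simp
    then show "B $$ (i, j) = 0\<^sub>m n r $$ (i, j)" using ij by (simp add: v_def)
  qed (use c in auto)
  then have "G * A = 1\<^sub>m n" using * c A by (simp add: zero_mult_dim zero_add_dim)
  then show ?thesis using c A by (auto simp: linv_def)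
qed

lemma rinvI_cokernel:
  fixes A :: "'k::field mat"
  assumes A: "A \<in> carrier_mat m n"
    and coker: "\<And>c. c \<in> carrier_mat 1 m \<Longrightarrow> c * A = 0\<^sub>m 1 n \<Longrightarrow> c = 0\<^sub>m 1 m"
  shows "rinv A"
proof -
  have AT: "A\<^sup>T \<in> carrier_mat n m" using A by simp
  have "linv A\<^sup>T"
  proof (rule linvI_kernel[OF AT])
    fix v :: "'k mat" assume v: "v \<in> carrier_mat m 1" "A\<^sup>T * v = 0\<^sub>m n 1"
    have "v\<^sup>T * A = (A\<^sup>T * v)\<^sup>T" by (subst transpose_mult[OF AT v(1)]) simp
    also have "\<dots> = 0\<^sub>m 1 n" using v by simp
    finally have "v\<^sup>T = 0\<^sub>m 1 m" by (rule coker[rotated]) (use v in simp)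
    then have "v\<^sup>T\<^sup>T = 0\<^sub>m m 1" by simp
    then show "v = 0\<^sub>m m 1" by simp
  qed
  then obtain N where N: "N \<in> carrier_mat m n" "N * A\<^sup>T = 1\<^sub>m m"
    using A by (auto simp: linv_def)
  have "A * N\<^sup>T = (N * A\<^sup>T)\<^sup>T" by (subst transpose_mult[OF N(1) AT]) simp
  then have "A * N\<^sup>T = 1\<^sub>m m" using N by simp
  then show ?thesis using A N unfolding rinv_def by (intro bexI[of _ "N\<^sup>T"]) auto
qed

section \<open>Biproduct calculus for block matrices\<close>

text \<open>Injections and projections of a direct sum of spaces of dimensions \<open>a\<close> and
  \<open>b\<close>, as block matrices with empty blocks. Computations with direct sums then reduce
  to the biproduct identities.\<close>

definition inl :: "nat \<Rightarrow> nat \<Rightarrow> 'k::field mat" where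
  "inl a b = four_block_mat (1\<^sub>m a) (0\<^sub>m a 0) (0\<^sub>m b a) (0\<^sub>m b 0)"

definition inr :: "nat \<Rightarrow> nat \<Rightarrow> 'k::field mat" where
  "inr a b = four_block_mat (0\<^sub>m a b) (0\<^sub>m a 0) (1\<^sub>m b) (0\<^sub>m b 0)"

definition prl :: "nat \<Rightarrow> nat \<Rightarrow> 'k::field mat" where
  "prl a b = four_block_mat (1\<^sub>m a) (0\<^sub>m a b) (0\<^sub>m 0 a) (0\<^sub>m 0 b)"

definition prr :: "nat \<Rightarrow> nat \<Rightarrow> 'k::field mat" where
  "prr a b = four_block_mat (0\<^sub>m b a) (1\<^sub>m b) (0\<^sub>m 0 a) (0\<^sub>m 0 b)"

lemma block_dims [simp]:
  "dim_row (inl a b) = a + b" "dim_col (inl a b) = a"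
  "dim_row (inr a b) = a + b" "dim_col (inr a b) = b"
  "dim_row (prl a b) = a" "dim_col (prl a b) = a + b"
  "dim_row (prr a b) = b" "dim_col (prr a b) = a + b"
  by (simp_all add: inl_def inr_def prl_def prr_def)

lemma four_block_empty_blocks:
  "A \<in> carrier_mat a b \<Longrightarrow> four_block_mat A (0\<^sub>m a 0) (0\<^sub>m 0 b) (0\<^sub>m 0 0) = A"
  by (rule eq_matI) auto

lemma block_orth:
  "prl a b * inl a b = (1\<^sub>m a :: 'k::field mat)" "prr a b * inr a b = (1\<^sub>m b :: 'k mat)"
  "prl a b * inr a b = (0\<^sub>m a b :: 'k mat)" "prr a b * inl a b = (0\<^sub>m b a :: 'k mat)"
  unfolding inl_def inr_def prl_def prr_def
  by (subst mult_four_block_mat; force intro!: eq_matI)+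

lemma block_sum: "inl a b * prl a b + inr a b * prr a b = (1\<^sub>m (a + b) :: 'k::field mat)"
proof -
  have "inl a b * prl a b = four_block_mat (1\<^sub>m a) (0\<^sub>m a b) (0\<^sub>m b a) (0\<^sub>m b b :: 'k mat)"
    unfolding inl_def prl_def by (subst mult_four_block_mat[of _ a a _ 0 _ b]) (auto intro!: eq_matI)
  moreover have "inr a b * prr a b = four_block_mat (0\<^sub>m a a) (0\<^sub>m a b) (0\<^sub>m b a) (1\<^sub>m b :: 'k mat)"
    unfolding inr_def prr_def by (subst mult_four_block_mat[of _ a b _ 0 _ b]) (auto intro!: eq_matI)
  ultimately show ?thesis by (auto intro!: eq_matI)
qed

lemma block_orth_mult:
  fixes X :: "'k::field mat"
  shows "dim_row X = a \<Longrightarrow> prl a b * (inl a b * X) = X"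
    "dim_row X = b \<Longrightarrow> prr a b * (inr a b * X) = X"
    "dim_row X = b \<Longrightarrow> prl a b * (inr a b * X) = 0\<^sub>m a (dim_col X)"
    "dim_row X = a \<Longrightarrow> prr a b * (inl a b * X) = 0\<^sub>m b (dim_col X)"
  by (simp_all add: block_orth zero_mult_dim flip: mult_assoc_dim)

text \<open>The link from the block form in \<open>direct_sum\<close> to the biproduct calculus:
  split the identity on the right by \<open>block_sum\<close> and evaluate on the two
  injections.\<close>

lemma four_block_decomp:
  fixes A :: "'k::field mat"
  assumes "A \<in> carrier_mat a c" "B \<in> carrier_mat a d" "C \<in> carrier_mat b c" "D \<in> carrier_mat b d"
  shows "four_block_mat A B C D = inl a b * A * prl c d + inl a b * B * prr c d
    + inr a b * C * prl c d + inr a b * D * prr c d"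
proof -
  let ?F = "four_block_mat A B C D"
  have 1: "?F * inl c d = inl a b * A + inr a b * C"
  proof -
    have "?F * inl c d = four_block_mat A (0\<^sub>m a 0) C (0\<^sub>m b 0)"
      unfolding inl_def by (subst mult_four_block_mat[of _ a c _ d _ b]) (use assms in auto)
    moreover have "A = four_block_mat A (0\<^sub>m a 0) (0\<^sub>m 0 c) (0\<^sub>m 0 0)"
      "C = four_block_mat C (0\<^sub>m b 0) (0\<^sub>m 0 c) (0\<^sub>m 0 0)"
      using assms by (simp_all add: four_block_empty_blocks)
    moreover have "inl a b * four_block_mat A (0\<^sub>m a 0) (0\<^sub>m 0 c) (0\<^sub>m 0 0)
      = four_block_mat A (0\<^sub>m a 0) (0\<^sub>m b c) (0\<^sub>m b 0)"
      unfolding inl_def by (subst mult_four_block_mat[of _ a a _ 0 _ b]) (use assms in \<open>auto intro!: eq_matI\<close>)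
    moreover have "inr a b * four_block_mat C (0\<^sub>m b 0) (0\<^sub>m 0 c) (0\<^sub>m 0 0)
      = four_block_mat (0\<^sub>m a c) (0\<^sub>m a 0) C (0\<^sub>m b 0)"
      unfolding inr_def by (subst mult_four_block_mat[of _ a b _ 0 _ b]) (use assms in \<open>auto intro!: eq_matI\<close>)
    ultimately show ?thesis using assms by (auto intro!: eq_matI)
  qed
  have 2: "?F * inr c d = inl a b * B + inr a b * D"
  proof -
    have "?F * inr c d = four_block_mat B (0\<^sub>m a 0) D (0\<^sub>m b 0)"
      unfolding inr_def by (subst mult_four_block_mat[of _ a c _ d _ b]) (use assms in auto)
    moreover have "B = four_block_mat B (0\<^sub>m a 0) (0\<^sub>m 0 d) (0\<^sub>m 0 0)"
      "D = four_block_mat D (0\<^sub>m b 0) (0\<^sub>m 0 d) (0\<^sub>m 0 0)"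
      using assms by (simp_all add: four_block_empty_blocks)
    moreover have "inl a b * four_block_mat B (0\<^sub>m a 0) (0\<^sub>m 0 d) (0\<^sub>m 0 0)
      = four_block_mat B (0\<^sub>m a 0) (0\<^sub>m b d) (0\<^sub>m b 0)"
      unfolding inl_def by (subst mult_four_block_mat[of _ a a _ 0 _ b]) (use assms in \<open>auto intro!: eq_matI\<close>)
    moreover have "inr a b * four_block_mat D (0\<^sub>m b 0) (0\<^sub>m 0 d) (0\<^sub>m 0 0)
      = four_block_mat (0\<^sub>m a d) (0\<^sub>m a 0) D (0\<^sub>m b 0)"
      unfolding inr_def by (subst mult_four_block_mat[of _ a b _ 0 _ b]) (use assms in \<open>auto intro!: eq_matI\<close>)
    ultimately show ?thesis using assms by (auto intro!: eq_matI)
  qed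
  have "?F = ?F * (inl c d * prl c d + inr c d * prr c d)" using assms by (simp add: block_sum)
  also have "\<dots> = (?F * inl c d) * prl c d + (?F * inr c d) * prr c d"
    using assms by (simp add: mat_dim_simps)
  also have "\<dots> = inl a b * A * prl c d + inl a b * B * prr c d
    + inr a b * C * prl c d + inr a b * D * prr c d"
    unfolding 1 2 using assms by (simp add: mat_dim_simps) (rule eq_matI, auto)
  finally show ?thesis .
qed

section \<open>Homomorphisms and extensions as families of matrices\<close>

text \<open>Adjoining a zero space at vertex \<open>0\<close> treats the strands \<open>c(0,j)\<close> like all others.\<close>

definition sdim :: "'k::field quiver_rep \<Rightarrow> nat \<Rightarrow> nat" where
  "sdim V x = (if x = 0 then 0 else dimv V x)"

definition sact :: "'k::field quiver_rep \<Rightarrow> nat \<Rightarrow> 'k mat" where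
  "sact V x = (if x = 0 then 0\<^sub>m (dimv V 1) 0 else act V x)"

lemma sdim_0 [simp]: "sdim V 0 = 0"
  by (simp add: sdim_def)

lemma sact_carrier: "is_rep n V \<Longrightarrow> x < n \<Longrightarrow> sact V x \<in> carrier_mat (sdim V (Suc x)) (sdim V x)"
  by (auto simp: is_rep_def sact_def sdim_def)

lemma sact_dims:
  assumes "is_rep n V" "x < n"
  shows "dim_row (sact V x) = sdim V (Suc x)" "dim_col (sact V x) = sdim V x"
  using sact_carrier[OF assms] by auto

definition hom_fam ::
    "nat \<Rightarrow> 'k::field quiver_rep \<Rightarrow> 'k quiver_rep \<Rightarrow> (nat \<Rightarrow> 'k mat) \<Rightarrow> bool" where
  "hom_fam n V W f \<longleftrightarrow> (\<forall>x\<le>n. f x \<in> carrier_mat (sdim W x) (sdim V x)) \<and>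
     (\<forall>x<n. f (Suc x) * sact V x = sact W x * f x)"

lemma hom_fam_carrier: "hom_fam n V W f \<Longrightarrow> x \<le> n \<Longrightarrow> f x \<in> carrier_mat (sdim W x) (sdim V x)"
  by (simp add: hom_fam_def)

lemma hom_fam_dims:
  assumes "hom_fam n V W f" "x \<le> n"
  shows "dim_row (f x) = sdim W x" "dim_col (f x) = sdim V x"
  using hom_fam_carrier[OF assms] by auto

lemma hom_fam_commute: "hom_fam n V W f \<Longrightarrow> x < n \<Longrightarrow> f (Suc x) * sact V x = sact W x * f x"
  by (simp add: hom_fam_def)

lemma hom_fam_morphism: "hom_fam n V W f \<Longrightarrow> morphism n V W f"
  unfolding hom_fam_def morphism_def sdim_def sact_def by fastforce

text \<open>The value of a morphism at vertex \<open>0\<close> is junk. Overwriting it by the empty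
  matrix gives a map between the adjoined zero spaces, and the square over the arrow from
  \<open>0\<close> to \<open>1\<close> has no columns.\<close>

lemma morphism_hom_fam:
  assumes "is_rep n V" "is_rep n W" "morphism n V W f"
  shows "hom_fam n V W (f(0 := 0\<^sub>m 0 0))"
  unfolding hom_fam_def
proof (intro conjI allI impI)
  show "(f(0 := 0\<^sub>m 0 0)) x \<in> carrier_mat (sdim W x) (sdim V x)" if "x \<le> n" for x
    using that assms(3) by (auto simp: sdim_def morphism_def)
  show "(f(0 := 0\<^sub>m 0 0)) (Suc x) * sact V x = sact W x * (f(0 := 0\<^sub>m 0 0)) x" if "x < n" for x
  proof (cases "x = 0")
    case True
    have "f 1 \<in> carrier_mat (dimv W 1) (dimv V 1)" using assms(3) that by (auto simp: morphism_def)
    then show ?thesis using True by (intro zero_mat_eq[of _ "dimv W 1" 0]) (auto simp: sact_def)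
  next
    case False
    then show ?thesis using assms(3) that by (auto simp: sact_def morphism_def)
  qed
qed

lemma hom_fam_comp:
  assumes "is_rep n U" "is_rep n V" "is_rep n W" "hom_fam n U V f" "hom_fam n V W g"
  shows "hom_fam n U W (\<lambda>x. g x * f x)"
  unfolding hom_fam_def
proof (intro conjI allI impI)
  show "g x * f x \<in> carrier_mat (sdim W x) (sdim U x)" if "x \<le> n" for x
    using that assms hom_fam_carrier by (metis mult_carrier_mat)
  fix x assume x: "x < n"
  note d = hom_fam_dims[OF assms(4), of x] hom_fam_dims[OF assms(4), of "Suc x"]
    hom_fam_dims[OF assms(5), of x] hom_fam_dims[OF assms(5), of "Suc x"]
    sact_dims[OF assms(1) x] sact_dims[OF assms(2) x] sact_dims[OF assms(3) x]
  have "g (Suc x) * f (Suc x) * sact U x = g (Suc x) * (sact V x * f x)"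
    using d x by (simp add: mult_assoc_dim hom_fam_commute[OF assms(4)])
  also have "\<dots> = g (Suc x) * sact V x * f x" using d x by (simp add: mult_assoc_dim)
  also have "\<dots> = sact W x * (g x * f x)"
    using d x by (simp add: mult_assoc_dim hom_fam_commute[OF assms(5)])
  finally show "g (Suc x) * f (Suc x) * sact U x = sact W x * (g x * f x)" .
qed

lemma hom_fam_inverse:
  assumes "is_rep n U" "is_rep n V" "hom_fam n U V f"
    and g: "\<And>x. x \<le> n \<Longrightarrow> g x \<in> carrier_mat (sdim U x) (sdim V x)"
    and inv: "\<And>x. x \<le> n \<Longrightarrow> g x * f x = 1\<^sub>m (sdim U x)" "\<And>x. x \<le> n \<Longrightarrow> f x * g x = 1\<^sub>m (sdim V x)"
  shows "hom_fam n V U g"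
  unfolding hom_fam_def
proof (intro conjI allI impI)
  fix x assume x: "x < n"
  note d = hom_fam_dims[OF assms(3), of x] hom_fam_dims[OF assms(3), of "Suc x"]
    carrier_matD[OF g, of x] carrier_matD[OF g, of "Suc x"]
    sact_dims[OF assms(1) x] sact_dims[OF assms(2) x]
  have "g (Suc x) * sact V x = g (Suc x) * (sact V x * (f x * g x))" using d x by (simp add: inv)
  also have "\<dots> = g (Suc x) * ((sact V x * f x) * g x)" using d x by (simp add: mult_assoc_dim)
  also have "sact V x * f x = f (Suc x) * sact U x" using hom_fam_commute[OF assms(3) x] by simp
  also have "g (Suc x) * (f (Suc x) * sact U x * g x) = (g (Suc x) * f (Suc x)) * (sact U x * g x)"
    using d x by (simp add: mult_assoc_dim)
  also have "\<dots> = sact U x * g x" using d x by (simp add: inv)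
  finally show "g (Suc x) * sact V x = sact U x * g x" .
qed (use g in auto)

lemma hom_fam_one: "is_rep n V \<Longrightarrow> hom_fam n V V (\<lambda>x. 1\<^sub>m (sdim V x))"
  by (auto simp: hom_fam_def sact_dims)

section \<open>Retracts and isomorphisms\<close>

text \<open>One notion for isomorphic copies and for direct summands: vanishing of Hom and Ext
  passes to retracts in either argument.\<close>

definition retract_of :: "nat \<Rightarrow> 'k::field quiver_rep \<Rightarrow> 'k quiver_rep \<Rightarrow> bool" where
  "retract_of n V W \<longleftrightarrow> (\<exists>\<iota> \<pi>. hom_fam n V W \<iota> \<and> hom_fam n W V \<pi> \<and> (\<forall>x\<le>n. \<pi> x * \<iota> x = 1\<^sub>m (sdim V x)))"

lemma rep_isoE:
  assumes "is_rep n V" "is_rep n W" "rep_iso n V W"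
  obtains f g where "hom_fam n V W f" "hom_fam n W V g"
    "\<And>x. x \<le> n \<Longrightarrow> g x * f x = 1\<^sub>m (sdim V x)" "\<And>x. x \<le> n \<Longrightarrow> f x * g x = 1\<^sub>m (sdim W x)"
proof -
  obtain f g where fg: "morphism n V W f" "morphism n W V g"
    "mor_eq n (mor_comp g f) (id_mor V)" "mor_eq n (mor_comp f g) (id_mor W)"
    using assms(3) by (auto simp: rep_iso_def)
  have "(g(0 := 0\<^sub>m 0 0)) x * (f(0 := 0\<^sub>m 0 0)) x = 1\<^sub>m (sdim V x)"
    "(f(0 := 0\<^sub>m 0 0)) x * (g(0 := 0\<^sub>m 0 0)) x = 1\<^sub>m (sdim W x)" if "x \<le> n" for x
    using fg(3,4) that by (auto simp: mor_eq_def mor_comp_def id_mor_def sdim_def)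
  then show ?thesis
    using that morphism_hom_fam[OF assms(1,2) fg(1)] morphism_hom_fam[OF assms(2,1) fg(2)] by blast
qed

lemma rep_isoI:
  assumes "hom_fam n V W f" "hom_fam n W V g"
    and "\<And>x. x \<le> n \<Longrightarrow> g x * f x = 1\<^sub>m (sdim V x)" "\<And>x. x \<le> n \<Longrightarrow> f x * g x = 1\<^sub>m (sdim W x)"
  shows "rep_iso n V W"
  unfolding rep_iso_def
  by (rule exI[of _ f], rule exI[of _ g])
    (use assms hom_fam_morphism in \<open>auto simp: mor_eq_def mor_comp_def id_mor_def sdim_def\<close>)

lemma rep_iso_retract:
  assumes "is_rep n V" "is_rep n W" "rep_iso n V W"
  shows "retract_of n V W" "retract_of n W V"
  using rep_isoE[OF assms] unfolding retract_of_def by metis+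

text \<open>\<open>c\<close> is the upper right block of the structure maps of an extension of \<open>V\<close> by \<open>W\<close>,
  and \<open>s\<close> the corresponding block of a section.\<close>

definition cosplit :: "nat \<Rightarrow> 'k::field quiver_rep \<Rightarrow> 'k quiver_rep \<Rightarrow> bool" where
  "cosplit n V W \<longleftrightarrow> (\<forall>c. (\<forall>x<n. c x \<in> carrier_mat (sdim W (Suc x)) (sdim V x)) \<longrightarrow>
     (\<exists>s. (\<forall>x\<le>n. s x \<in> carrier_mat (sdim W x) (sdim V x)) \<and>
          (\<forall>x<n. c x = s (Suc x) * sact V x - sact W x * s x)))"

section \<open>Yoneda extensions and the cocycle equation\<close>

lemma split_exact_level:
  fixes f g p q :: "'k::field mat"
  assumes c: "f \<in> carrier_mat e w" "g \<in> carrier_mat v e" "p \<in> carrier_mat w e" "q \<in> carrier_mat e v"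
    and pf: "p * f = 1\<^sub>m w" and gf: "g * f = 0\<^sub>m v w" and gq: "g * q = 1\<^sub>m v" and sum: "f * p + q * g = 1\<^sub>m e"
  shows "mat_kernel f = {0\<^sub>v w}" "(\<lambda>v. f *\<^sub>v v) ` carrier_vec w = mat_kernel g"
    "(\<lambda>v. g *\<^sub>v v) ` carrier_vec e = carrier_vec v"
proof -
  have "u = 0\<^sub>v w" if "u \<in> carrier_vec w" "f *\<^sub>v u = 0\<^sub>v e" for u
  proof -
    have "u = (p * f) *\<^sub>v u" using that by (simp add: pf)
    also have "\<dots> = p *\<^sub>v (f *\<^sub>v u)" using c that by (simp add: assoc_mult_mat_vec)
    also have "\<dots> = 0\<^sub>v w" unfolding that(2) using c by auto
    finally show ?thesis .
  qed
  then show "mat_kernel f = {0\<^sub>v w}" using c by (auto simp: mat_kernel[OF c(1)])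
  show "(\<lambda>v. f *\<^sub>v v) ` carrier_vec w = mat_kernel g"
  proof
    show "(\<lambda>v. f *\<^sub>v v) ` carrier_vec w \<subseteq> mat_kernel g"
    proof
      fix y assume "y \<in> (\<lambda>v. f *\<^sub>v v) ` carrier_vec w"
      then obtain u where u: "u \<in> carrier_vec w" "y = f *\<^sub>v u" by blast
      have "g *\<^sub>v y = (g * f) *\<^sub>v u" using c u by (simp add: assoc_mult_mat_vec)
      moreover have "0\<^sub>m v w *\<^sub>v u = 0\<^sub>v v" using u by (intro eq_vecI) auto
      ultimately show "y \<in> mat_kernel g" using c u by (simp add: mat_kernel[OF c(2)] gf)
    qed
    show "mat_kernel g \<subseteq> (\<lambda>v. f *\<^sub>v v) ` carrier_vec w"
    proof
      fix y assume "y \<in> mat_kernel g"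
      then have y: "y \<in> carrier_vec e" "g *\<^sub>v y = 0\<^sub>v v" by (auto simp: mat_kernel[OF c(2)])
      have "y = (f * p + q * g) *\<^sub>v y" using y by (simp add: sum)
      also have "\<dots> = (f * p) *\<^sub>v y + (q * g) *\<^sub>v y"
        by (rule add_mult_distrib_mat_vec[of _ e e]) (use c y in auto)
      also have "\<dots> = f *\<^sub>v (p *\<^sub>v y) + q *\<^sub>v (g *\<^sub>v y)" using c y by (simp add: assoc_mult_mat_vec)
      also have "\<dots> = f *\<^sub>v (p *\<^sub>v y)" unfolding y(2) using c y by auto
      finally show "y \<in> (\<lambda>v. f *\<^sub>v v) ` carrier_vec w" using c y
        by (metis imageI mult_mat_vec_carrier)
    qed
  qed
  show "(\<lambda>v. g *\<^sub>v v) ` carrier_vec e = carrier_vec v"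
  proof
    show "carrier_vec v \<subseteq> (\<lambda>v. g *\<^sub>v v) ` carrier_vec e"
    proof
      fix y :: "'k vec" assume y: "y \<in> carrier_vec v"
      have "y = g *\<^sub>v (q *\<^sub>v y)" using c y by (simp add: gq flip: assoc_mult_mat_vec)
      then show "y \<in> (\<lambda>v. g *\<^sub>v v) ` carrier_vec e" using c y by (metis imageI mult_mat_vec_carrier)
    qed
  qed (use c in auto)
qed

text \<open>\<open>p\<close> is a left inverse of the injective \<open>f\<close>, and the columns of
  \<open>q\<close> are preimages of unit vectors under \<open>g\<close>. The two choices are
  independent and need not decompose the identity; for every choice, however, \<open>f * p\<close>
  fixes the matrices annihilated by \<open>g\<close>.\<close>

lemma exact_level_split:
  fixes f g :: "'k::field mat"
  assumes c: "f \<in> carrier_mat e w" "g \<in> carrier_mat v e"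
    and ex: "mat_kernel f = {0\<^sub>v w}" "(\<lambda>v. f *\<^sub>v v) ` carrier_vec w = mat_kernel g"
    "(\<lambda>v. g *\<^sub>v v) ` carrier_vec e = carrier_vec v"
  shows "\<exists>p q. p \<in> carrier_mat w e \<and> q \<in> carrier_mat e v \<and> g * q = 1\<^sub>m v \<and> g * f = 0\<^sub>m v w \<and>
    (\<forall>k. \<forall>B\<in>carrier_mat e k. g * B = 0\<^sub>m v k \<longrightarrow> f * (p * B) = B)"
proof -
  have "linv f"
  proof (rule linvI_kernel[OF c(1)])
    fix u :: "'k mat" assume u: "u \<in> carrier_mat w 1" "f * u = 0\<^sub>m e 1"
    have "f *\<^sub>v col u 0 = col (f * u) 0" using col_mult2[OF c(1) u(1)] by simp
    then have "col u 0 \<in> mat_kernel f" using u by (auto simp: mat_kernel[OF c(1)])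
    then have "col u 0 = 0\<^sub>v w" using ex(1) by simp
    then show "u = 0\<^sub>m w 1" using u by (intro mat_col_eqI) auto
  qed
  then obtain p where p: "p \<in> carrier_mat w e" "p * f = 1\<^sub>m w" using c by (auto simp: linv_def)
  have "\<exists>a\<in>carrier_vec e. g *\<^sub>v a = unit_vec v j" for j
    using ex(3) unit_vec_carrier[of v j] by (metis imageE)
  then obtain a where a: "\<And>j. a j \<in> carrier_vec e" "\<And>j. g *\<^sub>v a j = unit_vec v j" by metis
  define q where "q = mat e v (\<lambda>(i, j). a j $ i)"
  have q: "q \<in> carrier_mat e v" by (simp add: q_def)
  have colq: "col q j = a j" if "j < v" for j
    using that a(1)[of j] by (intro eq_vecI) (auto simp: q_def)
  have "g * q = 1\<^sub>m v"
  proof (rule mat_col_eqI)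
    fix j assume "j < dim_col (1\<^sub>m v :: 'k mat)"
    then have j: "j < v" by simp
    have "col (g * q) j = g *\<^sub>v col q j" by (rule col_mult2[OF c(2) q j])
    also have "\<dots> = unit_vec v j" by (simp only: colq[OF j] a(2))
    also have "\<dots> = col (1\<^sub>m v) j" using j by simp
    finally show "col (g * q) j = col (1\<^sub>m v) j" .
  qed (use c q in auto)
  moreover have "g * f = 0\<^sub>m v w"
  proof (rule mat_col_eqI)
    fix j assume "j < dim_col (0\<^sub>m v w :: 'k mat)"
    then have j: "j < w" by simp
    have "f *\<^sub>v unit_vec w j \<in> mat_kernel g" using ex(2) by auto
    moreover have "f *\<^sub>v unit_vec w j = col f j" using c j by (intro eq_vecI) auto
    ultimately show "col (g * f) j = col (0\<^sub>m v w) j"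
      using j by (simp add: col_mult2[OF c(2,1)] mat_kernel[OF c(2)])
  qed (use c in auto)
  moreover have "f * (p * B) = B" if B: "B \<in> carrier_mat e k" "g * B = 0\<^sub>m v k" for k B
  proof (rule mat_col_eqI)
    fix j assume "j < dim_col B"
    then have j: "j < k" using B by simp
    have "g *\<^sub>v col B j = 0\<^sub>v v" using col_mult2[OF c(2) B(1) j] B(2) j by simp
    moreover have cB: "col B j \<in> carrier_vec e" using B by auto
    ultimately have "col B j \<in> mat_kernel g" by (auto simp: mat_kernel[OF c(2)])
    then obtain u where u: "u \<in> carrier_vec w" "col B j = f *\<^sub>v u" using ex(2) by blast
    have "col (f * (p * B)) j = f *\<^sub>v (p *\<^sub>v col B j)"
      using col_mult2[OF c(1) mult_carrier_mat[OF p(1) B(1)] j] col_mult2[OF p(1) B(1) j] by simp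
    also have "p *\<^sub>v col B j = (p * f) *\<^sub>v u" unfolding u(2) by (rule assoc_mult_mat_vec[OF p(1) c(1) u(1), symmetric])
    also have "\<dots> = u" using u by (simp add: p(2))
    finally show "col (f * (p * B)) j = col B j" using u by simp
  qed (use c B p in auto)
  ultimately show ?thesis using p q by blast
qed

lemma diff_self_dim: "dim_row A = m \<Longrightarrow> dim_col A = n \<Longrightarrow> A - A = 0\<^sub>m m (n :: nat)" for A :: "'a::group_add mat"
  by (rule eq_matI) auto

text \<open>The cocycle \<open>c\<close> becomes the corner of block triangular structure maps. The
  component in \<open>W\<close> of a section of this extension solves the cocycle equation.\<close>

lemma ext1_vanishes_cosplit:
  fixes V W :: "'k::field quiver_rep"
  assumes V: "is_rep n V" and W: "is_rep n W" and ext: "ext1_vanishes n V W"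
  shows "cosplit n V W"
  unfolding cosplit_def
proof (intro allI impI)
  fix c :: "nat \<Rightarrow> 'k mat" assume c: "\<forall>x<n. c x \<in> carrier_mat (sdim W (Suc x)) (sdim V x)"
  define E where "E = \<lparr>dimv = (\<lambda>x. dimv W x + dimv V x),
    act = (\<lambda>x. inl (dimv W (Suc x)) (dimv V (Suc x)) * act W x * prl (dimv W x) (dimv V x)
      + inl (dimv W (Suc x)) (dimv V (Suc x)) * c x * prr (dimv W x) (dimv V x)
      + inr (dimv W (Suc x)) (dimv V (Suc x)) * act V x * prr (dimv W x) (dimv V x))\<rparr>"
  define f where "f x = (inl (dimv W x) (dimv V x) :: 'k mat)" for x
  define g where "g x = (prr (dimv W x) (dimv V x) :: 'k mat)" for x
  define p where "p x = (prl (sdim W x) (sdim V x) :: 'k mat)" for x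
  note bl = block_orth block_orth_mult mat_dim_simps zero_add_dim add_zero_dim
  have cd: "dim_row (c x) = sdim W (Suc x)" "dim_col (c x) = sdim V x" if "x < n" for x
    using c that by auto
  have dE: "dimv E x = dimv W x + dimv V x" for x by (simp add: E_def)
  have sE: "sdim E x = sdim W x + sdim V x" for x by (simp add: E_def sdim_def)
  have aE: "act E x = inl (sdim W (Suc x)) (sdim V (Suc x)) * sact W x * prl (sdim W x) (sdim V x)
      + inl (sdim W (Suc x)) (sdim V (Suc x)) * c x * prr (sdim W x) (sdim V x)
      + inr (sdim W (Suc x)) (sdim V (Suc x)) * sact V x * prr (sdim W x) (sdim V x)"
    if "1 \<le> x" for x using that by (simp add: E_def sdim_def sact_def)
  have repE: "is_rep n E"
    unfolding is_rep_def
  proof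
    fix x assume "x \<in> {1..<n}"
    then have x: "1 \<le> x" "x < n" by auto
    have "act E x \<in> carrier_mat (sdim E (Suc x)) (sdim E x)"
      unfolding aE[OF x(1)] sE
      using sact_dims[OF V x(2)] sact_dims[OF W x(2)] cd[OF x(2)] by (intro carrier_matI) auto
    then show "act E x \<in> carrier_mat (dimv E (x + 1)) (dimv E x)" using x by (simp add: sdim_def)
  qed
  have fE: "morphism n W E f"
    unfolding morphism_def
  proof (intro conjI ballI)
    show "f x \<in> carrier_mat (dimv E x) (dimv W x)" for x by (auto simp: f_def dE intro!: carrier_matI)
    fix x assume "x \<in> {1..<n}"
    then have x: "1 \<le> x" "x < n" by auto
    have fs: "f x = inl (sdim W x) (sdim V x)" "f (Suc x) = inl (sdim W (Suc x)) (sdim V (Suc x))"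
      "act W x = sact W x"
      using x by (simp_all add: f_def sdim_def sact_def)
    show "f (x + 1) * act W x = act E x * f x"
      using sact_dims[OF V x(2)] sact_dims[OF W x(2)] cd[OF x(2)]
      by (simp add: aE[OF x(1)] fs bl)
  qed
  have gE: "morphism n E V g"
    unfolding morphism_def
  proof (intro conjI ballI)
    show "g x \<in> carrier_mat (dimv V x) (dimv E x)" for x by (auto simp: g_def dE intro!: carrier_matI)
    fix x assume "x \<in> {1..<n}"
    then have x: "1 \<le> x" "x < n" by auto
    have gs: "g x = prr (sdim W x) (sdim V x)" "g (Suc x) = prr (sdim W (Suc x)) (sdim V (Suc x))"
      "act V x = sact V x"
      using x by (simp_all add: g_def sdim_def sact_def)
    show "g (x + 1) * act E x = act V x * g x"
      using sact_dims[OF V x(2)] sact_dims[OF W x(2)] cd[OF x(2)]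
      by (simp add: aE[OF x(1)] gs bl)
  qed
  have "short_exact n W f E g V"
    unfolding short_exact_def
  proof (intro conjI ballI)
    fix x
    have fx: "f x \<in> carrier_mat (dimv E x) (dimv W x)" "g x \<in> carrier_mat (dimv V x) (dimv E x)"
      "prl (dimv W x) (dimv V x) \<in> carrier_mat (dimv W x) (dimv E x)"
      "inr (dimv W x) (dimv V x) \<in> carrier_mat (dimv E x) (dimv V x)"
      by (auto simp: f_def g_def dE intro!: carrier_matI)
    note ex = split_exact_level[OF fx]
    show "mat_kernel (f x) = {0\<^sub>v (dimv W x)}"
      by (rule ex(1)) (simp_all add: f_def g_def block_orth block_sum dE)
    show "(\<lambda>v. f x *\<^sub>v v) ` carrier_vec (dimv W x) = mat_kernel (g x)"
      by (rule ex(2)) (simp_all add: f_def g_def block_orth block_sum dE)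
    show "(\<lambda>v. g x *\<^sub>v v) ` carrier_vec (dimv E x) = carrier_vec (dimv V x)"
      by (rule ex(3)) (simp_all add: f_def g_def block_orth block_sum dE)
  qed (use V W repE fE gE in auto)
  then obtain s where s: "morphism n V E s" "mor_eq n (mor_comp g s) (id_mor V)"
    using ext unfolding ext1_vanishes_def by blast
  define t where "t = s(0 := 0\<^sub>m 0 0)"
  have t: "hom_fam n V E t" unfolding t_def by (rule morphism_hom_fam[OF V repE s(1)])
  have gt: "prr (sdim W x) (sdim V x) * t x = 1\<^sub>m (sdim V x)" if "x \<le> n" for x
  proof (cases "x = 0")
    case True
    then show ?thesis by (intro eq_matI) (auto simp: t_def)
  next
    case False
    then show ?thesis using s(2) that by (auto simp: t_def mor_eq_def mor_comp_def id_mor_def g_def sdim_def)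
  qed
  show "\<exists>s. (\<forall>x\<le>n. s x \<in> carrier_mat (sdim W x) (sdim V x)) \<and>
          (\<forall>x<n. c x = s (Suc x) * sact V x - sact W x * s x)"
  proof (rule exI[of _ "\<lambda>x. p x * t x"], intro conjI allI impI)
    show "p x * t x \<in> carrier_mat (sdim W x) (sdim V x)" if "x \<le> n" for x
      using hom_fam_carrier[OF t that] by (auto simp: p_def intro!: carrier_matI)
    fix x assume x: "x < n"
    note d = hom_fam_dims[OF t, of x] hom_fam_dims[OF t, of "Suc x"] sact_dims[OF V x] sact_dims[OF W x] cd[OF x]
    show "c x = p (Suc x) * t (Suc x) * sact V x - sact W x * (p x * t x)"
    proof (cases "x = 0")
      case True
      then show ?thesis
        by (intro zero_mat_eq[of _ "sdim W (Suc x)" 0]) (use d x in \<open>auto intro!: carrier_matI simp: p_def\<close>)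
    next
      case False
      then have x1: "1 \<le> x" by simp
      \<comment> \<open>The section commutes with the arrows, and its component in \<open>V\<close>
        is the identity by \<open>gt\<close>; comparing the components in \<open>W\<close> leaves
        exactly \<open>c x\<close>.\<close>
      have "p (Suc x) * t (Suc x) * sact V x = p (Suc x) * (sact E x * t x)"
        using d x hom_fam_commute[OF t x] by (simp add: mult_assoc_dim p_def sE)
      also have "sact E x = act E x" using x1 by (simp add: sact_def)
      also have "p (Suc x) * (act E x * t x) = sact W x * (p x * t x) + c x * (prr (sdim W x) (sdim V x) * t x)"
        using d x by (simp add: aE[OF x1] p_def sE bl)
      also have "\<dots> = sact W x * (p x * t x) + c x" using d x by (simp add: gt)
      finally show ?thesis using d x by (intro eq_matI) (auto simp: p_def)
    qed
  qed
qed

text \<open>Sections \<open>q x\<close> exist at each vertex but need not commute with the arrows.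
  The defect \<open>D x\<close> is annihilated by \<open>g\<close>, hence is the image under
  \<open>f\<close> of a cocycle, and a solution \<open>s\<close> of the cocycle equation corrects
  \<open>q\<close> to the morphism \<open>\<sigma>\<close>.\<close>

lemma cosplit_ext1_vanishes:
  fixes V W :: "'k::field quiver_rep"
  assumes cs: "cosplit n V W"
  shows "ext1_vanishes n V W"
  unfolding ext1_vanishes_def
proof (intro allI impI)
  fix E f g assume se: "short_exact n W f E g V"
  then have V: "is_rep n V" and W: "is_rep n W" and E: "is_rep n E"
    and mf: "morphism n W E f" and mg: "morphism n E V g" by (auto simp: short_exact_def)
  define F where "F = f(0 := 0\<^sub>m 0 0)"
  define G where "G = g(0 := 0\<^sub>m 0 0)"
  have F: "hom_fam n W E F" unfolding F_def by (rule morphism_hom_fam[OF W E mf])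
  have G: "hom_fam n E V G" unfolding G_def by (rule morphism_hom_fam[OF E V mg])
  define Q where "Q x p q \<longleftrightarrow> p \<in> carrier_mat (sdim W x) (sdim E x) \<and> q \<in> carrier_mat (sdim E x) (sdim V x) \<and>
     G x * q = 1\<^sub>m (sdim V x) \<and> G x * F x = 0\<^sub>m (sdim V x) (sdim W x) \<and>
    (\<forall>k. \<forall>B\<in>carrier_mat (sdim E x) k. G x * B = 0\<^sub>m (sdim V x) k \<longrightarrow> F x * (p * B) = B)" for x p q
  have "\<exists>p q. Q x p q" if "x \<le> n" for x
  proof (cases "x = 0")
    case True
    show ?thesis
      by (rule exI[of _ "0\<^sub>m 0 0"], rule exI[of _ "0\<^sub>m 0 0"]) (auto simp: Q_def True G_def F_def intro!: eq_matI)
  next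
    case False
    then have x: "x \<in> {1..n}" using that by auto
    have s: "sdim U x = dimv U x" for U :: "'k quiver_rep" using False by (simp add: sdim_def)
    have c: "f x \<in> carrier_mat (dimv E x) (dimv W x)" "g x \<in> carrier_mat (dimv V x) (dimv E x)"
      using x mf mg by (auto simp: morphism_def)
    have FG: "F x = f x" "G x = g x" using False by (simp_all add: F_def G_def)
    show ?thesis unfolding Q_def s FG
      by (rule exact_level_split[OF c]) (use se x in \<open>auto simp: short_exact_def\<close>)
  qed
  then obtain p q where Q: "\<And>x. x \<le> n \<Longrightarrow> Q x (p x) (q x)" by metis
  have pc: "\<And>x. x \<le> n \<Longrightarrow> p x \<in> carrier_mat (sdim W x) (sdim E x)"
    and qc: "\<And>x. x \<le> n \<Longrightarrow> q x \<in> carrier_mat (sdim E x) (sdim V x)"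
    and Gq: "\<And>x. x \<le> n \<Longrightarrow> G x * q x = 1\<^sub>m (sdim V x)"
    and GF: "\<And>x. x \<le> n \<Longrightarrow> G x * F x = 0\<^sub>m (sdim V x) (sdim W x)"
    and Fp: "\<And>x k B. x \<le> n \<Longrightarrow> B \<in> carrier_mat (sdim E x) k \<Longrightarrow> G x * B = 0\<^sub>m (sdim V x) k \<Longrightarrow> F x * (p x * B) = B"
    using Q unfolding Q_def by blast+
  define D where "D x = sact E x * q x - q (Suc x) * sact V x" for x
  define c where "c x = p (Suc x) * D x" for x
  have d: "dim_row (q x) = sdim E x" "dim_col (q x) = sdim V x" "dim_row (q (Suc x)) = sdim E (Suc x)"
    "dim_col (q (Suc x)) = sdim V (Suc x)" "dim_row (p (Suc x)) = sdim W (Suc x)" "dim_col (p (Suc x)) = sdim E (Suc x)"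
    "dim_row (F x) = sdim E x" "dim_col (F x) = sdim W x" "dim_row (F (Suc x)) = sdim E (Suc x)" "dim_col (F (Suc x)) = sdim W (Suc x)"
    "dim_row (G x) = sdim V x" "dim_col (G x) = sdim E x" "dim_row (G (Suc x)) = sdim V (Suc x)" "dim_col (G (Suc x)) = sdim E (Suc x)"
    "dim_row (sact E x) = sdim E (Suc x)" "dim_col (sact E x) = sdim E x"
    "dim_row (sact V x) = sdim V (Suc x)" "dim_col (sact V x) = sdim V x"
    "dim_row (sact W x) = sdim W (Suc x)" "dim_col (sact W x) = sdim W x" if "x < n" for x
    using that qc[of x] qc[of "Suc x"] pc[of "Suc x"] hom_fam_dims[OF F, of x] hom_fam_dims[OF F, of "Suc x"]
      hom_fam_dims[OF G, of x] hom_fam_dims[OF G, of "Suc x"] sact_dims[OF E that] sact_dims[OF V that] sact_dims[OF W that]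
    by auto
  have FpD: "F (Suc x) * c x = D x" if x: "x < n" for x
  proof -
    have "G (Suc x) * (sact E x * q x) = G (Suc x) * sact E x * q x" using d[OF x] by (simp add: mult_assoc_dim)
    also have "\<dots> = sact V x * (G x * q x)" using d[OF x] hom_fam_commute[OF G x] by (simp add: mult_assoc_dim)
    also have "\<dots> = sact V x" using d[OF x] x by (simp add: Gq)
    finally have 1: "G (Suc x) * (sact E x * q x) = sact V x" .
    have "G (Suc x) * (q (Suc x) * sact V x) = G (Suc x) * q (Suc x) * sact V x"
      using d[OF x] by (simp add: mult_assoc_dim)
    also have "\<dots> = sact V x" using d[OF x] x by (simp add: Gq)
    finally have 2: "G (Suc x) * (q (Suc x) * sact V x) = sact V x" .
    have "G (Suc x) * D x = 0\<^sub>m (sdim V (Suc x)) (sdim V x)"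
      unfolding D_def using d[OF x] by (simp add: mult_diff_dim 1 2 diff_self_dim)
    moreover have "D x \<in> carrier_mat (sdim E (Suc x)) (sdim V x)"
      unfolding D_def using d[OF x] by (intro carrier_matI) auto
    ultimately show ?thesis unfolding c_def using Fp x by (simp add: Suc_le_eq)
  qed
  have "\<forall>x<n. c x \<in> carrier_mat (sdim W (Suc x)) (sdim V x)"
    using d by (auto simp: c_def D_def intro!: carrier_matI)
  then obtain s where sc: "\<And>x. x \<le> n \<Longrightarrow> s x \<in> carrier_mat (sdim W x) (sdim V x)"
    and s: "\<And>x. x < n \<Longrightarrow> c x = s (Suc x) * sact V x - sact W x * s x"
    using cs unfolding cosplit_def by blast
  define \<sigma> where "\<sigma> x = q x + F x * s x" for x
  have "hom_fam n V E \<sigma>"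
    unfolding hom_fam_def
  proof (intro conjI allI impI)
    show "\<sigma> x \<in> carrier_mat (sdim E x) (sdim V x)" if "x \<le> n" for x
      using qc[OF that] hom_fam_carrier[OF F that] sc[OF that] by (auto simp: \<sigma>_def)
    fix x assume x: "x < n"
    have ds: "dim_row (s x) = sdim W x" "dim_col (s x) = sdim V x"
      "dim_row (s (Suc x)) = sdim W (Suc x)" "dim_col (s (Suc x)) = sdim V (Suc x)"
      using sc[of x] sc[of "Suc x"] x by auto
    have "sact E x * (F x * s x) = F (Suc x) * (sact W x * s x)"
      using d[OF x] ds hom_fam_commute[OF F x] by (simp flip: mult_assoc_dim)
    then have 1: "sact E x * \<sigma> x = sact E x * q x + F (Suc x) * (sact W x * s x)"
      using d[OF x] ds by (simp add: \<sigma>_def mult_add_dim)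
    have "D x = F (Suc x) * (s (Suc x) * sact V x) - F (Suc x) * (sact W x * s x)"
      using FpD[OF x] d[OF x] ds by (simp add: s[OF x] mult_diff_dim)
    then have "F (Suc x) * (s (Suc x) * sact V x) = D x + F (Suc x) * (sact W x * s x)"
      using d[OF x] ds by (intro eq_matI) auto
    then have 2: "\<sigma> (Suc x) * sact V x = q (Suc x) * sact V x + (D x + F (Suc x) * (sact W x * s x))"
      using d[OF x] ds by (simp add: \<sigma>_def add_mult_dim mult_assoc_dim)
    show "\<sigma> (Suc x) * sact V x = sact E x * \<sigma> x"
      unfolding 1 2 D_def using d[OF x] ds by (intro eq_matI) auto
  qed
  then have "morphism n V E \<sigma>" by (rule hom_fam_morphism)
  moreover have "mor_eq n (mor_comp g \<sigma>) (id_mor V)"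
    unfolding mor_eq_def
  proof
    fix x assume x: "x \<in> {1..n}"
    then have xn: "x \<le> n" by simp
    have ds: "dim_row (s x) = sdim W x" "dim_col (s x) = sdim V x" "dim_row (q x) = sdim E x" "dim_col (q x) = sdim V x"
      using sc[OF xn] qc[OF xn] by auto
    note dFG = hom_fam_dims[OF F xn] hom_fam_dims[OF G xn]
    have "G x * \<sigma> x = G x * q x + (G x * F x) * s x"
      using ds dFG by (simp add: \<sigma>_def mult_add_dim mult_assoc_dim)
    then have "G x * \<sigma> x = 1\<^sub>m (sdim V x)"
      using ds by (simp add: Gq[OF xn] GF[OF xn] zero_mult_dim add_zero_dim)
    then show "mor_comp g \<sigma> x = id_mor V x" using x by (simp add: mor_comp_def id_mor_def G_def sdim_def)
  qed
  ultimately show "\<exists>s. morphism n V E s \<and> mor_eq n (mor_comp g s) (id_mor V)" by blast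
qed

section \<open>Hom and Ext under retracts and direct sums\<close>

definition homv :: "nat \<Rightarrow> 'k::field quiver_rep \<Rightarrow> 'k quiver_rep \<Rightarrow> bool" where
  "homv n V W \<longleftrightarrow> (\<forall>f. hom_fam n V W f \<longrightarrow> (\<forall>x\<le>n. f x = 0\<^sub>m (sdim W x) (sdim V x)))"

lemma hom_vanishes_iff:
  assumes "is_rep n V" "is_rep n W"
  shows "hom_vanishes n V W \<longleftrightarrow> homv n V W"
proof
  assume hv: "hom_vanishes n V W"
  show "homv n V W"
    unfolding homv_def
  proof (intro allI impI)
    fix f x assume f: "hom_fam n V W f" and x: "x \<le> n"
    show "f x = 0\<^sub>m (sdim W x) (sdim V x)"
    proof (cases "x = 0")
      case True
      then show ?thesis using hom_fam_carrier[OF f x] by (intro zero_mat_eq[of _ 0 0]) auto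
    next
      case False
      then show ?thesis using hv hom_fam_morphism[OF f] x
        by (auto simp: hom_vanishes_def mor_eq_def zero_mor_def sdim_def)
    qed
  qed
next
  assume h: "homv n V W"
  show "hom_vanishes n V W"
    unfolding hom_vanishes_def mor_eq_def
  proof (intro allI impI ballI)
    fix f x assume f: "morphism n V W f" and x: "x \<in> {1..n}"
    have "(f(0 := 0\<^sub>m 0 0)) x = 0\<^sub>m (sdim W x) (sdim V x)"
      using h morphism_hom_fam[OF assms f] x unfolding homv_def by (meson atLeastAtMost_iff)
    then show "f x = zero_mor V W x" using x by (simp add: zero_mor_def sdim_def)
  qed
qed

lemma ext1_vanishes_iff:
  assumes "is_rep n V" "is_rep n W"
  shows "ext1_vanishes n V W \<longleftrightarrow> cosplit n V W"
  using ext1_vanishes_cosplit[OF assms] cosplit_ext1_vanishes by blast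

lemma homv_retract_target:
  assumes reps: "is_rep n W" "is_rep n V" "is_rep n V'" and r: "retract_of n V' V" and h: "homv n W V"
  shows "homv n W V'"
  unfolding homv_def
proof (intro allI impI)
  fix f x assume f: "hom_fam n W V' f" and x: "x \<le> n"
  obtain \<iota> \<pi> where i: "hom_fam n V' V \<iota>" and p: "hom_fam n V V' \<pi>" and pi: "\<pi> x * \<iota> x = 1\<^sub>m (sdim V' x)"
    using r x by (auto simp: retract_of_def)
  note d = hom_fam_dims[OF f x] hom_fam_dims[OF i x] hom_fam_dims[OF p x]
  have "\<iota> x * f x = 0\<^sub>m (sdim V x) (sdim W x)"
    using h hom_fam_comp[OF reps(1,3,2) f i] x by (simp add: homv_def)
  then have "\<pi> x * (\<iota> x * f x) = 0\<^sub>m (sdim V' x) (sdim W x)" using d by (simp add: mult_zero_dim)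
  moreover have "\<pi> x * (\<iota> x * f x) = f x" using d by (simp add: pi flip: mult_assoc_dim)
  ultimately show "f x = 0\<^sub>m (sdim V' x) (sdim W x)" by simp
qed

lemma homv_retract_source:
  assumes reps: "is_rep n W" "is_rep n W'" "is_rep n V" and r: "retract_of n W' W" and h: "homv n W V"
  shows "homv n W' V"
  unfolding homv_def
proof (intro allI impI)
  fix f x assume f: "hom_fam n W' V f" and x: "x \<le> n"
  obtain \<iota> \<pi> where i: "hom_fam n W' W \<iota>" and p: "hom_fam n W W' \<pi>" and pi: "\<pi> x * \<iota> x = 1\<^sub>m (sdim W' x)"
    using r x by (auto simp: retract_of_def)
  note d = hom_fam_dims[OF f x] hom_fam_dims[OF i x] hom_fam_dims[OF p x]
  have "f x * \<pi> x = 0\<^sub>m (sdim V x) (sdim W x)"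
    using h hom_fam_comp[OF reps(1,2,3) p f] x by (simp add: homv_def)
  then have "f x * \<pi> x * \<iota> x = 0\<^sub>m (sdim V x) (sdim W' x)" using d by (simp add: zero_mult_dim)
  moreover have "f x * \<pi> x * \<iota> x = f x" using d by (simp add: pi mult_assoc_dim)
  ultimately show "f x = 0\<^sub>m (sdim V x) (sdim W' x)" by simp
qed

lemma cosplitD:
  assumes "cosplit n V W" "\<And>x. x < n \<Longrightarrow> c x \<in> carrier_mat (sdim W (Suc x)) (sdim V x)"
  obtains s where "\<And>x. x \<le> n \<Longrightarrow> s x \<in> carrier_mat (sdim W x) (sdim V x)"
    "\<And>x. x < n \<Longrightarrow> c x = s (Suc x) * sact V x - sact W x * s x"
  using assms unfolding cosplit_def by blast

text \<open>Push the cocycle into \<open>V\<close> along \<open>\<iota>\<close>, solve the equation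
  there, and return along \<open>\<pi>\<close>, which commutes with the structure maps.\<close>

lemma cosplit_retract_target:
  assumes reps: "is_rep n W" "is_rep n V" "is_rep n V'" and r: "retract_of n V' V" and h: "cosplit n W V"
  shows "cosplit n W V'"
  unfolding cosplit_def
proof (intro allI impI)
  fix c :: "nat \<Rightarrow> 'a mat" assume c: "\<forall>x<n. c x \<in> carrier_mat (sdim V' (Suc x)) (sdim W x)"
  obtain \<iota> \<pi> where i: "hom_fam n V' V \<iota>" and p: "hom_fam n V V' \<pi>" and pi: "\<And>x. x \<le> n \<Longrightarrow> \<pi> x * \<iota> x = 1\<^sub>m (sdim V' x)"
    using r by (auto simp: retract_of_def)
  have "\<iota> (Suc x) * c x \<in> carrier_mat (sdim V (Suc x)) (sdim W x)" if "x < n" for x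
    using c that hom_fam_carrier[OF i, of "Suc x"] by auto
  then obtain s where sc: "\<And>x. x \<le> n \<Longrightarrow> s x \<in> carrier_mat (sdim V x) (sdim W x)"
    and s: "\<And>x. x < n \<Longrightarrow> \<iota> (Suc x) * c x = s (Suc x) * sact W x - sact V x * s x"
    using cosplitD[OF h, of "\<lambda>x. \<iota> (Suc x) * c x"] by blast
  show "\<exists>s. (\<forall>x\<le>n. s x \<in> carrier_mat (sdim V' x) (sdim W x)) \<and>
          (\<forall>x<n. c x = s (Suc x) * sact W x - sact V' x * s x)"
  proof (rule exI[of _ "\<lambda>x. \<pi> x * s x"], intro conjI allI impI)
    show "\<pi> x * s x \<in> carrier_mat (sdim V' x) (sdim W x)" if "x \<le> n" for x
      using sc[OF that] hom_fam_carrier[OF p that] by simp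
    fix x assume x: "x < n"
    have cd: "dim_row (c x) = sdim V' (Suc x)" "dim_col (c x) = sdim W x" using c x by auto
    note d = hom_fam_dims[OF i, of "Suc x"] hom_fam_dims[OF p, of x] hom_fam_dims[OF p, of "Suc x"]
      carrier_matD[OF sc, of x] carrier_matD[OF sc, of "Suc x"] sact_dims[OF reps(1) x] sact_dims[OF reps(2) x]
      sact_dims[OF reps(3) x] cd
    have "c x = \<pi> (Suc x) * (\<iota> (Suc x) * c x)" using d x by (simp add: pi flip: mult_assoc_dim)
    also have "\<dots> = \<pi> (Suc x) * s (Suc x) * sact W x - (\<pi> (Suc x) * sact V x) * s x"
      using d x by (simp add: s mult_diff_dim mult_assoc_dim)
    also have "\<dots> = \<pi> (Suc x) * s (Suc x) * sact W x - sact V' x * (\<pi> x * s x)"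
      using d x by (simp add: hom_fam_commute[OF p x] mult_assoc_dim)
    finally show "c x = \<pi> (Suc x) * s (Suc x) * sact W x - sact V' x * (\<pi> x * s x)" .
  qed
qed

lemma cosplit_retract_source:
  assumes reps: "is_rep n W" "is_rep n W'" "is_rep n V" and r: "retract_of n W' W" and h: "cosplit n W V"
  shows "cosplit n W' V"
  unfolding cosplit_def
proof (intro allI impI)
  fix c :: "nat \<Rightarrow> 'a mat" assume c: "\<forall>x<n. c x \<in> carrier_mat (sdim V (Suc x)) (sdim W' x)"
  obtain \<iota> \<pi> where i: "hom_fam n W' W \<iota>" and p: "hom_fam n W W' \<pi>" and pi: "\<And>x. x \<le> n \<Longrightarrow> \<pi> x * \<iota> x = 1\<^sub>m (sdim W' x)"
    using r by (auto simp: retract_of_def)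
  have "c x * \<pi> x \<in> carrier_mat (sdim V (Suc x)) (sdim W x)" if "x < n" for x
    using c that hom_fam_carrier[OF p, of x] by auto
  then obtain s where sc: "\<And>x. x \<le> n \<Longrightarrow> s x \<in> carrier_mat (sdim V x) (sdim W x)"
    and s: "\<And>x. x < n \<Longrightarrow> c x * \<pi> x = s (Suc x) * sact W x - sact V x * s x"
    using cosplitD[OF h, of "\<lambda>x. c x * \<pi> x"] by blast
  show "\<exists>s. (\<forall>x\<le>n. s x \<in> carrier_mat (sdim V x) (sdim W' x)) \<and>
          (\<forall>x<n. c x = s (Suc x) * sact W' x - sact V x * s x)"
  proof (rule exI[of _ "\<lambda>x. s x * \<iota> x"], intro conjI allI impI)
    show "s x * \<iota> x \<in> carrier_mat (sdim V x) (sdim W' x)" if "x \<le> n" for x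
      using sc[OF that] hom_fam_carrier[OF i that] by simp
    fix x assume x: "x < n"
    have cd: "dim_row (c x) = sdim V (Suc x)" "dim_col (c x) = sdim W' x" using c x by auto
    note d = hom_fam_dims[OF i, of "Suc x"] hom_fam_dims[OF i, of x] hom_fam_dims[OF p, of x]
      carrier_matD[OF sc, of x] carrier_matD[OF sc, of "Suc x"] sact_dims[OF reps(1) x] sact_dims[OF reps(2) x]
      sact_dims[OF reps(3) x] cd
    have "c x = (c x * \<pi> x) * \<iota> x" using d x by (simp add: pi mult_assoc_dim)
    also have "\<dots> = s (Suc x) * (sact W x * \<iota> x) - sact V x * (s x * \<iota> x)"
      using d x by (simp add: s diff_mult_dim mult_assoc_dim)
    also have "sact W x * \<iota> x = \<iota> (Suc x) * sact W' x" using hom_fam_commute[OF i x] by simp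
    also have "s (Suc x) * (\<iota> (Suc x) * sact W' x) = s (Suc x) * \<iota> (Suc x) * sact W' x"
      using d x by (simp add: mult_assoc_dim)
    finally show "c x = s (Suc x) * \<iota> (Suc x) * sact W' x - sact V x * (s x * \<iota> x)" .
  qed
qed

lemma sdim_direct_sum: "sdim (direct_sum V W) x = sdim V x + sdim W x"
  by (simp add: sdim_def direct_sum_def)

lemma is_rep_direct_sum:
  assumes "is_rep n V" "is_rep n W"
  shows "is_rep n (direct_sum V W)"
  using assms by (auto simp: is_rep_def direct_sum_def)

lemma sact_direct_sum:
  assumes "is_rep n V" "is_rep n W" "x < n"
  shows "sact (direct_sum V W) x =
     inl (sdim V (Suc x)) (sdim W (Suc x)) * sact V x * prl (sdim V x) (sdim W x)
     + inr (sdim V (Suc x)) (sdim W (Suc x)) * sact W x * prr (sdim V x) (sdim W x)"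
proof (cases "x = 0")
  case True
  show ?thesis
    by (rule zero_mat_eq[of _ "sdim V (Suc x) + sdim W (Suc x)" 0])
      (use sact_carrier[OF assms(1,3)] sact_carrier[OF assms(2,3)] True in
        \<open>auto simp: sact_def direct_sum_def sdim_def intro!: carrier_matI\<close>)
next
  case False
  note d = sact_dims[OF assms(1,3)] sact_dims[OF assms(2,3)]
  have "sact (direct_sum V W) x = four_block_mat (sact V x) (0\<^sub>m (sdim V (Suc x)) (sdim W x))
      (0\<^sub>m (sdim W (Suc x)) (sdim V x)) (sact W x)"
    using False by (simp add: sact_def direct_sum_def sdim_def)
  also have "\<dots> = inl (sdim V (Suc x)) (sdim W (Suc x)) * sact V x * prl (sdim V x) (sdim W x)
     + inr (sdim V (Suc x)) (sdim W (Suc x)) * sact W x * prr (sdim V x) (sdim W x)"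
    by (subst four_block_decomp[of _ "sdim V (Suc x)" "sdim V x" _ "sdim W x" _ "sdim W (Suc x)"])
      (use sact_carrier[OF assms(1,3)] sact_carrier[OF assms(2,3)] d in
        \<open>auto simp: mat_dim_simps zero_add_dim add_zero_dim\<close>)
  finally show ?thesis .
qed

lemmas block_simps = block_orth block_orth_mult mat_dim_simps zero_add_dim add_zero_dim

lemma direct_sum_hom_fams:
  assumes "is_rep n V" "is_rep n W"
  shows "hom_fam n V (direct_sum V W) (\<lambda>x. inl (sdim V x) (sdim W x))"
    "hom_fam n W (direct_sum V W) (\<lambda>x. inr (sdim V x) (sdim W x))"
    "hom_fam n (direct_sum V W) V (\<lambda>x. prl (sdim V x) (sdim W x))"
    "hom_fam n (direct_sum V W) W (\<lambda>x. prr (sdim V x) (sdim W x))"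
  using sact_dims[OF assms(1)] sact_dims[OF assms(2)]
  by (auto simp: hom_fam_def sdim_direct_sum sact_direct_sum[OF assms] block_simps intro!: carrier_matI)

lemma direct_sum_retracts:
  assumes "is_rep n V" "is_rep n W"
  shows "retract_of n V (direct_sum V W)" "retract_of n W (direct_sum V W)"
  unfolding retract_of_def
  using direct_sum_hom_fams[OF assms] block_orth(1,2) by blast+

lemma homv_direct_sum:
  assumes U: "is_rep n U" and V: "is_rep n V" and W: "is_rep n W" and h: "homv n U V" "homv n U W"
  shows "homv n U (direct_sum V W)"
  unfolding homv_def
proof (intro allI impI)
  fix f x assume f: "hom_fam n U (direct_sum V W) f" and x: "x \<le> n"
  note S = is_rep_direct_sum[OF V W]
  note d = hom_fam_dims[OF f x]
  have "prl (sdim V x) (sdim W x) * f x = 0\<^sub>m (sdim V x) (sdim U x)"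
    "prr (sdim V x) (sdim W x) * f x = 0\<^sub>m (sdim W x) (sdim U x)"
    using h hom_fam_comp[OF U S V f direct_sum_hom_fams(3)[OF V W]]
      hom_fam_comp[OF U S W f direct_sum_hom_fams(4)[OF V W]] x by (simp_all add: homv_def)
  moreover have "f x = (inl (sdim V x) (sdim W x) * prl (sdim V x) (sdim W x)
     + inr (sdim V x) (sdim W x) * prr (sdim V x) (sdim W x)) * f x"
    using d by (simp add: block_sum sdim_direct_sum)
  ultimately show "f x = 0\<^sub>m (sdim (direct_sum V W) x) (sdim U x)"
    using d by (simp add: block_simps sdim_direct_sum)
qed

lemma cosplit_direct_sum:
  fixes U V W :: "'k::field quiver_rep"
  assumes U: "is_rep n U" and V: "is_rep n V" and W: "is_rep n W" and h: "cosplit n U V" "cosplit n U W"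
  shows "cosplit n U (direct_sum V W)"
  unfolding cosplit_def
proof (intro allI impI)
  fix c :: "nat \<Rightarrow> 'k mat" assume c: "\<forall>x<n. c x \<in> carrier_mat (sdim (direct_sum V W) (Suc x)) (sdim U x)"
  then have cd: "dim_row (c x) = sdim V (Suc x) + sdim W (Suc x)" "dim_col (c x) = sdim U x" if "x < n" for x
    using that by (auto simp: sdim_direct_sum)
  have "prl (sdim V (Suc x)) (sdim W (Suc x)) * c x \<in> carrier_mat (sdim V (Suc x)) (sdim U x)" if "x < n" for x
    using cd[OF that] by (auto intro!: carrier_matI)
  then obtain s where sc: "\<And>x. x \<le> n \<Longrightarrow> s x \<in> carrier_mat (sdim V x) (sdim U x)"
    and s: "\<And>x. x < n \<Longrightarrow> prl (sdim V (Suc x)) (sdim W (Suc x)) * c x = s (Suc x) * sact U x - sact V x * s x"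
    using cosplitD[OF h(1), of "\<lambda>x. prl (sdim V (Suc x)) (sdim W (Suc x)) * c x"] by blast
  have "prr (sdim V (Suc x)) (sdim W (Suc x)) * c x \<in> carrier_mat (sdim W (Suc x)) (sdim U x)" if "x < n" for x
    using cd[OF that] by (auto intro!: carrier_matI)
  then obtain t where tc: "\<And>x. x \<le> n \<Longrightarrow> t x \<in> carrier_mat (sdim W x) (sdim U x)"
    and t: "\<And>x. x < n \<Longrightarrow> prr (sdim V (Suc x)) (sdim W (Suc x)) * c x = t (Suc x) * sact U x - sact W x * t x"
    using cosplitD[OF h(2), of "\<lambda>x. prr (sdim V (Suc x)) (sdim W (Suc x)) * c x"] by blast
  show "\<exists>s. (\<forall>x\<le>n. s x \<in> carrier_mat (sdim (direct_sum V W) x) (sdim U x)) \<and>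
          (\<forall>x<n. c x = s (Suc x) * sact U x - sact (direct_sum V W) x * s x)"
  proof (rule exI[of _ "\<lambda>x. inl (sdim V x) (sdim W x) * s x + inr (sdim V x) (sdim W x) * t x"], intro conjI allI impI)
    show "inl (sdim V x) (sdim W x) * s x + inr (sdim V x) (sdim W x) * t x
      \<in> carrier_mat (sdim (direct_sum V W) x) (sdim U x)" if "x \<le> n" for x
      using sc[OF that] tc[OF that] by (auto simp: sdim_direct_sum intro!: carrier_matI)
    fix x assume x: "x < n"
    note d = carrier_matD[OF sc, of x] carrier_matD[OF sc, of "Suc x"] carrier_matD[OF tc, of x]
      carrier_matD[OF tc, of "Suc x"] sact_dims[OF U x] sact_dims[OF V x] sact_dims[OF W x] cd[OF x]
    let ?l = "inl (sdim V (Suc x)) (sdim W (Suc x)) :: 'k mat" and ?r = "inr (sdim V (Suc x)) (sdim W (Suc x)) :: 'k mat"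
    have "c x = (?l * prl (sdim V (Suc x)) (sdim W (Suc x)) + ?r * prr (sdim V (Suc x)) (sdim W (Suc x))) * c x"
      using d by (simp add: block_sum)
    also have "\<dots> = ?l * (s (Suc x) * sact U x - sact V x * s x) + ?r * (t (Suc x) * sact U x - sact W x * t x)"
      using d x by (simp add: add_mult_dim mult_assoc_dim s t)
    also have "\<dots> = (?l * s (Suc x) + ?r * t (Suc x)) * sact U x
      - sact (direct_sum V W) x * (inl (sdim V x) (sdim W x) * s x + inr (sdim V x) (sdim W x) * t x)"
      using d x by (simp add: sact_direct_sum[OF V W] block_simps) (rule eq_matI, auto)
    finally show "c x = (?l * s (Suc x) + ?r * t (Suc x)) * sact U x
      - sact (direct_sum V W) x * (inl (sdim V x) (sdim W x) * s x + inr (sdim V x) (sdim W x) * t x)" .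
  qed
qed

section \<open>Perpendicularity to a list of modules\<close>

definition perp :: "nat \<Rightarrow> 'k::field quiver_rep \<Rightarrow> 'k quiver_rep \<Rightarrow> bool" where
  "perp n W V \<longleftrightarrow> homv n W V \<and> cosplit n W V"

lemma is_rep_zero: "is_rep n zero_rep"
  by (auto simp: is_rep_def zero_rep_def)

lemma is_rep_direct_sum_list: "\<forall>V\<in>set Vs. is_rep n V \<Longrightarrow> is_rep n (direct_sum_list Vs)"
  by (induction Vs) (auto simp: direct_sum_list_def is_rep_zero is_rep_direct_sum)

lemma sdim_zero_rep: "sdim zero_rep x = 0"
  by (simp add: sdim_def zero_rep_def)

lemma perp_zero_rep:
  assumes "is_rep n W"
  shows "perp n W zero_rep"
  unfolding perp_def homv_def cosplit_def
proof (intro conjI allI impI)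
  fix f x assume "hom_fam n W zero_rep f" "x \<le> n"
  then show "f x = 0\<^sub>m (sdim zero_rep x) (sdim W x)"
    using hom_fam_carrier[of n W zero_rep f x] by (intro zero_mat_eq) (auto simp: sdim_zero_rep)
next
  fix c :: "nat \<Rightarrow> 'a mat" assume c: "\<forall>x<n. c x \<in> carrier_mat (sdim zero_rep (Suc x)) (sdim W x)"
  show "\<exists>s. (\<forall>x\<le>n. s x \<in> carrier_mat (sdim zero_rep x) (sdim W x)) \<and>
     (\<forall>x<n. c x = s (Suc x) * sact W x - sact zero_rep x * s x)"
  proof (rule exI[of _ "\<lambda>x. 0\<^sub>m 0 (sdim W x)"], intro conjI allI impI)
    fix x assume x: "x < n"
    show "c x = 0\<^sub>m 0 (sdim W (Suc x)) * sact W x - sact zero_rep x * 0\<^sub>m 0 (sdim W x)"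
      using c x sact_dims[OF assms x] sact_dims[OF is_rep_zero x]
      by (intro zero_mat_eq[of _ 0 "sdim W x"]) (auto simp: sdim_zero_rep intro!: carrier_matI)
  qed (simp add: sdim_zero_rep)
qed

lemma perp_direct_sum_list:
  assumes "is_rep n W" "\<forall>V\<in>set Vs. is_rep n V"
  shows "perp n W (direct_sum_list Vs) \<longleftrightarrow> (\<forall>V\<in>set Vs. perp n W V)"
  using assms(2)
proof (induction Vs)
  case Nil
  then show ?case using perp_zero_rep[OF assms(1)] by (simp add: direct_sum_list_def)
next
  case (Cons V Vs)
  have V: "is_rep n V" and S: "is_rep n (direct_sum_list Vs)"
    using Cons.prems is_rep_direct_sum_list by auto
  have e: "direct_sum_list (V # Vs) = direct_sum V (direct_sum_list Vs)" by (simp add: direct_sum_list_def)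
  note VS = is_rep_direct_sum[OF V S]
  have "perp n W (direct_sum V (direct_sum_list Vs)) \<longleftrightarrow> perp n W V \<and> perp n W (direct_sum_list Vs)"
    unfolding perp_def
    using homv_direct_sum[OF assms(1) V S] cosplit_direct_sum[OF assms(1) V S]
      homv_retract_target[OF assms(1) VS V direct_sum_retracts(1)[OF V S]]
      homv_retract_target[OF assms(1) VS S direct_sum_retracts(2)[OF V S]]
      cosplit_retract_target[OF assms(1) VS V direct_sum_retracts(1)[OF V S]]
      cosplit_retract_target[OF assms(1) VS S direct_sum_retracts(2)[OF V S]] by blast
  then show ?case using Cons unfolding e by simp
qed

lemma left_perp_iff:
  assumes "\<forall>V\<in>set Vs. is_rep n V"
  shows "W \<in> left_perp n (direct_sum_list Vs) \<longleftrightarrow> is_rep n W \<and> (\<forall>V\<in>set Vs. perp n W V)"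
  unfolding left_perp_def mem_Collect_eq
  using hom_vanishes_iff[OF _ is_rep_direct_sum_list[OF assms]] perp_direct_sum_list[OF _ assms]
    ext1_vanishes_iff[OF _ is_rep_direct_sum_list[OF assms]] perp_def by metis

text \<open>Members of an exceptional sequence are interval modules only up to isomorphism; this
  carries perpendicularity over to the interval modules themselves.\<close>

lemma perp_iso:
  assumes "is_rep n W" "is_rep n W'" "is_rep n V" "is_rep n V'" "rep_iso n W W'" "rep_iso n V V'"
  shows "perp n W V \<longleftrightarrow> perp n W' V'"
  unfolding perp_def
  using rep_iso_retract[OF assms(1,2,5)] rep_iso_retract[OF assms(3,4,6)]
    homv_retract_source[OF assms(1,2,3)] homv_retract_source[OF assms(2,1,3)]
    homv_retract_target[OF assms(2,3,4)] homv_retract_target[OF assms(2,4,3)]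
    cosplit_retract_source[OF assms(1,2,3)] cosplit_retract_source[OF assms(2,1,3)]
    cosplit_retract_target[OF assms(2,3,4)] cosplit_retract_target[OF assms(2,4,3)]
  by blast

section \<open>Perpendicularity to interval modules\<close>

text \<open>The composite of the arrows from \<open>a\<close> to \<open>b\<close>. For
  \<open>a > b\<close> the value is a mere default, so undirected edges are later accessed through
  \<open>min\<close> and \<open>max\<close>.\<close>

primrec tmap :: "'k::field quiver_rep \<Rightarrow> nat \<Rightarrow> nat \<Rightarrow> 'k mat" where
  "tmap V a 0 = 1\<^sub>m (sdim V 0)"
| "tmap V a (Suc b) = (if a \<le> b then sact V b * tmap V a b else 1\<^sub>m (sdim V (Suc b)))"

lemma tmap_self [simp]: "tmap V a a = 1\<^sub>m (sdim V a)"
  by (cases a) auto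

lemma tmap_carrier:
  assumes "is_rep n V" "a \<le> b" "b \<le> n"
  shows "tmap V a b \<in> carrier_mat (sdim V b) (sdim V a)"
  using assms(2,3)
proof (induction b)
  case (Suc b)
  show ?case
  proof (cases "a = Suc b")
    case False
    then have "tmap V a b \<in> carrier_mat (sdim V b) (sdim V a)" "a \<le> b" using Suc by auto
    then show ?thesis using sact_carrier[OF assms(1), of b] Suc.prems by auto
  qed auto
qed auto

lemma tmap_dims:
  assumes "is_rep n V" "a \<le> b" "b \<le> n"
  shows "dim_row (tmap V a b) = sdim V b" "dim_col (tmap V a b) = sdim V a"
  using tmap_carrier[OF assms] by auto

lemma tmap_comp:
  assumes "is_rep n V" "a \<le> b" "b \<le> c" "c \<le> n"
  shows "tmap V b c * tmap V a b = tmap V a c"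
  using assms(3,4)
proof (induction c)
  case 0
  then show ?case using assms by simp
next
  case (Suc c)
  show ?case
  proof (cases "b = Suc c")
    case True
    then show ?thesis using tmap_dims[OF assms(1,2)] Suc.prems by simp
  next
    case False
    then have "b \<le> c" using Suc.prems by simp
    then show ?thesis using Suc tmap_dims[OF assms(1,2)] tmap_dims[OF assms(1), of b c] sact_dims[OF assms(1), of c] assms(2)
      by (simp add: mult_assoc_dim)
  qed
qed

lemma tmap_left:
  assumes "is_rep n V" "a < b" "b \<le> n"
  shows "tmap V (Suc a) b * sact V a = tmap V a b"
  using tmap_comp[OF assms(1), of a "Suc a" b] assms sact_dims[OF assms(1), of a] by simp

lemma hom_fam_tmap:
  assumes V: "is_rep n V" and W: "is_rep n W" and f: "hom_fam n V W f" and "a \<le> b" "b \<le> n"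
  shows "f b * tmap V a b = tmap W a b * f a"
  using assms(4,5)
proof (induction b)
  case 0
  then show ?case using hom_fam_dims[OF f, of 0] by simp
next
  case (Suc b)
  show ?case
  proof (cases "a = Suc b")
    case True
    then show ?thesis using hom_fam_dims[OF f, of a] Suc.prems by simp
  next
    case False
    then have ab: "a \<le> b" "b < n" using Suc.prems by auto
    note d = hom_fam_dims[OF f, of a] hom_fam_dims[OF f, of b] hom_fam_dims[OF f, of "Suc b"]
      tmap_dims[OF V ab(1)] tmap_dims[OF W ab(1)] sact_dims[OF V ab(2)] sact_dims[OF W ab(2)]
    have "f (Suc b) * tmap V a (Suc b) = (f (Suc b) * sact V b) * tmap V a b"
      using d ab by (simp add: mult_assoc_dim)
    also have "\<dots> = sact W b * (f b * tmap V a b)"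
      using d ab by (simp add: mult_assoc_dim hom_fam_commute[OF f])
    also have "\<dots> = tmap W a (Suc b) * f a" using d ab Suc.IH by (simp add: mult_assoc_dim)
    finally show ?thesis .
  qed
qed

lemma sdim_interval: "sdim (interval_rep k l) x = (if k < x \<and> x \<le> l then 1 else 0)"
  by (simp add: sdim_def interval_rep_def Let_def)

lemma sact_interval:
  "sact (interval_rep k l :: 'k::field quiver_rep) x = (if k < x \<and> Suc x \<le> l then 1\<^sub>m 1 else
    0\<^sub>m (sdim (interval_rep k l :: 'k quiver_rep) (Suc x)) (sdim (interval_rep k l :: 'k quiver_rep) x))"
  by (simp add: sdim_def sact_def interval_rep_def Let_def)

lemma is_rep_interval: "is_rep n (interval_rep k l)"
  by (auto simp: is_rep_def interval_rep_def Let_def)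

lemma tmap_interval:
  assumes "k < x" "x \<le> y" "y \<le> l"
  shows "tmap (interval_rep k l) x y = 1\<^sub>m 1"
  using assms(2,3)
proof (induction y)
  case (Suc y)
  then show ?case
    by (cases "x = Suc y") (use assms(1) in \<open>auto simp: sdim_interval sact_interval\<close>)
qed (use assms in auto)

section \<open>Homomorphisms and extensions into interval modules\<close>

text \<open>Homomorphisms to \<open>interval_rep k l\<close> correspond to functionals
  \<open>c\<close> on the space at \<open>l\<close> that vanish on the image of the space at
  \<open>k\<close>: the other components are forced by the transition maps, and the square over the
  arrow leaving \<open>k\<close> is the vanishing condition.\<close>

lemma hom_fam_to_interval:
  fixes W :: "'k::field quiver_rep"
  assumes W: "is_rep n W" and kl: "k < l" "l \<le> n"
    and c: "c \<in> carrier_mat 1 (sdim W l)" "c * tmap W k l = 0\<^sub>m 1 (sdim W k)"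
  shows "hom_fam n W (interval_rep k l) (\<lambda>x. if k < x \<and> x \<le> l then c * tmap W x l else 0\<^sub>m 0 (sdim W x))"
    (is "hom_fam n W ?M ?f")
  unfolding hom_fam_def
proof (intro conjI allI impI)
  have d: "dim_row (tmap W a l) = sdim W l" "dim_col (tmap W a l) = sdim W a" if "a \<le> l" for a
    using tmap_dims[OF W that kl(2)] by auto
  show "?f x \<in> carrier_mat (sdim ?M x) (sdim W x)" for x
    using c d[of x] by (auto simp: sdim_interval intro!: carrier_matI)
  fix x assume x: "x < n"
  note dW = sact_dims[OF W x]
  consider "k < x" "Suc x \<le> l" | "x = k" | "x < k \<or> l \<le> x" using kl by linarith
  then show "?f (Suc x) * sact W x = sact ?M x * ?f x"
  proof cases
    case 1
    then show ?thesis using c d[of x] d[of "Suc x"] dW tmap_left[OF W, of x l] kl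
      by (simp add: sact_interval mult_assoc_dim)
  next
    case 2
    then show ?thesis using c d[of k] d[of "Suc k"] dW tmap_left[OF W kl] kl
      by (simp add: sact_interval sdim_interval mult_assoc_dim zero_mult_dim)
  next
    case 3
    then show ?thesis using c d[of x] d[of "Suc x"] dW
      by (intro zero_mat_eq[of _ 0 "sdim W x"])
        (auto simp: sact_interval sdim_interval intro!: carrier_matI)
  qed
qed

lemma hom_fam_interval_tmap:
  fixes W :: "'k::field quiver_rep"
  assumes W: "is_rep n W" and kl: "k < l" "l \<le> n" and f: "hom_fam n W (interval_rep k l) f"
  shows "f l * tmap W k l = 0\<^sub>m 1 (sdim W k)"
    "\<And>x. k < x \<Longrightarrow> x \<le> l \<Longrightarrow> f l * tmap W x l = f x"
proof -
  let ?M = "interval_rep k l :: 'k quiver_rep"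
  note M = is_rep_interval[of n k l, where 'a = 'k]
  have kl': "k \<le> l" using kl by simp
  note d = tmap_dims[OF W kl' kl(2)] tmap_dims[OF M kl' kl(2)] hom_fam_dims[OF f, of k] hom_fam_dims[OF f, of l]
  have "f k = 0\<^sub>m 0 (sdim W k)" using d kl by (intro zero_mat_eq[of _ 0 "sdim W k"]) (auto simp: sdim_interval)
  then show "f l * tmap W k l = 0\<^sub>m 1 (sdim W k)"
    using hom_fam_tmap[OF W M f kl' kl(2)] d kl by (simp add: sdim_interval mult_zero_dim)
  show "f l * tmap W x l = f x" if "k < x" "x \<le> l" for x
    using hom_fam_tmap[OF W M f that(2) kl(2)] hom_fam_dims[OF f, of x] that kl
    by (simp add: tmap_interval sdim_interval)
qed

lemma homv_interval:
  fixes W :: "'k::field quiver_rep"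
  assumes W: "is_rep n W" and kl: "k < l" "l \<le> n"
  shows "homv n W (interval_rep k l) \<longleftrightarrow> rinv (tmap W k l)"
proof
  let ?M = "interval_rep k l :: 'k quiver_rep"
  have kl': "k \<le> l" using kl by simp
  assume h: "homv n W ?M"
  show "rinv (tmap W k l)"
  proof (rule rinvI_cokernel[OF tmap_carrier[OF W kl' kl(2)]])
    fix c :: "'k mat" assume c: "c \<in> carrier_mat 1 (sdim W l)" "c * tmap W k l = 0\<^sub>m 1 (sdim W k)"
    from h[unfolded homv_def, rule_format, OF hom_fam_to_interval[OF W kl c] kl(2)]
    show "c = 0\<^sub>m 1 (sdim W l)" using c kl by (simp add: sdim_interval)
  qed
next
  let ?M = "interval_rep k l :: 'k quiver_rep"
  assume r: "rinv (tmap W k l)"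
  have kl': "k \<le> l" using kl by simp
  show "homv n W ?M"
    unfolding homv_def
  proof (intro allI impI)
    fix f x assume f: "hom_fam n W ?M f" and x: "x \<le> n"
    note d = tmap_dims[OF W kl' kl(2)] hom_fam_dims[OF f, of l]
    have "f l * tmap W k l = 0\<^sub>m 1 (sdim W l) * tmap W k l"
      using d hom_fam_interval_tmap(1)[OF W kl f] by (simp add: zero_mult_dim)
    then have fl: "f l = 0\<^sub>m 1 (sdim W l)"
      by (rule rinv_cancel[OF r]) (use d kl in auto)
    show "f x = 0\<^sub>m (sdim ?M x) (sdim W x)"
    proof (cases "k < x \<and> x \<le> l")
      case True
      then show ?thesis using hom_fam_interval_tmap(2)[OF W kl f, of x] tmap_dims[OF W, of x l] kl
        by (simp add: fl zero_mult_dim sdim_interval)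
    next
      case False
      then show ?thesis using hom_fam_carrier[OF f x] by (intro zero_mat_eq) (auto simp: sdim_interval)
    qed
  qed
qed

text \<open>A functional \<open>\<rho>\<close> on the space at \<open>k\<close>, placed as a cocycle
  on the arrow leaving \<open>k\<close>, is a coboundary only if it factors through the map to the
  space at \<open>l\<close>.\<close>

lemma cosplit_interval_linv:
  fixes W :: "'k::field quiver_rep"
  assumes W: "is_rep n W" and kl: "k < l" "l \<le> n" and cs: "cosplit n W (interval_rep k l)"
  shows "linv (tmap W k l)"
proof -
  let ?M = "interval_rep k l :: 'k quiver_rep"
  have kl': "k \<le> l" using kl by simp
  show ?thesis
  proof (rule linvI_rows[OF tmap_carrier[OF W kl' kl(2)]])
    fix \<rho> :: "'k mat" assume r: "\<rho> \<in> carrier_mat 1 (sdim W k)"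
    define c where "c x = (if x = k then \<rho> else 0\<^sub>m (sdim ?M (Suc x)) (sdim W x))" for x
    have "c x \<in> carrier_mat (sdim ?M (Suc x)) (sdim W x)" for x
      using r kl by (auto simp: c_def sdim_interval)
    then obtain s where sc: "\<And>x. x \<le> n \<Longrightarrow> s x \<in> carrier_mat (sdim ?M x) (sdim W x)"
      and s: "\<And>x. x < n \<Longrightarrow> c x = s (Suc x) * sact W x - sact ?M x * s x"
      using cosplitD[OF cs] by blast
    \<comment> \<open>The equation at \<open>k\<close> starts the induction because the interval
      module is zero there. Beyond \<open>k\<close> the cocycle is zero, and the solution is carried
      along the identities of the interval module.\<close>
    have "\<rho> = s y * tmap W k y" if "k < y" "y \<le> l" for y
      using that
    proof (induction y)
      case (Suc y)
      have y: "y < n" using Suc kl by simp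
      note d = carrier_matD[OF sc, of y] carrier_matD[OF sc, of "Suc y"] sact_dims[OF W y]
      show ?case
      proof (cases "y = k")
        case True
        have "\<rho> = s (Suc k) * sact W k - sact ?M k * s k" using s[OF y] True by (simp add: c_def)
        also have "sact ?M k * s k = 0\<^sub>m 1 (sdim W k)" using d y kl True
          by (simp add: sact_interval sdim_interval zero_mult_dim)
        finally show ?thesis using d y kl True by (auto simp: sdim_interval intro!: eq_matI)
      next
        case False
        then have ky: "k < y" "y \<le> l" using Suc by auto
        have sM: "sact ?M y = 1\<^sub>m 1" using ky Suc.prems by (simp add: sact_interval)
        have eq: "0\<^sub>m 1 (sdim W y) = s (Suc y) * sact W y - s y"
          using s[OF y] d y ky Suc.prems False by (simp add: c_def sM sdim_interval)
        have "s y = s (Suc y) * sact W y"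
        proof (rule eq_matI)
          fix i j assume ij: "i < dim_row (s (Suc y) * sact W y)" "j < dim_col (s (Suc y) * sact W y)"
          then have "0 = (s (Suc y) * sact W y) $$ (i, j) - s y $$ (i, j)"
            using arg_cong[OF eq, of "\<lambda>A. A $$ (i, j)"] d y ky Suc.prems by (simp add: sdim_interval)
          then show "s y $$ (i, j) = (s (Suc y) * sact W y) $$ (i, j)" by simp
        qed (use d y ky Suc.prems in \<open>auto simp: sdim_interval\<close>)
        then have "\<rho> = s (Suc y) * sact W y * tmap W k y" using Suc.IH ky by simp
        then show ?thesis using d y ky tmap_dims[OF W, of k y] kl by (simp add: mult_assoc_dim)
      qed
    qed simp
    then show "\<exists>s\<in>carrier_mat 1 (sdim W l). \<rho> = s * tmap W k l"
      using sc[of l] kl by (intro bexI[of _ "s l"]) (auto simp: sdim_interval)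
  qed
qed

lemma linv_cosplit_interval:
  fixes W :: "'k::field quiver_rep"
  assumes W: "is_rep n W" and kl: "k < l" "l \<le> n" and inv: "linv (tmap W k l)"
  shows "cosplit n W (interval_rep k l)"
  unfolding cosplit_def
proof (intro allI impI)
  let ?M = "interval_rep k l :: 'k quiver_rep"
  fix c :: "nat \<Rightarrow> 'k mat" assume c: "\<forall>x<n. c x \<in> carrier_mat (sdim ?M (Suc x)) (sdim W x)"
  have cd: "dim_row (c x) = 1" "dim_col (c x) = sdim W x" if "k \<le> x" "x < l" for x
    using c[rule_format, of x] that kl by (auto simp: sdim_interval)
  have kl': "k \<le> l" using kl by simp
  obtain N where N: "N \<in> carrier_mat (sdim W k) (sdim W l)" "N * tmap W k l = 1\<^sub>m (sdim W k)"
    using inv tmap_dims[OF W kl' kl(2)] by (auto simp: linv_def)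
  \<comment> \<open>\<open>u r d\<close> is the component at vertex \<open>l - d\<close> of the
    solution with value \<open>r\<close> at \<open>l\<close>.\<close>
  define u where "u r = rec_nat r (\<lambda>d v. v * sact W (l - Suc d) - c (l - Suc d))" for r :: "'k mat"
  have u0: "u r 0 = r" and uS: "u r (Suc d) = u r d * sact W (l - Suc d) - c (l - Suc d)" for r d
    by (simp_all add: u_def)
  have uc: "u r d \<in> carrier_mat 1 (sdim W (l - d))" if "r \<in> carrier_mat 1 (sdim W l)" "d \<le> l - k" for r d
    using that(2)
  proof (induction d)
    case (Suc d)
    have e: "Suc (l - Suc d) = l - d" using Suc.prems by simp
    show ?case using Suc sact_dims[OF W, of "l - Suc d"] cd[of "l - Suc d"] kl
      by (intro carrier_matI) (auto simp: uS e)
  qed (use that u0 in simp)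
  define z where "z = (0\<^sub>m 1 (sdim W l) :: 'k mat)"
  have z: "z \<in> carrier_mat 1 (sdim W l)" by (simp add: z_def)
  \<comment> \<open>The dependence on \<open>r\<close> is affine, with linear part composition with
    the transition map. At \<open>d = l - k\<close> the left inverse \<open>N\<close> of that map
    can therefore enforce any prescribed value, in particular zero.\<close>
  have lin: "u r d = r * tmap W (l - d) l + u z d" if r: "r \<in> carrier_mat 1 (sdim W l)" and "d \<le> l - k" for r d
    using that(2)
  proof (induction d)
    case 0
    then show ?case using r by (simp add: u0 z_def add_zero_dim)
  next
    case (Suc d)
    have e: "Suc (l - Suc d) = l - d" using Suc.prems by simp
    have lt: "l - Suc d < n" "k \<le> l - Suc d" "l - Suc d < l" using Suc.prems kl by linarith+
    note dd = carrier_matD[OF r] carrier_matD[OF uc[OF z, of d]] sact_dims[OF W lt(1)] cd[OF lt(2,3)] tmap_dims[OF W, of "l - d" l] tmap_dims[OF W, of "l - Suc d" l]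
    have "u r (Suc d) = (r * tmap W (l - d) l + u z d) * sact W (l - Suc d) - c (l - Suc d)"
      using Suc by (simp add: uS)
    also have "\<dots> = r * (tmap W (l - d) l * sact W (l - Suc d)) + u z d * sact W (l - Suc d) - c (l - Suc d)"
      using dd Suc.prems kl by (simp add: e mat_dim_simps)
    also have "tmap W (l - d) l * sact W (l - Suc d) = tmap W (l - Suc d) l"
      using tmap_left[OF W, of "l - Suc d" l] Suc.prems kl by (simp add: e)
    also have "r * tmap W (l - Suc d) l + u z d * sact W (l - Suc d) - c (l - Suc d)
        = r * tmap W (l - Suc d) l + u z (Suc d)"
      using dd Suc.prems kl by (intro eq_matI) (auto simp: uS e)
    finally show ?case .
  qed
  text \<open>Going down from \<open>l\<close>, the cocycle equations determine everything from the value \<open>r\<close> at \<open>l\<close>;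
    the equation at \<open>k\<close> says that the value \<open>u r (l - k)\<close> obtained at \<open>k\<close> is zero.\<close>
  define r where "r = (0\<^sub>m 1 (sdim W k) - u z (l - k)) * N"
  have dz: "dim_row (u z (l - k)) = 1" "dim_col (u z (l - k)) = sdim W k" using uc[OF z, of "l - k"] kl by auto
  have r: "r \<in> carrier_mat 1 (sdim W l)" using N dz by (auto simp: r_def intro!: carrier_matI)
  have "r * tmap W k l = 0\<^sub>m 1 (sdim W k) - u z (l - k)"
    using N dz tmap_dims[OF W kl' kl(2)] by (simp add: r_def mult_assoc_dim)
  then have uk: "u r (l - k) = 0\<^sub>m 1 (sdim W k)"
    using lin[OF r, of "l - k"] dz kl by (auto intro!: eq_matI)
  define s where "s x = (if k < x \<and> x \<le> l then u r (l - x) else 0\<^sub>m 0 (sdim W x))" for x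
  have sc: "s x \<in> carrier_mat (sdim ?M x) (sdim W x)" for x
    using uc[OF r, of "l - x"] by (auto simp: s_def sdim_interval)
  have step: "c x = u r (l - Suc x) * sact W x - u r (l - x)" if x: "k \<le> x" "x < l" for x
  proof -
    have e: "l - x = Suc (l - Suc x)" "l - (l - x) = x" "l - (l - Suc x) = Suc x" using x by auto
    have "u r (l - x) = u r (l - Suc x) * sact W x - c x" using uS[of r "l - Suc x"] x by (simp add: e(1) flip: e(1))
    then show ?thesis using cd[OF x] uc[OF r, of "l - Suc x"] sact_dims[OF W, of x] x kl
      by (auto simp: e intro!: eq_matI)
  qed
  show "\<exists>s. (\<forall>x\<le>n. s x \<in> carrier_mat (sdim ?M x) (sdim W x)) \<and>
          (\<forall>x<n. c x = s (Suc x) * sact W x - sact ?M x * s x)"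
  proof (rule exI[of _ s], intro conjI allI impI)
    show "s x \<in> carrier_mat (sdim ?M x) (sdim W x)" for x by (rule sc)
    fix x assume x: "x < n"
    note d = carrier_matD[OF sc[of x]] carrier_matD[OF sc[of "Suc x"]] sact_dims[OF W x]
      sact_dims[OF is_rep_interval x, of k l, where 'a = 'k]
    consider "k < x" "x < l" | "x = k" | "x < k \<or> l \<le> x" using kl by linarith
    then show "c x = s (Suc x) * sact W x - sact ?M x * s x"
    proof cases
      case 1
      then have "dim_row (u r (l - x)) = 1" by (intro carrier_matD(1)[OF uc[OF r]]) simp
      then show ?thesis using step[of x] 1 by (simp add: s_def sact_interval)
    next
      case 2
      then show ?thesis using step[of x] uk d kl
        by (simp add: s_def sact_interval sdim_interval zero_mult_dim)
    next
      case 3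
      then show ?thesis using d c x
        by (intro zero_mat_eq[of _ 0 "sdim W x"]) (auto simp: sdim_interval intro!: carrier_matI)
    qed
  qed
qed

theorem perp_interval:
  assumes "is_rep n W" "k < l" "l \<le> n"
  shows "perp n W (interval_rep k l) \<longleftrightarrow> bij_mat (tmap W k l)"
  unfolding perp_def bij_mat_iff
  using homv_interval[OF assms] cosplit_interval_linv[OF assms] linv_cosplit_interval[OF assms] by blast

section \<open>Kernels, indecomposables and extension of functionals\<close>

text \<open>The structure maps of the kernel are written in the bases \<open>\<kappa> x\<close>,
  with \<open>L x\<close> computing coordinates. \<open>L\<close> and \<open>G\<close> are returned
  as well, since the kernel is used through the splitting of the identity that they provide.\<close>

lemma kernel_rep:
  fixes X Y :: "'k::field quiver_rep"
  assumes X: "is_rep n X" and Y: "is_rep n Y" and f: "hom_fam n X Y f"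
  obtains K \<kappa> L G where "is_rep n K" "hom_fam n K X \<kappa>"
    "\<And>x. x \<le> n \<Longrightarrow> L x \<in> carrier_mat (sdim K x) (sdim X x)"
    "\<And>x. x \<le> n \<Longrightarrow> G x \<in> carrier_mat (sdim X x) (sdim Y x)"
    "\<And>x. x \<le> n \<Longrightarrow> f x * \<kappa> x = 0\<^sub>m (sdim Y x) (sdim K x)"
    "\<And>x. x \<le> n \<Longrightarrow> L x * \<kappa> x = 1\<^sub>m (sdim K x)"
    "\<And>x. x \<le> n \<Longrightarrow> \<kappa> x * L x + G x * f x = 1\<^sub>m (sdim X x)"
proof -
  \<comment> \<open>The last clause makes the dimension at the adjoined vertex \<open>0\<close>
    agree with \<open>sdim\<close>.\<close>
  define Q where "Q x r G B L \<longleftrightarrow> G \<in> carrier_mat (sdim X x) (sdim Y x) \<and> B \<in> carrier_mat (sdim X x) r \<and>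
     L \<in> carrier_mat r (sdim X x) \<and> f x * B = 0\<^sub>m (sdim Y x) r \<and> L * B = 1\<^sub>m r \<and>
     B * L + G * f x = 1\<^sub>m (sdim X x) \<and> (x = 0 \<longrightarrow> r = 0)" for x r G B L
  have "\<exists>r G B L. Q x r G B L" if x: "x \<le> n" for x
  proof (cases "x = 0")
    case True
    have "Q x 0 (0\<^sub>m 0 0) (0\<^sub>m 0 0) (0\<^sub>m 0 0)"
      using True hom_fam_dims[OF f x] by (auto simp: Q_def intro!: eq_matI)
    then show ?thesis by blast
  next
    case False
    then show ?thesis using kernel_split[OF hom_fam_carrier[OF f x]] unfolding Q_def by simp
  qed
  then obtain r G B L where Q: "\<And>x. x \<le> n \<Longrightarrow> Q x (r x) (G x) (B x) (L x)" by metis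
  define K where "K = \<lparr>dimv = r, act = (\<lambda>x. L (Suc x) * sact X x * B x)\<rparr>"
  have sK: "sdim K x = r x" if "x \<le> n" for x
    using Q[of 0] by (auto simp: sdim_def K_def Q_def)
  have c: "G x \<in> carrier_mat (sdim X x) (sdim Y x)" "B x \<in> carrier_mat (sdim X x) (sdim K x)"
    "L x \<in> carrier_mat (sdim K x) (sdim X x)" if "x \<le> n" for x
    using Q[OF that] sK[OF that] by (auto simp: Q_def)
  have e: "f x * B x = 0\<^sub>m (sdim Y x) (sdim K x)" "L x * B x = 1\<^sub>m (sdim K x)"
     "B x * L x + G x * f x = 1\<^sub>m (sdim X x)" if "x \<le> n" for x
    using Q[OF that] sK[OF that] by (auto simp: Q_def)
  have K: "is_rep n K"
    unfolding is_rep_def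
  proof
    fix x assume "x \<in> {1..<n}"
    then have x: "1 \<le> x" "x < n" by auto
    show "act K x \<in> carrier_mat (dimv K (x + 1)) (dimv K x)"
      using c[of x] c[of "Suc x"] x by (auto simp: K_def sdim_def intro!: carrier_matI)
  qed
  have "hom_fam n K X B"
    unfolding hom_fam_def
  proof (intro conjI allI impI)
    fix x assume x: "x < n"
    have d: "dim_row (B x) = sdim X x" "dim_col (B x) = sdim K x" "dim_row (B (Suc x)) = sdim X (Suc x)"
      "dim_col (B (Suc x)) = sdim K (Suc x)" "dim_row (L (Suc x)) = sdim K (Suc x)" "dim_col (L (Suc x)) = sdim X (Suc x)"
      "dim_row (G (Suc x)) = sdim X (Suc x)" "dim_col (G (Suc x)) = sdim Y (Suc x)"
      using c[of x] c[of "Suc x"] x by auto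
    note d = d sact_dims[OF X x] sact_dims[OF Y x] sact_dims[OF K x] hom_fam_dims[OF f, of x] hom_fam_dims[OF f, of "Suc x"]
    show "B (Suc x) * sact K x = sact X x * B x"
    proof (cases "x = 0")
      case True
      then show ?thesis
        by (intro zero_mat_eq[of _ "sdim X (Suc x)" 0]) (use d in \<open>auto intro!: carrier_matI\<close>)
    next
      case False
      have "f (Suc x) * (sact X x * B x) = (f (Suc x) * sact X x) * B x" using d x by (simp add: mult_assoc_dim)
      also have "\<dots> = sact Y x * (f x * B x)"
        using d x by (simp add: mult_assoc_dim hom_fam_commute[OF f x])
      also have "\<dots> = 0\<^sub>m (sdim Y (Suc x)) (sdim K x)" using d x by (simp add: e mult_zero_dim)
      finally have z: "f (Suc x) * (sact X x * B x) = 0\<^sub>m (sdim Y (Suc x)) (sdim K x)" .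
      \<comment> \<open>The arrow of \<open>X\<close> maps the kernel into the kernel, so the
        splitting recovers the image from its coordinates.\<close>
      have "sact X x * B x = (B (Suc x) * L (Suc x) + G (Suc x) * f (Suc x)) * (sact X x * B x)"
        using d x by (simp add: e)
      also have "\<dots> = B (Suc x) * (L (Suc x) * (sact X x * B x)) + G (Suc x) * (f (Suc x) * (sact X x * B x))"
        using d x by (simp add: add_mult_dim mult_assoc_dim)
      also have "\<dots> = B (Suc x) * (L (Suc x) * (sact X x * B x))"
        using d x by (simp add: z mult_zero_dim add_zero_dim)
      finally show ?thesis using d x False by (simp add: sact_def K_def mult_assoc_dim)
    qed
  qed (use c in auto)
  then show ?thesis using that[OF K _ c(3,1) e] by blast
qed

section \<open>Indecomposable modules are interval modules\<close>

text \<open>The kernel of the retraction is a complement of \<open>M\<close>. Indecomposability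
  makes it zero, and the retraction an isomorphism.\<close>

lemma indecomposable_retract:
  fixes V M :: "'k::field quiver_rep"
  assumes ind: "indecomposable_rep n V" and M: "is_rep n M" "\<not> is_zero_rep n M" and r: "retract_of n M V"
  shows "rep_iso n V M"
proof -
  have V: "is_rep n V" using ind by (simp add: indecomposable_rep_def)
  obtain \<iota> \<pi> where i: "hom_fam n M V \<iota>" and p: "hom_fam n V M \<pi>" and pi: "\<And>x. x \<le> n \<Longrightarrow> \<pi> x * \<iota> x = 1\<^sub>m (sdim M x)"
    using r by (auto simp: retract_of_def)
  obtain K \<kappa> L G where K: "is_rep n K" and k: "hom_fam n K V \<kappa>"
    and Lc: "\<And>x. x \<le> n \<Longrightarrow> L x \<in> carrier_mat (sdim K x) (sdim V x)"
    and Gc: "\<And>x. x \<le> n \<Longrightarrow> G x \<in> carrier_mat (sdim V x) (sdim M x)"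
    and pk: "\<And>x. x \<le> n \<Longrightarrow> \<pi> x * \<kappa> x = 0\<^sub>m (sdim M x) (sdim K x)"
    and Lk: "\<And>x. x \<le> n \<Longrightarrow> L x * \<kappa> x = 1\<^sub>m (sdim K x)"
    and kL: "\<And>x. x \<le> n \<Longrightarrow> \<kappa> x * L x + G x * \<pi> x = 1\<^sub>m (sdim V x)"
    using kernel_rep[OF V M(1) p] by blast
  have d: "dim_row (\<iota> x) = sdim V x" "dim_col (\<iota> x) = sdim M x" "dim_row (\<pi> x) = sdim M x" "dim_col (\<pi> x) = sdim V x"
    "dim_row (\<kappa> x) = sdim V x" "dim_col (\<kappa> x) = sdim K x" "dim_row (L x) = sdim K x" "dim_col (L x) = sdim V x"
    "dim_row (G x) = sdim V x" "dim_col (G x) = sdim M x" if "x \<le> n" for x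
    using hom_fam_dims[OF i that] hom_fam_dims[OF p that] hom_fam_dims[OF k that] Lc[OF that] Gc[OF that] by auto
  have Gi: "G x = \<iota> x - \<kappa> x * (L x * \<iota> x)" if x: "x \<le> n" for x
  proof -
    have "\<iota> x = (\<kappa> x * L x + G x * \<pi> x) * \<iota> x" using d[OF x] by (simp add: kL[OF x])
    also have "\<dots> = \<kappa> x * (L x * \<iota> x) + G x" using d[OF x] by (simp add: add_mult_dim mult_assoc_dim pi[OF x])
    finally have eq: "\<iota> x = \<kappa> x * (L x * \<iota> x) + G x" .
    show ?thesis by (subst (1) eq) (rule eq_matI, use d[OF x] in auto)
  qed
  let ?S = "direct_sum M K"
  define \<beta> where "\<beta> x = \<iota> x * prl (sdim M x) (sdim K x) + \<kappa> x * prr (sdim M x) (sdim K x)" for x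
  \<comment> \<open>\<open>L x\<close> need not vanish on the image of \<open>\<iota> x\<close>;
    subtracting \<open>L x * \<iota> x * \<pi> x\<close> makes it the projection to the complement
    along that image.\<close>
  define \<alpha> where "\<alpha> x = inl (sdim M x) (sdim K x) * \<pi> x + inr (sdim M x) (sdim K x) * (L x - L x * \<iota> x * \<pi> x)" for x
  note S = is_rep_direct_sum[OF M(1) K]
  have b: "hom_fam n ?S V \<beta>"
    unfolding hom_fam_def
  proof (intro conjI allI impI)
    show "\<beta> x \<in> carrier_mat (sdim V x) (sdim ?S x)" if "x \<le> n" for x
      using d[OF that] by (auto simp: \<beta>_def sdim_direct_sum intro!: carrier_matI)
    fix x assume x: "x < n"
    then have xn: "x \<le> n" "Suc x \<le> n" by auto
    note dd = d[OF xn(1)] d[OF xn(2)] sact_dims[OF M(1) x] sact_dims[OF V x] sact_dims[OF K x]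
    have "\<beta> (Suc x) * sact ?S x = (\<iota> (Suc x) * sact M x) * prl (sdim M x) (sdim K x)
      + (\<kappa> (Suc x) * sact K x) * prr (sdim M x) (sdim K x)"
      using dd by (simp add: \<beta>_def sact_direct_sum[OF M(1) K x] block_simps)
    also have "\<dots> = sact V x * \<beta> x"
      using dd by (simp add: \<beta>_def hom_fam_commute[OF i x] hom_fam_commute[OF k x] block_simps)
    finally show "\<beta> (Suc x) * sact ?S x = sact V x * \<beta> x" .
  qed
  have ac: "\<alpha> x \<in> carrier_mat (sdim ?S x) (sdim V x)" if "x \<le> n" for x
    using d[OF that] by (auto simp: \<alpha>_def sdim_direct_sum intro!: carrier_matI)
  have ab: "\<alpha> x * \<beta> x = 1\<^sub>m (sdim ?S x)" if x: "x \<le> n" for x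
  proof -
    have pX: "\<pi> x * (\<iota> x * A) = A" "\<pi> x * (\<kappa> x * B) = 0\<^sub>m (sdim M x) (dim_col B)" "L x * (\<kappa> x * B) = B"
      if "dim_row A = sdim M x" "dim_row B = sdim K x" for A B
      using d[OF x] that by (simp_all add: pi[OF x] pk[OF x] Lk[OF x] zero_mult_dim flip: mult_assoc_dim)
    have pb: "\<pi> x * \<beta> x = prl (sdim M x) (sdim K x)"
      using d[OF x] by (simp add: \<beta>_def mult_add_dim pX add_zero_dim)
    have "L x * \<beta> x = L x * (\<iota> x * prl (sdim M x) (sdim K x)) + prr (sdim M x) (sdim K x)"
      using d[OF x] by (simp add: \<beta>_def mult_add_dim pX)
    then have Lb: "(L x - L x * \<iota> x * \<pi> x) * \<beta> x = prr (sdim M x) (sdim K x)"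
      using d[OF x] hom_fam_dims[OF b x]
      by (simp add: diff_mult_dim mult_assoc_dim pb) (rule eq_matI, auto)
    have "\<alpha> x * \<beta> x = inl (sdim M x) (sdim K x) * (\<pi> x * \<beta> x)
      + inr (sdim M x) (sdim K x) * ((L x - L x * \<iota> x * \<pi> x) * \<beta> x)"
      using d[OF x] hom_fam_dims[OF b x] by (simp add: \<alpha>_def add_mult_dim mult_assoc_dim)
    then show ?thesis by (simp add: pb Lb block_sum sdim_direct_sum)
  qed
  have ba: "\<beta> x * \<alpha> x = 1\<^sub>m (sdim V x)" if x: "x \<le> n" for x
  proof -
    have "\<beta> x * \<alpha> x = \<iota> x * \<pi> x + \<kappa> x * (L x - L x * \<iota> x * \<pi> x)"
      using d[OF x] by (simp add: \<alpha>_def \<beta>_def block_simps)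
    also have "\<dots> = \<kappa> x * L x + G x * \<pi> x"
      unfolding Gi[OF x] using d[OF x] by (simp add: mat_dim_simps) (rule eq_matI, auto)
    finally show ?thesis using kL[OF x] by simp
  qed
  have "hom_fam n V ?S \<alpha>" by (rule hom_fam_inverse[OF S V b ac ab ba])
  then have "rep_iso n V ?S" using b ab ba by (intro rep_isoI) auto
  then have "is_zero_rep n K" using ind M K by (auto simp: indecomposable_rep_def)
  then have K0: "sdim K x = 0" if "x \<le> n" for x using that by (auto simp: is_zero_rep_def sdim_def)
  have ip: "\<iota> x * \<pi> x = 1\<^sub>m (sdim V x)" if x: "x \<le> n" for x
  proof -
    have "\<kappa> x * (L x * \<iota> x) = 0\<^sub>m (sdim V x) (sdim M x)" "\<kappa> x * L x = 0\<^sub>m (sdim V x) (sdim V x)"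
      using d[OF x] K0[OF x] by (auto intro!: eq_matI simp: scalar_prod_def)
    moreover from this have "G x = \<iota> x" unfolding Gi[OF x] using d[OF x] by (auto intro!: eq_matI)
    ultimately show ?thesis using kL[OF x] d[OF x] by (simp add: zero_add_dim)
  qed
  show ?thesis by (rule rep_isoI[OF p i ip pi])
qed

text \<open>It suffices to split off one interval: a nonzero vector at the lowest vertex with a
  nonzero space generates an interval module that is a direct summand.\<close>

theorem indecomposable_interval:
  fixes V :: "'k::field quiver_rep"
  assumes ind: "indecomposable_rep n V"
  shows "\<exists>i j. i < j \<and> j \<le> n \<and> rep_iso n V (interval_rep i j)"
proof -
  have V: "is_rep n V" and nz: "\<not> is_zero_rep n V" using ind by (auto simp: indecomposable_rep_def)
  define P where "P x \<longleftrightarrow> x \<le> n \<and> sdim V x \<noteq> 0" for x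
  obtain y where "y \<in> {1..n}" "dimv V y \<noteq> 0" using nz unfolding is_zero_rep_def by blast
  then have "P y" by (simp add: P_def sdim_def)
  define x where "x = (LEAST x. P x)"
  have "P x" unfolding x_def using \<open>P y\<close> by (rule LeastI)
  then have x: "x \<le> n" "sdim V x \<noteq> 0" by (auto simp: P_def)
  then have x0: "0 < x" using sdim_0 by (cases x) auto
  have below: "sdim V y = 0" if "y < x" for y
    using not_less_Least[of y P] that x(1) unfolding x_def[symmetric] by (auto simp: P_def)
  define v where "v = mat (sdim V x) 1 (\<lambda>(a, _). if a = 0 then 1 else 0 :: 'k)"
  have v: "v \<in> carrier_mat (sdim V x) 1" by (simp add: v_def)
  define A where "A = {j. x \<le> j \<and> j \<le> n \<and> tmap V x j * v \<noteq> 0\<^sub>m (sdim V j) 1}"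
  have "v $$ (0, 0) = 1" using x(2) by (simp add: v_def)
  then have "v \<noteq> 0\<^sub>m (sdim V x) 1" using x(2) by auto
  then have "x \<in> A" using x v by (simp add: A_def)
  have finA: "finite A" by (rule finite_subset[of _ "{..n}"]) (auto simp: A_def)
  \<comment> \<open>The last vertex at which the image of \<open>v\<close> is nonzero. A functional
    \<open>\<phi>\<close> with value 1 on that image \<open>w\<close> will give the
    retraction.\<close>
  define j where "j = Max A"
  have "j \<in> A" unfolding j_def using finA \<open>x \<in> A\<close> by (intro Max_in) auto
  then have j: "x \<le> j" "j \<le> n" and wj: "tmap V x j * v \<noteq> 0\<^sub>m (sdim V j) 1" by (auto simp: A_def)
  have dies: "tmap V x (Suc j) * v = 0\<^sub>m (sdim V (Suc j)) 1" if "j < n"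
  proof (rule ccontr)
    assume "\<not> ?thesis"
    then have "Suc j \<in> A" using that j by (auto simp: A_def)
    then have "Suc j \<le> j" unfolding j_def using finA by (rule Max_ge[rotated])
    then show False by simp
  qed
  have dT: "dim_row (tmap V a b) = sdim V b" "dim_col (tmap V a b) = sdim V a" if "a \<le> b" "b \<le> n" for a b
    using tmap_dims[OF V that] by auto
  define w where "w = tmap V x j * v"
  have w: "w \<in> carrier_mat (sdim V j) 1" using v dT[OF j] by (auto simp: w_def intro!: carrier_matI)
  obtain i where i: "i < sdim V j" "w $$ (i, 0) \<noteq> 0"
  proof -
    have "w = 0\<^sub>m (sdim V j) 1" if "\<forall>i<sdim V j. w $$ (i, 0) = 0"
      by (rule eq_matI) (use w that in auto)
    then show ?thesis using that wj unfolding w_def by blast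
  qed
  define \<phi> where "\<phi> = mat 1 (sdim V j) (\<lambda>(_, a). if a = i then 1 / w $$ (i, 0) else 0)"
  have \<phi>: "\<phi> \<in> carrier_mat 1 (sdim V j)" by (simp add: \<phi>_def)
  have pw: "\<phi> * w = 1\<^sub>m 1"
  proof (rule eq_matI)
    fix a b assume "a < dim_row (1\<^sub>m 1 :: 'k mat)" "b < dim_col (1\<^sub>m 1 :: 'k mat)"
    then have ab: "a = 0" "b = 0" by auto
    have "(\<phi> * w) $$ (0, 0) = (\<Sum>l<sdim V j. \<phi> $$ (0, l) * w $$ (l, 0))"
      by (rule mult_index_sum[OF \<phi> w]) auto
    also have "\<dots> = (\<Sum>l<sdim V j. if l = i then 1 else 0)"
      by (intro sum.cong) (use i in \<open>auto simp: \<phi>_def\<close>)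
    also have "\<dots> = 1" using i by simp
    finally show "(\<phi> * w) $$ (a, b) = 1\<^sub>m 1 $$ (a, b)" using ab by simp
  qed (use \<phi> w in auto)
  \<comment> \<open>The support of \<open>interval_rep k j\<close> begins at \<open>Suc k\<close>,
    hence the shift. As the space at \<open>k\<close> is zero, any functional at \<open>j\<close>
    defines a homomorphism to this interval module.\<close>
  define k where "k = x - 1"
  have xk: "x = Suc k" using x0 by (simp add: k_def)
  let ?M = "interval_rep k j :: 'k quiver_rep"
  note M = is_rep_interval[of n k j, where 'a = 'k]
  have kj: "k < j" using j xk by simp
  define \<pi> where "\<pi> y = (if k < y \<and> y \<le> j then \<phi> * tmap V y j else 0\<^sub>m 0 (sdim V y))" for y
  have "\<phi> * tmap V k j = 0\<^sub>m 1 (sdim V k)"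
    by (rule zero_mat_eq[of _ 1 "sdim V k"]) (use \<phi> dT[of k j] below[of k] xk j in \<open>auto intro!: carrier_matI\<close>)
  then have p: "hom_fam n V ?M \<pi>"
    unfolding \<pi>_def by (rule hom_fam_to_interval[OF V kj j(2) \<phi>])
  define \<iota> where "\<iota> y = (if k < y \<and> y \<le> j then tmap V x y * v else 0\<^sub>m (sdim V y) 0)" for y
  have ic: "\<iota> y \<in> carrier_mat (sdim V y) (sdim ?M y)" if "y \<le> n" for y
    using dT[of x y] v that xk by (auto simp: \<iota>_def sdim_interval intro!: carrier_matI)
  have "hom_fam n ?M V \<iota>"
    unfolding hom_fam_def
  proof (intro conjI allI impI)
    fix y assume y: "y < n"
    note d = carrier_matD[OF ic, of y] carrier_matD[OF ic, of "Suc y"] sact_dims[OF V y] sact_dims[OF M y] carrier_matD[OF v]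
    consider "k < y" "y < j" | "y = j" | "y \<le> k \<or> j < y" by linarith
    then show "\<iota> (Suc y) * sact ?M y = sact V y * \<iota> y"
    proof cases
      case 1
      then show ?thesis using d y dT[of x y] xk
        by (simp add: \<iota>_def sact_interval mult_assoc_dim)
    next
      case 2
      have "sact V j * (tmap V x j * v) = tmap V x (Suc j) * v"
        using d 2 y dT[OF j] j xk by (simp add: mult_assoc_dim)
      then show ?thesis using d 2 y kj dies
        by (simp add: \<iota>_def sact_interval sdim_interval mult_zero_dim)
    next
      case 3
      then show ?thesis
        by (intro zero_mat_eq[of _ "sdim V (Suc y)" "sdim ?M y"])
          (use d y in \<open>auto simp: sdim_interval intro!: carrier_matI\<close>)
    qed
  qed (use ic in auto)
  moreover have "\<pi> y * \<iota> y = 1\<^sub>m (sdim ?M y)" if y: "y \<le> n" for y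
  proof (cases "k < y \<and> y \<le> j")
    case True
    have "\<pi> y * \<iota> y = \<phi> * ((tmap V y j * tmap V x y) * v)"
      using True dT[of x y] dT[of y j] v \<phi> y xk j by (simp add: \<pi>_def \<iota>_def mult_assoc_dim)
    also have "tmap V y j * tmap V x y = tmap V x j" using True tmap_comp[OF V, of x y j] xk j by simp
    finally show ?thesis using True pw by (simp add: w_def sdim_interval)
  next
    case False
    then show ?thesis using hom_fam_carrier[OF p y] ic[OF y]
      by (intro zero_mat_eq[of _ 0 0]) (auto simp: sdim_interval)
  qed
  ultimately have "retract_of n ?M V" using p unfolding retract_of_def by blast
  moreover have "\<not> is_zero_rep n ?M"
    using kj j xk x by (auto simp: is_zero_rep_def interval_rep_def Let_def intro!: bexI[of _ j])
  ultimately have "rep_iso n V ?M" by (intro indecomposable_retract[OF ind M])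
  then show ?thesis using kj j by blast
qed

section \<open>Bijective transition maps and the perpendicular category\<close>

text \<open>Comparing the vanishing of dimensions is enough for interval modules, whose spaces have
  dimension 0 or 1.\<close>

lemma bij_mat_zero_dims:
  fixes A :: "'k::field mat"
  assumes "bij_mat A"
  shows "dim_row A = 0 \<longleftrightarrow> dim_col A = 0"
proof -
  obtain N where N: "N \<in> carrier_mat (dim_col A) (dim_row A)" "N * A = 1\<^sub>m (dim_col A)" "A * N = 1\<^sub>m (dim_row A)"
    using assms by (auto simp: bij_mat_def)
  have "dim_col A = 0" if "dim_row A = 0"
  proof (rule ccontr)
    assume "dim_col A \<noteq> 0"
    then have "(N * A) $$ (0, 0) = 1" by (simp add: N)
    then show False using N(1) that \<open>dim_col A \<noteq> 0\<close> by (simp add: scalar_prod_def)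
  qed
  moreover have "dim_row A = 0" if "dim_col A = 0"
  proof (rule ccontr)
    assume "dim_row A \<noteq> 0"
    then have "(A * N) $$ (0, 0) = 1" by (simp add: N)
    then show False using N(1) that \<open>dim_row A \<noteq> 0\<close> by (simp add: scalar_prod_def)
  qed
  ultimately show ?thesis by blast
qed

lemma rep_iso_sdim_zero:
  assumes "is_rep n V" "is_rep n W" "rep_iso n V W" "x \<le> n"
  shows "sdim V x = 0 \<longleftrightarrow> sdim W x = 0"
proof -
  obtain f g where fg: "hom_fam n V W f" "hom_fam n W V g"
    "\<And>x. x \<le> n \<Longrightarrow> g x * f x = 1\<^sub>m (sdim V x)" "\<And>x. x \<le> n \<Longrightarrow> f x * g x = 1\<^sub>m (sdim W x)"
    using rep_isoE[OF assms(1-3)] by blast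
  have "bij_mat (f x)" unfolding bij_mat_def
    by (rule bexI[of _ "g x"]) (use fg(3,4) assms(4) hom_fam_dims[OF fg(1)] hom_fam_carrier[OF fg(2)] in auto)
  then show ?thesis using bij_mat_zero_dims hom_fam_dims[OF fg(1) assms(4)] by metis
qed

lemma rep_iso_refl: "is_rep n V \<Longrightarrow> rep_iso n V V"
  by (rule rep_isoI[OF hom_fam_one hom_fam_one]) auto

lemma interval_iso_unique:
  fixes E :: "'k::field quiver_rep"
  assumes "is_rep n E" "rep_iso n E (interval_rep i j)" "rep_iso n E (interval_rep k l)"
    and "i < j" "j \<le> n" "k < l" "l \<le> n"
  shows "i = k \<and> j = l"
proof -
  have *: "(i < x \<and> x \<le> j) = (k < x \<and> x \<le> l)" if "x \<le> n" for x
    using rep_iso_sdim_zero[OF assms(1) is_rep_interval assms(2) that]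
      rep_iso_sdim_zero[OF assms(1) is_rep_interval assms(3) that]
    by (auto simp: sdim_interval split: if_splits)
  show ?thesis using *[of "Suc i"] *[of j] *[of "Suc k"] *[of l] assms(4-) by auto
qed

text \<open>Two out of three: among the transition maps between \<open>x \<le> y \<le> z\<close>,
  bijectivity of two implies that of the third. The six orders of \<open>a\<close>,
  \<open>b\<close>, \<open>c\<close> are instances of this.\<close>

lemma bij_tmap_trans:
  assumes V: "is_rep n V" and "a \<le> n" "b \<le> n" "c \<le> n"
    and ab: "bij_mat (tmap V (min a b) (max a b))" and bc: "bij_mat (tmap V (min b c) (max b c))"
  shows "bij_mat (tmap V (min a c) (max a c))"
proof -
  have chain: "(bij_mat (tmap V x y) \<and> bij_mat (tmap V y z) \<longrightarrow> bij_mat (tmap V x z)) \<and>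
    (bij_mat (tmap V x y) \<and> bij_mat (tmap V x z) \<longrightarrow> bij_mat (tmap V y z)) \<and>
    (bij_mat (tmap V x z) \<and> bij_mat (tmap V y z) \<longrightarrow> bij_mat (tmap V x y))"
    if xyz: "x \<le> y" "y \<le> z" "z \<le> n" for x y z
  proof -
    have eq: "tmap V y z * tmap V x y = tmap V x z" by (rule tmap_comp[OF V xyz])
    have d: "dim_col (tmap V y z) = dim_row (tmap V x y)"
      using tmap_dims[OF V, of x y] tmap_dims[OF V, of y z] xyz by simp
    show ?thesis
      using bij_mat_mult[of "tmap V y z" "tmap V x y"] bij_mat_cancel_left[of "tmap V y z" "tmap V x y"]
        bij_mat_cancel_right[of "tmap V y z" "tmap V x y"] d unfolding eq by blast
  qed
  consider "a \<le> b" "b \<le> c" | "a \<le> c" "c \<le> b" | "b \<le> a" "a \<le> c" | "b \<le> c" "c \<le> a" | "c \<le> a" "a \<le> b" | "c \<le> b" "b \<le> a"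
    by linarith
  then show ?thesis
  proof cases
    case 1
    then have eqs: "min a b = a" "max a b = b" "min b c = b" "max b c = c" "min a c = a" "max a c = c" by auto
    show ?thesis using ab bc chain[OF 1 assms(4)] unfolding eqs by blast
  next
    case 2
    then have eqs: "min a b = a" "max a b = b" "min b c = c" "max b c = b" "min a c = a" "max a c = c" by auto
    show ?thesis using ab bc chain[OF 2 assms(3)] unfolding eqs by blast
  next
    case 3
    then have eqs: "min a b = b" "max a b = a" "min b c = b" "max b c = c" "min a c = a" "max a c = c" by auto
    show ?thesis using ab bc chain[OF 3 assms(4)] unfolding eqs by blast
  next
    case 4
    then have eqs: "min a b = b" "max a b = a" "min b c = b" "max b c = c" "min a c = c" "max a c = a" by auto
    show ?thesis using ab bc chain[OF 4 assms(2)] unfolding eqs by blast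
  next
    case 5
    then have eqs: "min a b = a" "max a b = b" "min b c = c" "max b c = b" "min a c = c" "max a c = a" by auto
    show ?thesis using ab bc chain[OF 5 assms(3)] unfolding eqs by blast
  next
    case 6
    then have eqs: "min a b = b" "max a b = a" "min b c = c" "max b c = b" "min a c = c" "max a c = a" by auto
    show ?thesis using ab bc chain[OF 6 assms(2)] unfolding eqs by blast
  qed
qed

lemma hom_fam_zero:
  assumes "is_rep n V" "is_rep n W"
  shows "hom_fam n V W (\<lambda>x. 0\<^sub>m (sdim W x) (sdim V x))"
  using assms by (auto simp: hom_fam_def sact_dims zero_mult_dim mult_zero_dim)

text \<open>By \<open>perp_interval\<close>, for a set \<open>B\<close> of strands this is the left
  perpendicular category of their interval modules.\<close>

definition iso_along :: "nat \<Rightarrow> (nat \<times> nat) set \<Rightarrow> 'k::field quiver_rep set" where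
  "iso_along n B = {W. is_rep n W \<and> (\<forall>(k, l)\<in>B. bij_mat (tmap W k l))}"

text \<open>Transition maps along \<open>B\<close> are bijective on \<open>X\<close> and
  \<open>Y\<close>, hence on the kernel of \<open>f\<close>, which is thus a legitimate test object.
  Comparing its inclusion with the zero map shows that it vanishes.\<close>

lemma mono_in_linv:
  fixes X Y :: "'k::field quiver_rep"
  assumes B: "\<forall>(k, l)\<in>B. k < l \<and> l \<le> n"
    and XC: "X \<in> iso_along n B" and YC: "Y \<in> iso_along n B"
    and mono: "mono_in n (iso_along n B) X Y f"
    and x: "x \<le> n"
  shows "linv ((f(0 := 0\<^sub>m 0 0)) x)"
proof -
  have X: "is_rep n X" and Y: "is_rep n Y" using XC YC by (auto simp: iso_along_def)
  define F where "F = f(0 := 0\<^sub>m 0 0)"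
  have F: "hom_fam n X Y F" using mono unfolding F_def mono_in_def by (blast intro: morphism_hom_fam[OF X Y])
  obtain K \<kappa> L G where K: "is_rep n K" and k: "hom_fam n K X \<kappa>"
    and Lc: "\<And>x. x \<le> n \<Longrightarrow> L x \<in> carrier_mat (sdim K x) (sdim X x)"
    and Gc: "\<And>x. x \<le> n \<Longrightarrow> G x \<in> carrier_mat (sdim X x) (sdim Y x)"
    and Fk: "\<And>x. x \<le> n \<Longrightarrow> F x * \<kappa> x = 0\<^sub>m (sdim Y x) (sdim K x)"
    and Lk: "\<And>x. x \<le> n \<Longrightarrow> L x * \<kappa> x = 1\<^sub>m (sdim K x)"
    and kL: "\<And>x. x \<le> n \<Longrightarrow> \<kappa> x * L x + G x * F x = 1\<^sub>m (sdim X x)"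
    using kernel_rep[OF X Y F] by blast
  have d: "dim_row (F x) = sdim Y x" "dim_col (F x) = sdim X x"
    "dim_row (\<kappa> x) = sdim X x" "dim_col (\<kappa> x) = sdim K x" "dim_row (L x) = sdim K x" "dim_col (L x) = sdim X x"
    "dim_row (G x) = sdim X x" "dim_col (G x) = sdim Y x" if "x \<le> n" for x
    using hom_fam_dims[OF F that] hom_fam_dims[OF k that] Lc[OF that] Gc[OF that] by auto
  have "bij_mat (tmap K a b)" if e: "(a, b) \<in> B" for a b
  proof -
    have ab: "a \<le> b" "b \<le> n" "a \<le> n" using B e by auto
    note da = d[OF ab(3)] d[OF ab(2)] tmap_dims[OF X ab(1,2)] tmap_dims[OF Y ab(1,2)] tmap_dims[OF K ab(1,2)]
    have bX: "bij_mat (tmap X a b)" and bY: "bij_mat (tmap Y a b)" using XC YC e by (auto simp: iso_along_def)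
    obtain N where N: "N \<in> carrier_mat (sdim X a) (sdim X b)" "N * tmap X a b = 1\<^sub>m (sdim X a)" "tmap X a b * N = 1\<^sub>m (sdim X b)"
      using bX da by (auto simp: bij_mat_def)
    have Nd: "dim_row N = sdim X a" "dim_col N = sdim X b" using N by auto
    have XN: "tmap X a b * (N * A) = A" if "dim_row A = sdim X b" for A
      using that Nd da N(3) by (simp flip: mult_assoc_dim)
    have NX: "N * (tmap X a b * A) = A" if "dim_row A = sdim X a" for A
      using that Nd da N(2) by (simp flip: mult_assoc_dim)
    have kT: "\<kappa> b * tmap K a b = tmap X a b * \<kappa> a" by (rule hom_fam_tmap[OF K X k ab(1,2)])
    have FT: "F b * tmap X a b = tmap Y a b * F a" by (rule hom_fam_tmap[OF X Y F ab(1,2)])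
    \<comment> \<open>Pulled back along the bijection of \<open>X\<close>, the inclusion at
      \<open>b\<close> lands in the kernel at \<open>a\<close>, because the map of \<open>Y\<close>
      is injective. Its coordinates form the inverse \<open>N'\<close> on the kernel.\<close>
    have "tmap Y a b * (F a * (N * \<kappa> b)) = (F b * tmap X a b) * (N * \<kappa> b)"
      using da Nd by (simp add: FT mult_assoc_dim)
    also have "\<dots> = F b * \<kappa> b" using da Nd by (simp add: mult_assoc_dim XN)
    also have "\<dots> = tmap Y a b * 0\<^sub>m (sdim Y a) (sdim K b)" using da by (simp add: Fk[OF ab(2)] mult_zero_dim)
    finally have FN: "F a * (N * \<kappa> b) = 0\<^sub>m (sdim Y a) (sdim K b)"
      using bY da Nd unfolding bij_mat_iff by (elim conjE linv_cancel) auto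
    have "N * \<kappa> b = (\<kappa> a * L a + G a * F a) * (N * \<kappa> b)" using da Nd by (simp add: kL[OF ab(3)])
    also have "\<dots> = \<kappa> a * (L a * (N * \<kappa> b)) + G a * (F a * (N * \<kappa> b))"
      using da Nd by (simp add: add_mult_dim mult_assoc_dim)
    also have "\<dots> = \<kappa> a * (L a * (N * \<kappa> b))" using da Nd by (simp add: FN mult_zero_dim add_zero_dim)
    finally have kLN: "\<kappa> a * (L a * (N * \<kappa> b)) = N * \<kappa> b" by simp
    define N' where "N' = L a * (N * \<kappa> b)"
    have N': "N' \<in> carrier_mat (sdim K a) (sdim K b)" using da Nd by (auto simp: N'_def intro!: carrier_matI)
    have "N' * tmap K a b = L a * (N * (\<kappa> b * tmap K a b))" using da Nd by (simp add: N'_def mult_assoc_dim)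
    also have "\<dots> = 1\<^sub>m (sdim K a)" using da Nd by (simp add: kT NX Lk[OF ab(3)])
    finally have 1: "N' * tmap K a b = 1\<^sub>m (sdim K a)" .
    have "\<kappa> b * (tmap K a b * N') = (\<kappa> b * tmap K a b) * N'" using da N' by (simp add: mult_assoc_dim)
    also have "\<dots> = tmap X a b * (\<kappa> a * N')" using da N' by (simp add: kT mult_assoc_dim)
    also have "\<dots> = \<kappa> b" using da Nd by (simp add: N'_def kLN XN)
    finally have "\<kappa> b * (tmap K a b * N') = \<kappa> b" .
    then have "L b * (\<kappa> b * (tmap K a b * N')) = 1\<^sub>m (sdim K b)" by (simp add: Lk[OF ab(2)])
    moreover have "L b * (\<kappa> b * (tmap K a b * N')) = tmap K a b * N'"
      using da N' by (simp add: Lk[OF ab(2)] flip: mult_assoc_dim)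
    ultimately have "tmap K a b * N' = 1\<^sub>m (sdim K b)" by simp
    then show ?thesis using 1 N' da unfolding bij_mat_def by auto
  qed
  then have KC: "K \<in> iso_along n B" using K by (auto simp: iso_along_def)
  define z where "z x = (0\<^sub>m (sdim X x) (sdim K x) :: 'k mat)" for x
  have mk: "morphism n K X \<kappa>" and mz: "morphism n K X z"
    using hom_fam_morphism[OF k] hom_fam_morphism[OF hom_fam_zero[OF K X]] by (auto simp: z_def[abs_def])
  have "mor_eq n (mor_comp f \<kappa>) (mor_comp f z)"
    unfolding mor_eq_def
  proof
    fix y assume "y \<in> {1..n}"
    then have y: "y \<le> n" "y \<noteq> 0" by auto
    have "F y * \<kappa> y = F y * z y" using Fk[OF y(1)] d[OF y(1)] by (simp add: z_def mult_zero_dim)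
    then show "mor_comp f \<kappa> y = mor_comp f z y" using y by (simp add: mor_comp_def F_def)
  qed
  then have eq: "mor_eq n \<kappa> z" using mono KC mk mz unfolding mono_in_def by blast
  have "\<kappa> x = z x"
  proof (cases "x = 0")
    case True
    then show ?thesis using d[OF x] by (intro zero_mat_eq[of _ 0 "sdim K x"]) (auto simp: z_def intro!: carrier_matI)
  next
    case False
    then show ?thesis using eq x by (auto simp: mor_eq_def)
  qed
  then have "G x * F x = 1\<^sub>m (sdim X x)"
    using kL[OF x] d[OF x] by (simp add: z_def zero_mult_dim zero_add_dim)
  then show ?thesis using d[OF x] Gc[OF x] unfolding F_def[symmetric] linv_def by auto
qed

text \<open>The sought homomorphism is a functional \<open>\<eta>\<close> at \<open>j\<close> that
  restricts to \<open>g j\<close> along \<open>f j\<close> and vanishes on the image of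
  \<open>tmap Y i j\<close>. It exists once every relation
  \<open>f j * P + tmap Y i j * Q = 0\<close> forces \<open>g j * P = 0\<close>, which is where
  \<open>esc\<close> enters.\<close>

lemma extend_to_interval:
  fixes X Y :: "'k::field quiver_rep"
  assumes X: "is_rep n X" and Y: "is_rep n Y" and f: "hom_fam n X Y f" and inj: "linv (f j)"
    and ij: "i < j" "j \<le> n" and g: "hom_fam n X (interval_rep i j) g"
    and esc: "sdim Y i = 0 \<or> (\<exists>z>j. z \<le> n \<and> bij_mat (tmap X i z) \<and> bij_mat (tmap Y i z))"
  shows "\<exists>h. hom_fam n Y (interval_rep i j) h \<and> (\<forall>x\<le>n. h x * f x = g x)"
proof -
  have ij': "i \<le> j" "i \<le> n" using ij by auto
  let ?M = "interval_rep i j :: 'k quiver_rep"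
  let ?a = "sdim X j" and ?b = "sdim Y i"
  note dj = hom_fam_dims[OF f ij(2)] hom_fam_dims[OF f ij'(2)] tmap_dims[OF X ij'(1) ij(2)] tmap_dims[OF Y ij'(1) ij(2)]
  have gj: "dim_row (g j) = 1" "dim_col (g j) = ?a" using hom_fam_dims[OF g ij(2)] ij by (auto simp: sdim_interval)
  \<comment> \<open>\<open>A\<close> is the block row of \<open>f j\<close> and
    \<open>tmap Y i j\<close>, and \<open>D\<close> the block row of \<open>g j\<close> and zero.
    The columns of the kernel basis \<open>B\<close> are the relations to be checked.\<close>
  define A where "A = f j * prl ?a ?b + tmap Y i j * prr ?a ?b"
  define D where "D = g j * prl ?a ?b"
  have A: "A \<in> carrier_mat (sdim Y j) (?a + ?b)" using dj by (auto simp: A_def intro!: carrier_matI)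
  have D: "D \<in> carrier_mat 1 (?a + ?b)" using gj by (auto simp: D_def intro!: carrier_matI)
  obtain r G B L where c: "G \<in> carrier_mat (?a + ?b) (sdim Y j)" "B \<in> carrier_mat (?a + ?b) r" "L \<in> carrier_mat r (?a + ?b)"
    and AB: "A * B = 0\<^sub>m (sdim Y j) r" and BL: "B * L + G * A = 1\<^sub>m (?a + ?b)"
    using kernel_split[OF A] by blast
  have cd: "dim_row B = ?a + ?b" "dim_col B = r" "dim_row L = r" "dim_col L = ?a + ?b" "dim_row G = ?a + ?b"
    "dim_col G = sdim Y j" using c by auto
  define P where "P = prl ?a ?b * B"
  define Q where "Q = prr ?a ?b * B"
  have PQ: "dim_row P = ?a" "dim_col P = r" "dim_row Q = ?b" "dim_col Q = r" using cd by (auto simp: P_def Q_def)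
  have AB': "f j * P + tmap Y i j * Q = 0\<^sub>m (sdim Y j) r"
    using AB dj cd by (simp add: A_def P_def Q_def add_mult_dim mult_assoc_dim)
  have "g j * P = 0\<^sub>m 1 r"
    using esc
  proof
    assume b0: "sdim Y i = 0"
    have "Q = 0\<^sub>m 0 r" by (rule zero_mat_eq[of _ 0 r]) (use b0 PQ in \<open>auto intro: carrier_matI\<close>)
    then have "tmap Y i j * Q = 0\<^sub>m (sdim Y j) r" using b0 dj by (simp add: mult_zero_dim)
    then have "f j * P = f j * 0\<^sub>m ?a r" using AB' dj PQ by (simp add: add_zero_dim mult_zero_dim)
    then have "P = 0\<^sub>m ?a r" by (rule linv_cancel[OF inj]) (use PQ dj in auto)
    then show ?thesis using gj by (simp add: mult_zero_dim)
  next
    assume "\<exists>z>j. z \<le> n \<and> bij_mat (tmap X i z) \<and> bij_mat (tmap Y i z)"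
    then obtain z where z: "j < z" "z \<le> n" and bX: "bij_mat (tmap X i z)" and bY: "bij_mat (tmap Y i z)" by blast
    have iz: "i \<le> z" "j \<le> z" using z ij by auto
    note dz = hom_fam_dims[OF f z(2)] tmap_dims[OF X iz(1) z(2)] tmap_dims[OF Y iz(1) z(2)]
      tmap_dims[OF X iz(2) z(2)] tmap_dims[OF Y iz(2) z(2)]
    obtain N where N: "N \<in> carrier_mat (sdim X i) (sdim X z)" "tmap X i z * N = 1\<^sub>m (sdim X z)"
      using bX dz by (auto simp: bij_mat_def)
    have Nd: "dim_row N = sdim X i" "dim_col N = sdim X z" using N by auto
    \<comment> \<open>\<open>P'\<close> lives at \<open>i\<close> and has the same image at
      \<open>z\<close> as \<open>P\<close>. Cancelling the bijection of \<open>Y\<close> at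
      \<open>z\<close> gives \<open>f i * P' + Q = 0\<close>, and injectivity of \<open>f j\<close>
      then \<open>P = tmap X i j * P'\<close>, which \<open>g j\<close> kills.\<close>
    define P' where "P' = N * (tmap X j z * P)"
    have P': "dim_row P' = sdim X i" "dim_col P' = r" using Nd PQ by (auto simp: P'_def)
    have XP': "tmap X i z * P' = tmap X j z * P"
      using Nd dz PQ by (simp add: P'_def N(2) flip: mult_assoc_dim)
    have fi: "f z * tmap X i z = tmap Y i z * f i" "f z * tmap X j z = tmap Y j z * f j" "f j * tmap X i j = tmap Y i j * f i"
      using hom_fam_tmap[OF X Y f] iz z ij by auto
    have "tmap Y i z * (f i * P' + Q) = (f z * tmap X i z) * P' + tmap Y i z * Q"
      using dz dj P' PQ by (simp add: mult_add_dim mult_assoc_dim fi)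
    also have "(f z * tmap X i z) * P' = (f z * tmap X j z) * P"
      using dz dj P' PQ by (simp add: mult_assoc_dim XP')
    also have "\<dots> = tmap Y j z * (f j * P)" using dz dj PQ by (simp add: fi mult_assoc_dim)
    also have "tmap Y i z * Q = tmap Y j z * (tmap Y i j * Q)"
      using dz dj PQ tmap_comp[OF Y ij'(1) iz(2) z(2)] by (simp flip: mult_assoc_dim)
    also have "tmap Y j z * (f j * P) + tmap Y j z * (tmap Y i j * Q) = tmap Y j z * (f j * P + tmap Y i j * Q)"
      using dz dj PQ by (simp add: mult_add_dim)
    also have "\<dots> = tmap Y i z * 0\<^sub>m (sdim Y i) r" using dz by (simp add: AB' mult_zero_dim)
    finally have 0: "f i * P' + Q = 0\<^sub>m (sdim Y i) r"
      using bY dz dj P' PQ unfolding bij_mat_iff by (elim conjE linv_cancel) auto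
    have "f j * (tmap X i j * P') + tmap Y i j * Q = (f j * tmap X i j) * P' + tmap Y i j * Q"
      using dj P' PQ by (simp add: mult_assoc_dim)
    also have "\<dots> = tmap Y i j * (f i * P' + Q)"
      using dj P' PQ by (simp add: fi mult_assoc_dim mult_add_dim)
    also have "\<dots> = f j * P + tmap Y i j * Q" using dj by (simp add: 0 AB' mult_zero_dim)
    finally have s: "f j * (tmap X i j * P') + tmap Y i j * Q = f j * P + tmap Y i j * Q" .
    have "f j * (tmap X i j * P') = f j * P"
    proof (rule eq_matI)
      fix u v assume uv: "u < dim_row (f j * P)" "v < dim_col (f j * P)"
      show "(f j * (tmap X i j * P')) $$ (u, v) = (f j * P) $$ (u, v)"
        using arg_cong[OF s, of "\<lambda>A. A $$ (u, v)"] uv dj P' PQ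
        by (simp del: index_mult_mat(1))
    qed (use dj P' PQ in auto)
    then have "tmap X i j * P' = P" by (rule linv_cancel[OF inj]) (use dj P' PQ in auto)
    then have "g j * P = (g j * tmap X i j) * P'" using gj dj P' by (simp add: mult_assoc_dim)
    also have "\<dots> = 0\<^sub>m 1 r" using hom_fam_interval_tmap(1)[OF X ij g] P' by (simp add: zero_mult_dim)
    finally show ?thesis .
  qed
  then have DB: "D * B = 0\<^sub>m 1 r" using gj cd by (simp add: D_def P_def mult_assoc_dim)
  \<comment> \<open>As \<open>D\<close> vanishes on the kernel of \<open>A\<close>, the generalized
    inverse solves \<open>\<eta> * A = D\<close>.\<close>
  define \<eta> where "\<eta> = D * G"
  have e: "\<eta> \<in> carrier_mat 1 (sdim Y j)" using D c by (auto simp: \<eta>_def)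
  have ed: "dim_row \<eta> = 1" "dim_col \<eta> = sdim Y j" using e by auto
  note DA = carrier_matD[OF D] carrier_matD[OF A]
  have "D = D * (B * L + G * A)" using DA by (simp add: BL)
  also have "\<dots> = (D * B) * L + \<eta> * A" using DA cd by (simp add: \<eta>_def mult_add_dim mult_assoc_dim)
  also have "\<dots> = \<eta> * A" using DA cd ed by (simp add: DB zero_mult_dim zero_add_dim)
  finally have eA: "\<eta> * A = D" by simp
  have "\<eta> * f j = \<eta> * (A * inl ?a ?b)" using dj by (simp add: A_def block_simps)
  also have "\<dots> = (\<eta> * A) * inl ?a ?b" using ed DA by (simp add: mult_assoc_dim)
  also have "\<dots> = g j" unfolding eA using gj by (simp add: D_def block_simps)
  finally have ef: "\<eta> * f j = g j" .
  have "\<eta> * tmap Y i j = \<eta> * (A * inr ?a ?b)" using dj by (simp add: A_def block_simps)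
  also have "\<dots> = (\<eta> * A) * inr ?a ?b" using ed DA by (simp add: mult_assoc_dim)
  also have "\<dots> = 0\<^sub>m 1 (sdim Y i)" unfolding eA using gj by (simp add: D_def block_simps)
  finally have eT: "\<eta> * tmap Y i j = 0\<^sub>m 1 (sdim Y i)" .
  define h where "h x = (if i < x \<and> x \<le> j then \<eta> * tmap Y x j else 0\<^sub>m 0 (sdim Y x))" for x
  have h: "hom_fam n Y ?M h" unfolding h_def by (rule hom_fam_to_interval[OF Y ij e eT])
  moreover have "h x * f x = g x" if x: "x \<le> n" for x
  proof (cases "i < x \<and> x \<le> j")
    case True
    then have xj: "x \<le> j" by simp
    note dx = hom_fam_dims[OF f x] tmap_dims[OF X xj ij(2)] tmap_dims[OF Y xj ij(2)]
    have "h x * f x = \<eta> * (f j * tmap X x j)"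
      using True dx ed dj hom_fam_tmap[OF X Y f xj ij(2)] by (simp add: h_def mult_assoc_dim)
    also have "\<dots> = g j * tmap X x j" using dx ed dj by (simp add: ef flip: mult_assoc_dim)
    also have "\<dots> = g x" using hom_fam_interval_tmap(2)[OF X ij g] True by simp
    finally show ?thesis .
  next
    case False
    then show ?thesis using hom_fam_carrier[OF g x] hom_fam_carrier[OF h x] hom_fam_carrier[OF f x]
      by (intro zero_mat_eq[of _ 0 "sdim X x"]) (auto simp: sdim_interval)
  qed
  ultimately show ?thesis by blast
qed

section \<open>Noncrossing trees and the order of strands\<close>

definition adjacent :: "(nat \<times> nat) set \<Rightarrow> nat \<Rightarrow> nat \<Rightarrow> bool" where
  "adjacent D a b \<longleftrightarrow> (a, b) \<in> D \<or> (b, a) \<in> D"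

definition conn :: "(nat \<times> nat) set \<Rightarrow> nat \<Rightarrow> nat \<Rightarrow> bool" where
  "conn D = (adjacent D)\<^sup>*\<^sup>*"

text \<open>Deletes the edges at \<open>v\<close> and keeps \<open>v\<close> as an isolated vertex;
  between other vertices, connectivity in \<open>avoid v D\<close> means connectivity by walks that
  miss \<open>v\<close>.\<close>

definition avoid :: "nat \<Rightarrow> (nat \<times> nat) set \<Rightarrow> (nat \<times> nat) set" where
  "avoid v D = {(a, b) \<in> D. a \<noteq> v \<and> b \<noteq> v}"

lemma conn_refl [simp]: "conn D a a"
  by (simp add: conn_def)

lemma conn_trans: "conn D a b \<Longrightarrow> conn D b c \<Longrightarrow> conn D a c"
  by (simp add: conn_def)

lemma conn_sym: "conn D a b \<Longrightarrow> conn D b a"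
proof -
  have "symp (adjacent D)\<^sup>*\<^sup>*"
    by (rule symp_rtranclp) (auto simp: symp_def adjacent_def)
  then show "conn D a b \<Longrightarrow> conn D b a" by (auto simp: conn_def dest: sympD)
qed

lemma conn_mono:
  assumes "D \<subseteq> D'" "conn D a b"
  shows "conn D' a b"
  using assms(2) unfolding conn_def
  by (rule rtranclp_mono[THEN predicate2D, rotated]) (use assms(1) in \<open>auto simp: adjacent_def\<close>)

lemma adjacent_conn: "adjacent D a b \<Longrightarrow> conn D a b"
  by (auto simp: conn_def)

lemma edge_conn: "(a, b) \<in> D \<Longrightarrow> conn D a b"
  by (simp add: adjacent_conn adjacent_def)

lemma conn_induct [consumes 1, case_names refl step]:
  assumes "conn D a b" "P a"
    and "\<And>y z. conn D a y \<Longrightarrow> adjacent D y z \<Longrightarrow> P y \<Longrightarrow> P z"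
  shows "P b"
  using assms unfolding conn_def by (induction rule: rtranclp_induct) auto

lemma conn_step: "conn D a b \<Longrightarrow> adjacent D b c \<Longrightarrow> conn D a c"
  by (auto simp: conn_def)

lemma conn_insert:
  assumes "conn (insert (a, b) D) u v"
  shows "conn D u v \<or> (conn D u a \<and> conn D b v) \<or> (conn D u b \<and> conn D a v)"
  using assms
proof (induction rule: conn_induct)
  case (step y z)
  consider "adjacent D y z" | "y = a" "z = b" | "y = b" "z = a"
    using step(2) by (auto simp: adjacent_def)
  then show ?case
    by cases (use step(3) in \<open>auto intro: conn_step\<close>)
qed simp

lemma avoid_subset: "avoid v D \<subseteq> D"
  by (auto simp: avoid_def)

lemma avoid_subset_remove: "avoid a D \<subseteq> D - {(a, b)}" "avoid b D \<subseteq> D - {(a, b)}"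
  by (auto simp: avoid_def)

lemma conn_avoidI:
  assumes "conn D a c" "\<not> conn D a k"
  shows "conn (avoid k D) a c"
  using assms(1)
proof (induction rule: conn_induct)
  case (step y z)
  have "y \<noteq> k" "z \<noteq> k" using step assms(2) conn_step by blast+
  then have "adjacent (avoid k D) y z" using step(2) by (auto simp: adjacent_def avoid_def)
  then show ?case using step(3) conn_step by blast
qed simp

lemma conn_avoidD:
  assumes "conn (avoid v D) u v"
  shows "u = v"
proof -
  have "v = v \<longrightarrow> u = v" using assms
    by (cases rule: rtranclp.cases[OF assms[unfolded conn_def]]) (auto simp: adjacent_def avoid_def)
  then show ?thesis by simp
qed

lemma path_conn_avoid:
  assumes "successively (\<lambda>x y. (x, y) \<in> D \<or> (y, x) \<in> D) xs" "xs \<noteq> []" "v \<notin> set xs"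
  shows "conn (avoid v D) (hd xs) (last xs)"
  using assms
proof (induction xs)
  case (Cons x xs)
  show ?case
  proof (cases xs)
    case (Cons y ys)
    then have "adjacent (avoid v D) x y" "conn (avoid v D) y (last xs)"
      using Cons.prems Cons.IH by (auto simp: adjacent_def avoid_def)
    then show ?thesis using Cons adjacent_conn conn_trans by fastforce
  qed simp
qed simp

lemma simple_path_prefix:
  assumes "simple_path D u (ys @ z # zs) v"
  shows "simple_path D u (ys @ [z]) z"
proof -
  have "successively (\<lambda>x y. (x, y) \<in> D \<or> (y, x) \<in> D) ((ys @ [z]) @ zs)"
    using assms by (simp add: simple_path_def)
  then have "successively (\<lambda>x y. (x, y) \<in> D \<or> (y, x) \<in> D) (ys @ [z])"
    unfolding successively_append_iff by blast
  moreover have "hd (ys @ [z]) = u" using assms by (cases ys) (auto simp: simple_path_def)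
  ultimately show ?thesis using assms by (simp add: simple_path_def)
qed

text \<open>A simple path meets its endpoint only at the end, so the part up to \<open>i\<close>
  misses it.\<close>

lemma path_conn_avoid_prefix:
  assumes "simple_path D u xs v" "i \<in> set xs" "i \<noteq> v"
  shows "conn (avoid v D) u i"
proof -
  obtain ys zs where s: "xs = ys @ i # zs" using assms(2) by (auto simp: in_set_conv_decomp)
  have "zs \<noteq> []" using assms(1,3) unfolding s simple_path_def by auto
  then have "v \<in> set zs" using assms(1) unfolding s simple_path_def by auto
  then have "v \<notin> set (ys @ [i])" using assms(1) unfolding s simple_path_def by auto
  moreover have "simple_path D u (ys @ [i]) i" using assms(1) unfolding s by (rule simple_path_prefix)
  ultimately show ?thesis using path_conn_avoid[of D "ys @ [i]" v] by (simp add: simple_path_def)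
qed

text \<open>If the next vertex was visited before, the path is cut there. The second conjunct serves
  to keep a path in \<open>avoid v D\<close> away from \<open>v\<close>.\<close>

lemma conn_simple_path:
  assumes "conn D u v"
  shows "\<exists>xs. simple_path D u xs v \<and> (\<forall>x\<in>set xs. conn D u x)"
  using assms
proof (induction rule: conn_induct)
  case refl
  show ?case by (rule exI[of _ "[u]"]) (simp add: simple_path_def)
next
  case (step y z)
  then obtain xs where xs: "simple_path D u xs y" "\<forall>x\<in>set xs. conn D u x" by blast
  show ?case
  proof (cases "z \<in> set xs")
    case True
    then obtain ys zs where s: "xs = ys @ z # zs" by (auto simp: in_set_conv_decomp)
    have "simple_path D u (ys @ [z]) z" using xs(1) unfolding s by (rule simple_path_prefix)
    then show ?thesis using xs(2) s by (intro exI[of _ "ys @ [z]"]) auto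
  next
    case False
    have "simple_path D u (xs @ [z]) z"
      using xs(1) False step(2) unfolding simple_path_def adjacent_def
      by (auto simp: successively_append_iff)
    moreover have "conn D u z" using step conn_step by blast
    ultimately show ?thesis using xs(2) by (intro exI[of _ "xs @ [z]"]) auto
  qed
qed

section \<open>Noncrossing graphs\<close>

definition noncrossing :: "(nat \<times> nat) set \<Rightarrow> bool" where
  "noncrossing D \<longleftrightarrow> (\<forall>(a, b)\<in>D. a < b) \<and> (\<forall>(a, b)\<in>D. \<forall>(c, d)\<in>D. \<not> (a < c \<and> c < b \<and> b < d))"

lemma noncrossing_less: "noncrossing D \<Longrightarrow> (a, b) \<in> D \<Longrightarrow> a < b"
  by (auto simp: noncrossing_def)

lemma noncrossingD: "noncrossing D \<Longrightarrow> (a, b) \<in> D \<Longrightarrow> (c, d) \<in> D \<Longrightarrow> a < c \<Longrightarrow> c < b \<Longrightarrow> d \<le> b"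
  unfolding noncrossing_def by (metis (no_types, lifting) case_prodD not_less)

lemma noncrossing_mono: "noncrossing D \<Longrightarrow> D' \<subseteq> D \<Longrightarrow> noncrossing D'"
  unfolding noncrossing_def by blast

text \<open>An edge from the inside of the chord to the outside would cross it or use one of its
  ends.\<close>

lemma chord_separates:
  assumes "noncrossing D" "(k, l) \<in> D" "conn (avoid k (avoid l D)) u v"
  shows "(k < u \<and> u < l) = (k < v \<and> v < l)"
  using assms(3)
proof (induction rule: conn_induct)
  case (step y z)
  have ne: "y \<noteq> k" "y \<noteq> l" "z \<noteq> k" "z \<noteq> l" and "(y, z) \<in> D \<or> (z, y) \<in> D"
    using step(2) by (auto simp: adjacent_def avoid_def)
  have *: "(k < a \<and> a < l) = (k < b \<and> b < l)"
    if "(a, b) \<in> D" "a \<noteq> k" "a \<noteq> l" "b \<noteq> k" "b \<noteq> l" for a b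
    using noncrossingD[OF assms(1) assms(2) that(1)] noncrossingD[OF assms(1) that(1) assms(2)]
      noncrossing_less[OF assms(1) that(1)] that(2-) by fastforce
  show ?case using step(3) * \<open>(y, z) \<in> D \<or> (z, y) \<in> D\<close> ne by blast
qed simp

text \<open>A discrete Jordan curve argument: if the components differ, no edge in the component of
  \<open>b\<close> separates \<open>a\<close> from \<open>c\<close>, so a walk from \<open>b\<close>
  stays between \<open>a\<close> and \<open>c\<close>, whereas \<open>d\<close> lies
  outside.\<close>

lemma noncrossing_components:
  assumes "noncrossing D" "conn D a c" "conn D b d" "a < b" "b < c" "c < d"
  shows "conn D a b"
proof (rule ccontr)
  assume nc: "\<not> conn D a b"
  have sep: "(k < a \<and> a < l) = (k < c \<and> c < l)" if e: "(k, l) \<in> D" and bk: "conn D b k" for k l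
  proof -
    have "\<not> conn D a k" "\<not> conn D a l"
      using nc bk edge_conn[OF e] conn_sym conn_trans by blast+
    then have "conn (avoid k (avoid l D)) a c"
      using assms(2) conn_avoidI conn_mono[OF avoid_subset] by blast
    then show ?thesis by (rule chord_separates[OF assms(1) e])
  qed
  have "a < d \<and> d < c" using assms(3)
  proof (induction rule: conn_induct)
    case refl
    then show ?case using assms by simp
  next
    case (step y z)
    have bz: "conn D b z" using step conn_step by blast
    have "z \<noteq> a" "z \<noteq> c" using nc bz assms(2) conn_sym conn_trans by blast+
    consider "(y, z) \<in> D" | "(z, y) \<in> D" using step(2) by (auto simp: adjacent_def)
    then show ?case
    proof cases
      case 1
      then show ?thesis using sep[OF 1 step(1)] noncrossing_less[OF assms(1) 1] step(3)
          \<open>z \<noteq> a\<close> \<open>z \<noteq> c\<close> by auto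
    next
      case 2
      then show ?thesis using sep[OF 2 bz] noncrossing_less[OF assms(1) 2] step(3)
          \<open>z \<noteq> a\<close> \<open>z \<noteq> c\<close> by auto
    qed
  qed
  then show False using assms by simp
qed

section \<open>The tree rooted at 0 and the orientation of strands\<close>

text \<open>Acyclicity is expressed as every edge being a bridge, a form that can be followed while
  strands are inserted one by one.\<close>

locale noncrossing_tree =
  fixes D :: "(nat \<times> nat) set" and n :: nat
  assumes noncross: "noncrossing D"
    and bounded: "(a, b) \<in> D \<Longrightarrow> b \<le> n"
    and connected: "u \<le> n \<Longrightarrow> conn D 0 u"
    and bridge: "(a, b) \<in> D \<Longrightarrow> \<not> conn (D - {(a, b)}) a b"
begin

lemma less: "(a, b) \<in> D \<Longrightarrow> a < b"
  using noncross by (rule noncrossing_less)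

definition parent :: "nat \<Rightarrow> nat \<Rightarrow> bool" where
  "parent u v \<longleftrightarrow> adjacent D u v \<and> conn (avoid v D) 0 u"

lemma adjacent_bridge:
  assumes "adjacent D u v" "conn (avoid u D) x v" "conn (avoid v D) x u"
  shows False
proof -
  obtain a b where ab: "(a, b) \<in> D" "(a = u \<and> b = v) \<or> (a = v \<and> b = u)"
    using assms(1) by (auto simp: adjacent_def)
  have "conn (D - {(a, b)}) x a" "conn (D - {(a, b)}) x b"
    using ab(2) assms(2,3) conn_mono[OF avoid_subset_remove(1)] conn_mono[OF avoid_subset_remove(2)]
    by blast+
  then show False using bridge[OF ab(1)] conn_sym conn_trans by blast
qed

lemma parent_asym: "parent u v \<Longrightarrow> \<not> parent v u"
  unfolding parent_def using adjacent_bridge by blast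

lemma parent_total:
  assumes "adjacent D u v"
  shows "parent u v \<or> parent v u"
proof -
  have uv: "u \<le> n" "u \<noteq> v" using assms less bounded by (force simp: adjacent_def)+
  obtain xs where xs: "simple_path D 0 xs u" using conn_simple_path connected[OF uv(1)] by blast
  show ?thesis
  proof (cases "v \<in> set xs")
    case False
    then have "parent u v" using path_conn_avoid[of D xs v] xs assms
      by (auto simp: simple_path_def parent_def)
    then show ?thesis ..
  next
    case True
    then have "conn (avoid u D) 0 v" using path_conn_avoid_prefix[OF xs] uv by simp
    then show ?thesis using assms by (auto simp: parent_def adjacent_def)
  qed
qed

text \<open>Two parents of \<open>v\<close> are connected by a walk missing \<open>v\<close>, so
  with their edges to \<open>v\<close> they would close a cycle.\<close>

lemma parent_unique:
  assumes "parent u v" "parent u' v"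
  shows "u = u'"
proof (rule ccontr)
  assume ne: "u \<noteq> u'"
  obtain a b where ab: "(a, b) \<in> D" "(a = u \<and> b = v) \<or> (a = v \<and> b = u)"
    using assms(1) by (auto simp: adjacent_def parent_def)
  have "conn (avoid v D) u u'" using assms conn_sym conn_trans unfolding parent_def by blast
  then have "conn (D - {(a, b)}) u u'"
    using ab(2) conn_mono[OF avoid_subset_remove(1)] conn_mono[OF avoid_subset_remove(2)] by blast
  moreover have "adjacent (D - {(a, b)}) u' v"
    using assms(2) ab ne by (auto simp: parent_def adjacent_def)
  ultimately have "conn (D - {(a, b)}) u v" using conn_step by blast
  then show False using bridge[OF ab(1)] ab(2) conn_sym by blast
qed

text \<open>A simple path ending in \<open>j\<close> that contains \<open>i\<close> reaches
  \<open>i\<close> without \<open>j\<close>; conversely the edge extends a path to \<open>i\<close>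
  that misses \<open>j\<close>. Orientation thus becomes a relation between the two ends.\<close>

lemma oriented_right_iff_parent:
  assumes "(i, j) \<in> D"
  shows "oriented_right D i j \<longleftrightarrow> parent i j"
proof
  assume "oriented_right D i j"
  then obtain xs where xs: "simple_path D 0 xs j" "i \<in> set xs" by (auto simp: oriented_right_def)
  then have "conn (avoid j D) 0 i" using path_conn_avoid_prefix[OF xs] less[OF assms] by simp
  then show "parent i j" using assms by (auto simp: parent_def adjacent_def)
next
  assume p: "parent i j"
  then obtain xs where xs: "simple_path (avoid j D) 0 xs i" "\<forall>x\<in>set xs. conn (avoid j D) 0 x"
    using conn_simple_path unfolding parent_def by blast
  have "j \<notin> set xs" using xs(2) conn_avoidD less[OF assms] by fastforce
  moreover have "successively (\<lambda>x y. (x, y) \<in> D \<or> (y, x) \<in> D) xs"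
    using xs(1) unfolding simple_path_def
    by (auto elim!: successively_mono simp: avoid_def)
  ultimately have "simple_path D 0 (xs @ [j]) j"
    using xs(1) assms by (auto simp: simple_path_def successively_append_iff)
  moreover have "i \<in> set (xs @ [j])" using xs(1) by (auto simp: simple_path_def)
  ultimately show "oriented_right D i j" unfolding oriented_right_def by blast
qed

text \<open>The root is not strictly between \<open>i\<close> and \<open>j\<close>, so a walk from
  it to an inner vertex meets one of the two ends. If the walk misses \<open>u\<close>, it meets
  \<open>v\<close>.\<close>

lemma parent_reaches_inside:
  assumes "(i, j) \<in> D" "i < x" "x < j" "(u = i \<and> v = j) \<or> (u = j \<and> v = i)"
    and "conn (avoid u D) 0 x"
  shows "parent v u"
proof -
  have "conn (avoid u D) 0 v"
  proof (rule ccontr)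
    assume "\<not> conn (avoid u D) 0 v"
    then have "conn (avoid v (avoid u D)) 0 x" by (rule conn_avoidI[OF assms(5)])
    moreover have "avoid v (avoid u D) = avoid i (avoid j D)"
      using assms(4) by (auto simp: avoid_def)
    ultimately have "(i < 0 \<and> 0 < j) = (i < x \<and> x < j)"
      using chord_separates[OF noncross assms(1)] by metis
    then show False using assms by simp
  qed
  then show ?thesis using assms by (auto simp: parent_def adjacent_def)
qed

text \<open>Directions \<open>b\<close> and \<open>c\<close> attach at the end of \<open>X\<close>
  farther from the root; its only parent is the other end of \<open>X\<close>, so it is the parent
  in \<open>Y\<close>. Direction \<open>a\<close> attaches at the nearer end, which stays the parent
  since the new end lies inside \<open>X\<close>. Comparing which end of \<open>Y\<close> is the
  parent, left or right, only \<open>b\<close> changes the side.\<close>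

lemma child_edge_and_orientation:
  assumes "child D X l Y" "X \<in> D"
  shows "Y \<in> D \<and> (parent (fst Y) (snd Y) \<longleftrightarrow> parent (fst X) (snd X) = (l \<noteq> LB))"
  using assms
proof (cases rule: child.cases)
  case (right_a i j x)
  then have e: "(i, x) \<in> D" "i < x" "x < j" "(i, j) \<in> D" using assms by (auto simp: is_greatest_def)
  have p: "parent i j" using right_a e oriented_right_iff_parent by simp
  \<comment> \<open>Otherwise \<open>x\<close> is the parent of \<open>i\<close> and is reached
    without \<open>i\<close>; then \<open>j\<close> would be the parent of \<open>i\<close>
    too.\<close>
  have "parent i x"
    using parent_total[of i x] parent_reaches_inside[OF e(4,2,3), of i j] parent_asym[OF p] e(1)
    by (auto simp: parent_def adjacent_def)
  then show ?thesis using p e right_a by simp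
next
  case (right_b i j y)
  then have e: "(y, j) \<in> D" "i < y" "y < j" "(i, j) \<in> D" using assms by (auto simp: is_smallest_def)
  have p: "parent i j" using right_b e oriented_right_iff_parent by simp
  have "\<not> parent y j" using parent_unique[OF p, of y] e(2) by auto
  then show ?thesis using p e right_b by simp
next
  case (right_c i j z)
  then have e: "(j, z) \<in> D" "j < z" "(i, j) \<in> D" using assms by (auto simp: is_greatest_def)
  have p: "parent i j" using right_c e oriented_right_iff_parent by simp
  have "parent j z" using parent_unique[OF p, of z] parent_total[of j z] e less[OF e(3)]
    by (auto simp: adjacent_def)
  then show ?thesis using p e right_c by simp
next
  case (left_a i j x)
  then have e: "(x, j) \<in> D" "i < x" "x < j" "(i, j) \<in> D" using assms by (auto simp: is_smallest_def)
  have p: "\<not> parent i j" using left_a e oriented_right_iff_parent by simp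
  have "\<not> parent x j"
    using parent_reaches_inside[OF e(4,2,3), of j i] p by (auto simp: parent_def)
  then show ?thesis using p e left_a by simp
next
  case (left_b i j y)
  then have e: "(i, y) \<in> D" "i < y" "y < j" "(i, j) \<in> D" using assms by (auto simp: is_greatest_def)
  have p: "\<not> parent i j" using left_b e oriented_right_iff_parent by simp
  then have q: "parent j i" using parent_total[of i j] e by (auto simp: adjacent_def)
  have "parent i y" using parent_unique[OF q, of y] parent_total[of i y] e
    by (auto simp: adjacent_def)
  then show ?thesis using p e left_b by simp
next
  case (left_c i j z)
  then have e: "(z, i) \<in> D" "z < i" "(i, j) \<in> D" using assms by (auto simp: is_smallest_def)
  have p: "\<not> parent i j" using left_c e oriented_right_iff_parent by simp
  then have q: "parent j i" using parent_total[of i j] e by (auto simp: adjacent_def)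
  have "\<not> parent z i" using parent_unique[OF q, of z] e less[OF e(3)] by auto
  then show ?thesis using p e left_c by simp
qed

lemma tree_node_parity:
  assumes "tree_node D w X"
  shows "X \<in> D \<and> (parent (fst X) (snd X) \<longleftrightarrow> even (count_list w LB))"
  using assms
proof (induction rule: tree_node.induct)
  case (root k)
  then show ?case by (auto simp: is_greatest_def parent_def adjacent_def)
next
  case (step w X l Y)
  then show ?case using child_edge_and_orientation[OF step(2)] by auto
qed

end

section \<open>Strands in the order of an exceptional sequence\<close>

text \<open>\<open>separated\<close> is what the combinatorics retains of exceptionality: the module
  of \<open>(i, j)\<close> has a bijective transition map along every earlier strand
  \<open>(k, l)\<close>, so it is zero at both of \<open>k\<close>, \<open>l\<close> or at
  neither.\<close>

locale strand_sequence =
  fixes n :: nat and es :: "(nat \<times> nat) list"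
  assumes length: "length es = n"
    and strand: "p < n \<Longrightarrow> es ! p = (i, j) \<Longrightarrow> i < j \<and> j \<le> n"
    and separated: "q < p \<Longrightarrow> p < n \<Longrightarrow> es ! p = (i, j) \<Longrightarrow> es ! q = (k, l)
      \<Longrightarrow> (i < k \<and> k \<le> j) = (i < l \<and> l \<le> j)"
begin

abbreviation "Before p \<equiv> set (take p es)"

lemma in_Before: "p \<le> n \<Longrightarrow> e \<in> Before p \<longleftrightarrow> (\<exists>q<p. es ! q = e)"
  using length by (auto simp: in_set_conv_nth)

lemma Before_Suc: "p < n \<Longrightarrow> Before (Suc p) = insert (es ! p) (Before p)"
  using length by (auto simp: take_Suc_conv_app_nth)

lemma Before_n: "Before n = set es"
  using length by simp

lemma Before_subset: "p \<le> q \<Longrightarrow> Before p \<subseteq> Before q"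
  by (rule set_take_subset_set_take)

lemma conn_same_side:
  assumes "p < n" "es ! p = (i, j)" "conn (Before p) u v"
  shows "(i < u \<and> u \<le> j) = (i < v \<and> v \<le> j)"
  using assms(3)
proof (induction rule: conn_induct)
  case (step y z)
  then obtain q where "q < p" "es ! q = (y, z) \<or> es ! q = (z, y)"
    using in_Before assms(1) by (auto simp: adjacent_def)
  then show ?case using step(3) separated[OF _ assms(1,2)] by metis
qed simp

lemma not_conn_before:
  assumes "p < n" "es ! p = (i, j)"
  shows "\<not> conn (Before p) i j"
  using conn_same_side[OF assms, of i j] strand[OF assms] by auto

text \<open>In a crossing pair the support of the later strand contains exactly one end of the
  earlier one: \<open>c\<close> but not \<open>d\<close> if \<open>(a, b)\<close> is later,
  \<open>b\<close> but not \<open>a\<close> if \<open>(c, d)\<close> is later.\<close>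

lemma noncrossing_set: "noncrossing (set es)"
proof -
  have False if e: "(a, b) \<in> set es" "(c, d) \<in> set es" and l: "a < c" "c < b" "b < d" for a b c d
  proof -
    obtain p q where pq: "p < n" "q < n" "es ! p = (a, b)" "es ! q = (c, d)"
      using e length by (auto simp: in_set_conv_nth)
    then have "p \<noteq> q" using l by auto
    then consider "p < q" | "q < p" by linarith
    then show False
      by cases (use separated[of p q c d a b] separated[of q p a b c d] pq l in auto)
  qed
  moreover have "a < b" if "(a, b) \<in> set es" for a b
    using that strand length by (auto simp: in_set_conv_nth)
  ultimately show ?thesis unfolding noncrossing_def by blast
qed

text \<open>Labels stand for components. Each strand merges two labels, distinct by
  \<open>not_conn_before\<close>, so \<open>n\<close> strands on \<open>n + 1\<close> vertices leave
  a single label; this gives connectedness without quotients.\<close>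

lemma component_labels:
  assumes "p \<le> n"
  shows "\<exists>f :: nat \<Rightarrow> nat. (\<forall>u\<le>n. \<forall>v\<le>n. f u = f v \<longrightarrow> conn (Before p) u v) \<and> card (f ` {..n}) \<le> n + 1 - p"
  using assms
proof (induction p)
  case 0
  show ?case by (rule exI[of _ id]) simp
next
  case (Suc p)
  then obtain f :: "nat \<Rightarrow> nat" where
    f: "\<And>u v. u \<le> n \<Longrightarrow> v \<le> n \<Longrightarrow> f u = f v \<Longrightarrow> conn (Before p) u v" and
    card: "card (f ` {..n}) \<le> n + 1 - p" by (metis Suc_leD)
  obtain i j where e: "es ! p = (i, j)" by force
  have p: "p < n" using Suc by simp
  have ij: "i \<le> n" "j \<le> n" using strand[OF p e] by auto
  have ne: "f i \<noteq> f j" using not_conn_before[OF p e] f ij by blast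
  define g where "g v = (if f v = f i then f j else f v)" for v
  have sub: "Before p \<subseteq> Before (Suc p)" using Before_subset by simp
  have new: "conn (Before (Suc p)) i j" using Before_Suc[OF p] e by (auto intro: edge_conn)
  have old: "conn (Before (Suc p)) u v" if "u \<le> n" "v \<le> n" "f u = f v" for u v
    using f[OF that] conn_mono[OF sub] by blast
  have "conn (Before (Suc p)) u v" if "u \<le> n" "v \<le> n" "g u = g v" for u v
  proof -
    have "f u = f v \<or> f u = f i \<and> f v = f j \<or> f u = f j \<and> f v = f i"
      using that(3) unfolding g_def by presburger
    then consider "f u = f v" | "f u = f i" "f v = f j" | "f u = f j" "f v = f i" by blast
    then show ?thesis
    proof cases
      case 2
      then show ?thesis
        using conn_trans[OF old[of u i] conn_trans[OF new conn_sym[OF old[of v j]]]] that ij by simp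
    next
      case 3
      then show ?thesis
        using conn_trans[OF old[of u j] conn_trans[OF conn_sym[OF new] conn_sym[OF old[of v i]]]]
          that ij by simp
    qed (use that old in simp)
  qed
  moreover have "g ` {..n} \<subseteq> f ` {..n} - {f i}" using ne ij by (auto simp: g_def)
  then have "card (g ` {..n}) \<le> card (f ` {..n} - {f i})" by (intro card_mono) auto
  then have "card (g ` {..n}) \<le> n + 1 - Suc p" using card ij by (simp add: card_Diff_singleton_if)
  ultimately show ?case by blast
qed

lemma conn_all:
  assumes "u \<le> n" "v \<le> n"
  shows "conn (set es) u v"
proof -
  obtain f :: "nat \<Rightarrow> nat" where
    f: "\<forall>u\<le>n. \<forall>v\<le>n. f u = f v \<longrightarrow> conn (Before n) u v" and card: "card (f ` {..n}) \<le> n + 1 - n"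
    using component_labels[of n] by blast
  have "card (f ` {..n}) \<le> Suc 0" using card by simp
  then have "\<forall>x\<in>f ` {..n}. \<forall>y\<in>f ` {..n}. x = y"
    by (rule iffD1[OF card_le_Suc0_iff_eq, rotated]) simp
  then have "f u = f v" using assms by blast
  then show ?thesis using f assms Before_n by simp
qed

text \<open>If the new strand \<open>(c, d)\<close> opened a detour around an older strand
  \<open>(a, b)\<close>, then the rest of the detour together with \<open>(a, b)\<close> would have
  connected \<open>c\<close> and \<open>d\<close> before.\<close>

lemma bridge_before:
  assumes "p \<le> n" "(a, b) \<in> Before p"
  shows "\<not> conn (Before p - {(a, b)}) a b"
  using assms
proof (induction p)
  case (Suc p)
  then have p: "p < n" by simp
  obtain c d where e: "es ! p = (c, d)" by force
  note B = Before_Suc[OF p, unfolded e]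
  note nc = not_conn_before[OF p e]
  have notin: "(c, d) \<notin> Before p" using nc edge_conn by blast
  show ?case
  proof (cases "(a, b) = (c, d)")
    case True
    then show ?thesis using B nc notin by auto
  next
    case False
    then have ab: "(a, b) \<in> Before p" using Suc.prems B by auto
    have sub: "conn (Before p) x y" if "conn (Before p - {(a, b)}) x y" for x y
      using that conn_mono[of "Before p - {(a, b)}" "Before p"] by blast
    have "Before (Suc p) - {(a, b)} = insert (c, d) (Before p - {(a, b)})" using B False by auto
    moreover have "\<not> conn (insert (c, d) (Before p - {(a, b)})) a b"
    proof
      assume "conn (insert (c, d) (Before p - {(a, b)})) a b"
      from conn_insert[OF this] have "conn (Before p) c d"
        using Suc.IH ab p sub edge_conn[OF ab] conn_sym conn_trans by (meson less_imp_le)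
      then show False using nc by simp
    qed
    ultimately show ?thesis by simp
  qed
qed simp

sublocale noncrossing_tree "set es" n
proof
  show "b \<le> n" if "(a, b) \<in> set es" for a b
    using that strand length by (auto simp: in_set_conv_nth)
  show "\<not> conn (set es - {(a, b)}) a b" if "(a, b) \<in> set es" for a b
    using bridge_before[of n a b] that Before_n by simp
qed (use noncrossing_set conn_all in auto)

text \<open>For modules \<open>X\<close> in the perpendicular category of the first \<open>p\<close> objects, this forces
  \<open>X\<^sub>i \<rightarrow> X\<^sub>j\<close> to be injective: either \<open>X\<^sub>i = 0\<close>, or \<open>X\<^sub>i \<rightarrow> X\<^sub>j \<rightarrow> X\<^sub>z\<close> is bijective.\<close>

definition escapes :: "nat \<Rightarrow> bool" where
  "escapes p \<longleftrightarrow> (case es ! p of (i, j) \<Rightarrow> conn (Before p) i 0 \<or> (\<exists>z>j. z \<le> n \<and> conn (Before p) i z))"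

lemma conn_bounded:
  assumes "u \<le> n" "conn (set es) u v"
  shows "v \<le> n"
  using assms(2)
proof (induction rule: conn_induct)
  case (step y z)
  then show ?case using less bounded by (fastforce simp: adjacent_def)
qed (use assms in simp)

text \<open>A component leaving \<open>{m..j}\<close> has no vertex there to the right of
  \<open>i\<close>, by \<open>conn_same_side\<close>, and is not the component of \<open>i\<close>.
  So it contains some \<open>u\<close> with \<open>m < u < i\<close> and would cross the component
  that joins \<open>m\<close> and \<open>i\<close>.\<close>

lemma trapped_component:
  assumes p: "p < n" "es ! p = (i, j)" and ne: "\<not> escapes p"
  obtains m where "0 < m" "m \<le> i" "conn (Before p) i m"
    "\<And>a b. (a, b) \<in> Before p \<Longrightarrow> (m \<le> a \<and> a \<le> j) = (m \<le> b \<and> b \<le> j)"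
proof -
  have ij: "i < j" "j \<le> n" using strand[OF p] by auto
  have sub: "Before p \<subseteq> set es" using set_take_subset by metis
  have nc: "noncrossing (Before p)" using noncrossing_mono[OF noncross sub] .
  define m where "m = (LEAST m. conn (Before p) i m)"
  have m: "conn (Before p) i m" unfolding m_def by (rule LeastI[of _ i]) simp
  have least: "m \<le> x" if "conn (Before p) i x" for x unfolding m_def using that by (rule Least_le)
  have ub: "x \<le> j" if "conn (Before p) i x" for x
  proof (rule ccontr)
    assume "\<not> x \<le> j"
    moreover have "x \<le> n" using conn_bounded[of i x] conn_mono[OF sub that] ij by simp
    ultimately show False using ne that p(2) by (auto simp: escapes_def)
  qed
  have "0 < m"
  proof (rule ccontr)
    assume "\<not> 0 < m"
    then show False using m ne p(2) by (simp add: escapes_def)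
  qed
  moreover have mi: "m \<le> i" using least by simp
  moreover have "(m \<le> a \<and> a \<le> j) = (m \<le> b \<and> b \<le> j)" if e: "(a, b) \<in> Before p" for a b
  proof -
    have *: False if uv: "conn (Before p) u v" and u: "m \<le> u" "u \<le> j" and v: "v < m \<or> j < v" for u v
    proof -
      have "(i < u \<and> u \<le> j) = (i < v \<and> v \<le> j)" by (rule conn_same_side[OF p uv])
      then have ui: "u \<le> i" using u v mi by auto
      have niu: "\<not> conn (Before p) i u"
      proof
        assume "conn (Before p) i u"
        then have "conn (Before p) i v" using uv conn_trans by blast
        then show False using least ub v by fastforce
      qed
      have "m \<noteq> u" "u \<noteq> i" using niu m by auto
      then have ui: "m < u" "u < i" using u ui by auto
      have mi': "conn (Before p) m i" using m by (rule conn_sym)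
      show False using v
      proof
        assume "v < m"
        then have "conn (Before p) v m"
          using noncrossing_components[OF nc conn_sym[OF uv] mi'] ui by simp
        then show False using niu uv m conn_sym conn_trans by blast
      next
        assume "j < v"
        then have "conn (Before p) m u"
          using noncrossing_components[OF nc mi' uv] ui ij by simp
        then show False using niu m conn_trans by blast
      qed
    qed
    show ?thesis using *[OF edge_conn[OF e]] *[OF conn_sym[OF edge_conn[OF e]]] by (meson not_less)
  qed
  ultimately show ?thesis using that m by blast
qed

text \<open>\<open>escapes\<close> looks only at the strands before \<open>p\<close>,
  \<open>parent\<close> at the whole tree. Noncrossingness closes this gap in one direction; in the
  other, no strand, earlier or later, leads out of \<open>{m..<j}\<close> except through
  \<open>j\<close>.\<close>

theorem escapes_iff_parent:
  assumes p: "p < n" "es ! p = (i, j)"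
  shows "escapes p \<longleftrightarrow> parent i j"
proof -
  have ij: "i < j" "j \<le> n" using strand[OF p] by auto
  have ije: "(i, j) \<in> set es" using p length nth_mem by metis
  have sub: "Before p \<subseteq> set es" using set_take_subset by metis
  have subr: "Before p \<subseteq> set es - {(i, j)}" using sub not_conn_before[OF p] edge_conn by blast
  show ?thesis
  proof
    assume esc: "escapes p"
    show "parent i j"
    proof (rule ccontr)
      assume "\<not> parent i j"
      then have "parent j i" using parent_total[of i j] ije by (auto simp: adjacent_def)
      then have av: "conn (avoid i (set es)) 0 j" by (simp add: parent_def)
      have j0: "conn (set es - {(i, j)}) 0 j" by (rule conn_mono[OF avoid_subset_remove(1) av])
      have i0: "i \<noteq> 0"
      proof
        assume "i = 0"
        then show False using conn_avoidD[of i "set es" j] conn_sym[OF av] ij by simp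
      qed
      have no: "\<not> conn (set es - {(i, j)}) 0 i" using bridge[OF ije] j0 conn_sym conn_trans by blast
      have "\<not> conn (Before p) i 0" using no conn_mono[OF subr] conn_sym by blast
      then obtain z where z: "z > j" "conn (Before p) i z"
        using esc p by (auto simp: escapes_def)
      \<comment> \<open>Without the strand \<open>(i, j)\<close> there are still connections from
        \<open>0\<close> to \<open>j\<close> and from \<open>i\<close> to \<open>z\<close>, where
        \<open>0 < i < j < z\<close>; they would have to meet and connect \<open>0\<close> with
        \<open>i\<close>.\<close>
      have "noncrossing (set es - {(i, j)})" using noncrossing_mono[OF noncross] by blast
      from noncrossing_components[OF this j0 conn_mono[OF subr z(2)]] show False
        using no i0 ij z by simp
    qed
  next
    assume par: "parent i j"
    show "escapes p"
    proof (rule ccontr)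
      assume ne: "\<not> escapes p"
      obtain m where m: "0 < m" "m \<le> i" "conn (Before p) i m"
        "\<And>a b. (a, b) \<in> Before p \<Longrightarrow> (m \<le> a \<and> a \<le> j) = (m \<le> b \<and> b \<le> j)"
        using trapped_component[OF p ne] by blast
      have "conn (Before (Suc p)) i j" using Before_Suc[OF p(1)] p(2) by (auto intro: edge_conn)
      moreover have "conn (Before (Suc p)) i m"
        using m(3) conn_mono[OF Before_subset[of p "Suc p"]] by simp
      ultimately have mj: "conn (Before (Suc p)) m j" using conn_sym conn_trans by blast
      have leave: "(m \<le> a \<and> a < j) = (m \<le> b \<and> b < j)"
        if e: "(a, b) \<in> set es" and aj: "a \<noteq> j" "b \<noteq> j" for a b
      proof -
        obtain r where r: "r < n" "es ! r = (a, b)" using e length by (auto simp: in_set_conv_nth)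
        consider "r < p" | "r = p" | "p < r" by linarith
        then show ?thesis
        proof cases
          case 1
          then have "(a, b) \<in> Before p" using r p in_Before by auto
          then show ?thesis using m(4) aj by fastforce
        next
          case 2
          then show ?thesis using r p aj by simp
        next
          case 3
          \<comment> \<open>Before a strand \<open>(a, b)\<close> later than \<open>p\<close>, the
            vertices \<open>m\<close> and \<open>j\<close> are already connected, so its support
            contains both or neither. A strand that misses \<open>j\<close> and has exactly one end
            in \<open>{m..<j}\<close> would contain exactly one of them.\<close>
          then have "conn (Before r) m j" using mj conn_mono[OF Before_subset[of "Suc p" r]] by simp
          from conn_same_side[OF r this] less[OF e] aj show ?thesis by auto
        qed
      qed
      have "conn (avoid j (set es)) 0 i" using par by (simp add: parent_def)
      \<comment> \<open>The walk starts outside because \<open>m\<close> is positive, and without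
        \<open>j\<close> it cannot enter.\<close>
      then have "\<not> (m \<le> i \<and> i < j)"
      proof (induction rule: conn_induct)
        case (step y z)
        then show ?case using leave[of y z] leave[of z y] by (auto simp: adjacent_def avoid_def)
      qed (use m in simp)
      then show False using m ij by simp
    qed
  qed
qed

end

section \<open>Relative injectivity\<close>

text \<open>Bijectivity spreads from the edges of \<open>B\<close> to whole components by two out of
  three.\<close>

lemma conn_bij_tmap:
  assumes W: "W \<in> iso_along n B" and B: "\<forall>(k, l)\<in>B. k < l \<and> l \<le> n"
    and ab: "conn B a b" "a \<le> n"
  shows "b \<le> n \<and> bij_mat (tmap W (min a b) (max a b))"
  using ab(1)
proof (induction rule: conn_induct)
  case refl
  then show ?case using ab(2) by (simp add: bij_mat_one)
next
  case (step y z)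
  have "bij_mat (tmap W (min y z) (max y z)) \<and> z \<le> n"
    using step(2) W B by (fastforce simp: adjacent_def iso_along_def min_def max_def)
  then show ?case using step(3) bij_tmap_trans[of n W a y z] W ab(2) by (auto simp: iso_along_def)
qed

locale strand_rep_sequence = strand_sequence n es for n es +
  fixes Es :: "'k::field quiver_rep list"
  assumes exceptional: "exceptional_sequence n Es"
    and strand_iso: "p < n \<Longrightarrow> es ! p = (i, j) \<Longrightarrow> rep_iso n (Es ! p) (interval_rep i j)"
begin

lemma rep: "p < n \<Longrightarrow> is_rep n (Es ! p)"
  using exceptional by (auto simp: exceptional_sequence_def indecomposable_rep_def)

lemma Before_strands:
  assumes "p \<le> n"
  shows "\<forall>(k, l)\<in>Before p. k < l \<and> l \<le> n"
proof (rule ballI, rule case_prodI2)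
  fix e k l assume "e \<in> Before p" "e = (k, l)"
  then obtain q where "q < p" "es ! q = (k, l)" using in_Before[OF assms] by blast
  then show "k < l \<and> l \<le> n" using strand assms by (meson less_le_trans)
qed

lemma left_perp_eq_iso_along:
  assumes "p \<le> n"
  shows "left_perp n (direct_sum_list (take p Es)) = iso_along n (Before p)"
proof -
  have len: "length Es = n" using exceptional by (simp add: exceptional_sequence_def)
  have set_take: "set (take p Es) = (!) Es ` {..<p}"
    using nth_image[of p Es] assms len by (simp add: atLeast0LessThan)
  have Before_image: "Before p = (!) es ` {..<p}"
    using nth_image[of p es] assms length by (simp add: atLeast0LessThan)
  have reps: "\<forall>V\<in>set (take p Es). is_rep n V" using rep assms by (simp add: set_take)
  have "perp n W (Es ! q) \<longleftrightarrow> (case es ! q of (k, l) \<Rightarrow> bij_mat (tmap W k l))"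
    if W: "is_rep n W" and q: "q < n" for W q
  proof -
    obtain k l where e: "es ! q = (k, l)" by force
    have "perp n W (Es ! q) \<longleftrightarrow> perp n W (interval_rep k l)"
      by (rule perp_iso[OF W W rep[OF q] is_rep_interval rep_iso_refl[OF W] strand_iso[OF q e]])
    then show ?thesis using perp_interval[OF W] strand[OF q e] e by simp
  qed
  note perp_iff = this
  have ball_nth: "(\<forall>q<p. Q (xs ! q)) \<longleftrightarrow> (\<forall>e\<in>(!) xs ` {..<p}. Q e)" for Q and xs :: "(nat \<times> nat) list"
    by auto
  have "(\<forall>V\<in>set (take p Es). perp n W V) \<longleftrightarrow> (\<forall>e\<in>Before p. case e of (k, l) \<Rightarrow> bij_mat (tmap W k l))"
    if W: "is_rep n W" for W
  proof -
    have "(\<forall>V\<in>set (take p Es). perp n W V) \<longleftrightarrow> (\<forall>q<p. perp n W (Es ! q))"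
      by (auto simp: set_take)
    also have "\<dots> \<longleftrightarrow> (\<forall>q<p. case es ! q of (k, l) \<Rightarrow> bij_mat (tmap W k l))"
      by (intro all_cong perp_iff[OF W less_le_trans[OF _ assms]])
    also have "\<dots> \<longleftrightarrow> (\<forall>e\<in>Before p. case e of (k, l) \<Rightarrow> bij_mat (tmap W k l))"
      unfolding Before_image by (rule ball_nth[of "\<lambda>(k, l). bij_mat (tmap W k l)" es])
    finally show ?thesis .
  qed
  then show ?thesis using left_perp_iff[OF reps] unfolding iso_along_def by blast
qed

lemma object_in_iso_along:
  assumes "p < n"
  shows "Es ! p \<in> iso_along n (Before p)"
proof -
  have len: "length Es = n" using exceptional by (simp add: exceptional_sequence_def)
  have reps: "\<forall>V\<in>set (take p Es). is_rep n V" using rep assms len by (auto simp: in_set_conv_nth)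
  have "perp n (Es ! p) V" if V: "V \<in> set (take p Es)" for V
  proof -
    obtain q where "q < p" "V = Es ! q" using V assms len by (auto simp: in_set_conv_nth)
    then show ?thesis
      using exceptional assms rep[OF assms] reps V hom_vanishes_iff[of n "Es ! p" V]
        ext1_vanishes_iff[of n "Es ! p" V]
      by (auto simp: perp_def exceptional_sequence_def)
  qed
  then have "Es ! p \<in> left_perp n (direct_sum_list (take p Es))"
    unfolding left_perp_iff[OF reps] using rep assms by blast
  then show ?thesis using left_perp_eq_iso_along assms by simp
qed

lemma escapes_relatively_injective:
  assumes p: "p < n" and esc: "escapes p"
  shows "relatively_injective n Es p"
proof -
  obtain i j where e: "es ! p = (i, j)" by force
  have ij: "i < j" "j \<le> n" using strand[OF p e] by auto
  have B: "\<forall>(k, l)\<in>Before p. k < l \<and> l \<le> n" by (rule Before_strands[OF less_imp_le[OF p]])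
  let ?M = "interval_rep i j :: 'k quiver_rep"
  note M = is_rep_interval[of n i j, where 'a = 'k]
  note E = rep[OF p]
  obtain \<alpha> \<beta> where ab: "hom_fam n (Es ! p) ?M \<alpha>" "hom_fam n ?M (Es ! p) \<beta>"
    "\<And>x. x \<le> n \<Longrightarrow> \<beta> x * \<alpha> x = 1\<^sub>m (sdim (Es ! p) x)" "\<And>x. x \<le> n \<Longrightarrow> \<alpha> x * \<beta> x = 1\<^sub>m (sdim ?M x)"
    by (rule rep_isoE[OF E M strand_iso[OF p e]], rule that)
  have "injective_in n (iso_along n (Before p)) (Es ! p)"
    unfolding injective_in_def
  proof (intro conjI ballI allI impI)
    show "Es ! p \<in> iso_along n (Before p)" by (rule object_in_iso_along[OF p])
    fix X Y f g
    assume XC: "X \<in> iso_along n (Before p)" and YC: "Y \<in> iso_along n (Before p)"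
      and fg: "mono_in n (iso_along n (Before p)) X Y f \<and> morphism n X (Es ! p) g"
    have X: "is_rep n X" and Y: "is_rep n Y" using XC YC by (auto simp: iso_along_def)
    define F where "F = f(0 := 0\<^sub>m 0 0)"
    define G where "G = g(0 := 0\<^sub>m 0 0)"
    have F: "hom_fam n X Y F" unfolding F_def
      by (rule morphism_hom_fam[OF X Y]) (use fg in \<open>simp add: mono_in_def\<close>)
    have G: "hom_fam n X (Es ! p) G" unfolding G_def by (rule morphism_hom_fam[OF X E]) (use fg in simp)
    have inj: "linv (F j)" unfolding F_def using mono_in_linv[OF B XC YC _ ij(2)] fg by blast
    note aG = hom_fam_comp[OF X E M G ab(1)]
    have "sdim Y i = 0 \<or> (\<exists>z>j. z \<le> n \<and> bij_mat (tmap X i z) \<and> bij_mat (tmap Y i z))"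
    proof (cases "conn (Before p) i 0")
      case True
      \<comment> \<open>The source of this bijection is the adjoined zero space, so the space at
        \<open>i\<close> is zero as well.\<close>
      then have "bij_mat (tmap Y 0 i)" using conn_bij_tmap[OF YC B, of i 0] ij by simp
      then have "sdim Y i = 0" using bij_mat_zero_dims tmap_dims[OF Y, of 0 i] ij by fastforce
      then show ?thesis ..
    next
      case False
      then obtain z where z: "z > j" "z \<le> n" "conn (Before p) i z" using esc e by (auto simp: escapes_def)
      then have "bij_mat (tmap X i z)" "bij_mat (tmap Y i z)"
        using conn_bij_tmap[OF XC B z(3)] conn_bij_tmap[OF YC B z(3)] ij by (simp_all add: min_def max_def)
      then show ?thesis using z by blast
    qed
    from extend_to_interval[OF X Y F inj ij aG this] obtain h where
      h: "hom_fam n Y ?M h" "\<forall>x\<le>n. h x * F x = \<alpha> x * G x" by blast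
    show "\<exists>h. morphism n Y (Es ! p) h \<and> mor_eq n (mor_comp h f) g"
    proof (intro exI[of _ "\<lambda>x. \<beta> x * h x"] conjI)
      show "morphism n Y (Es ! p) (\<lambda>x. \<beta> x * h x)"
        by (rule hom_fam_morphism[OF hom_fam_comp[OF Y M E h(1) ab(2)]])
      show "mor_eq n (mor_comp (\<lambda>x. \<beta> x * h x) f) g"
        unfolding mor_eq_def
      proof
        fix x assume "x \<in> {1..n}"
        then have x: "x \<le> n" "x \<noteq> 0" by auto
        note d = hom_fam_dims[OF ab(1) x(1)] hom_fam_dims[OF ab(2) x(1)] hom_fam_dims[OF h(1) x(1)]
          hom_fam_dims[OF F x(1)] hom_fam_dims[OF G x(1)]
        have "\<beta> x * h x * F x = \<beta> x * (\<alpha> x * G x)"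
          using d h(2) x by (subst mult_assoc_dim) simp_all
        also have "\<dots> = (\<beta> x * \<alpha> x) * G x" using d by (subst mult_assoc_dim) simp_all
        also have "\<dots> = G x" using d ab(3)[OF x(1)] by simp
        finally show "mor_comp (\<lambda>x. \<beta> x * h x) f x = g x"
          using x by (simp add: mor_comp_def F_def G_def)
      qed
    qed
  qed
  then show ?thesis using left_perp_eq_iso_along p by (simp add: relatively_injective_def)
qed

text \<open>If \<open>p\<close> does not escape, the inclusion of \<open>M\<^sub>i\<^sub>,\<^sub>j\<close> into the interval module with support
  \<open>{m..j}\<close>, where \<open>m\<close> is the least vertex connected with \<open>i\<close>, does not split.\<close>

lemma not_escapes_not_relatively_injective:
  assumes p: "p < n" and nesc: "\<not> escapes p"
  shows "\<not> relatively_injective n Es p"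
proof
  assume "relatively_injective n Es p"
  then have inj: "injective_in n (iso_along n (Before p)) (Es ! p)"
    using left_perp_eq_iso_along p by (simp add: relatively_injective_def)
  obtain i j where e: "es ! p = (i, j)" by force
  have ij: "i < j" "j \<le> n" using strand[OF p e] by auto
  have B: "\<forall>(k, l)\<in>Before p. k < l \<and> l \<le> n" by (rule Before_strands[OF less_imp_le[OF p]])
  obtain m where m: "0 < m" "m \<le> i" "conn (Before p) i m"
    "\<And>a b. (a, b) \<in> Before p \<Longrightarrow> (m \<le> a \<and> a \<le> j) = (m \<le> b \<and> b \<le> j)"
    by (rule trapped_component[OF p e nesc], rule that)
  \<comment> \<open>\<open>interval_rep k j\<close> has support \<open>{m..j}\<close>. The shift is
    legitimate because \<open>m\<close> is positive, and \<open>m \<le> i\<close> makes this support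
    strictly larger than that of \<open>interval_rep i j\<close>.\<close>
  define k where "k = m - 1"
  have mk: "m = Suc k" using m by (simp add: k_def)
  have ki: "k < i" using m mk by simp
  let ?M = "interval_rep i j :: 'k quiver_rep" and ?Y = "interval_rep k j :: 'k quiver_rep"
  note M = is_rep_interval[of n i j, where 'a = 'k] and Y = is_rep_interval[of n k j, where 'a = 'k]
  note E = rep[OF p]
  have YC: "?Y \<in> iso_along n (Before p)"
    unfolding iso_along_def
  proof (intro CollectI conjI ballI Y, clarify)
    fix a b assume ab: "(a, b) \<in> Before p"
    then have l: "a < b" "b \<le> n" using B by auto
    \<comment> \<open>An earlier strand has both ends in \<open>{m..j}\<close> or neither, so the
      transition map along it is an identity matrix of size 1 or 0.\<close>
    show "bij_mat (tmap ?Y a b)"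
    proof (cases "k < a \<and> a \<le> j")
      case True
      then have "k < b \<and> b \<le> j" using m(4)[OF ab] mk by auto
      then show ?thesis using True l by (simp add: tmap_interval bij_mat_one)
    next
      case False
      then have "\<not> (k < b \<and> b \<le> j)" using m(4)[OF ab] mk by auto
      then have "tmap ?Y a b = 1\<^sub>m 0"
        using False tmap_carrier[OF Y, of a b] l by (intro zero_mat_eq[of _ 0 0]) (auto simp: sdim_interval)
      then show ?thesis by (simp add: bij_mat_one)
    qed
  qed
  obtain \<alpha> \<beta> where ab: "hom_fam n (Es ! p) ?M \<alpha>" "hom_fam n ?M (Es ! p) \<beta>"
    "\<And>x. x \<le> n \<Longrightarrow> \<beta> x * \<alpha> x = 1\<^sub>m (sdim (Es ! p) x)" "\<And>x. x \<le> n \<Longrightarrow> \<alpha> x * \<beta> x = 1\<^sub>m (sdim ?M x)"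
    by (rule rep_isoE[OF E M strand_iso[OF p e]], rule that)
  define \<iota> where "\<iota> x = (if i < x \<and> x \<le> j then 1\<^sub>m 1 else 0\<^sub>m (sdim ?Y x) 0 :: 'k mat)" for x
  have \<iota>: "hom_fam n ?M ?Y \<iota>"
    unfolding hom_fam_def
  proof (intro conjI allI impI)
    show ic: "\<iota> x \<in> carrier_mat (sdim ?Y x) (sdim ?M x)" for x
      using ki by (auto simp: \<iota>_def sdim_interval)
    fix x assume x: "x < n"
    note d = carrier_matD[OF ic, of x] carrier_matD[OF ic, of "Suc x"] sact_dims[OF M x] sact_dims[OF Y x]
    consider "i < x" "x < j" | "x = j" | "x \<le> i \<or> j < x" by linarith
    then show "\<iota> (Suc x) * sact ?M x = sact ?Y x * \<iota> x"
    proof cases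
      case 1
      then show ?thesis using ki by (simp add: \<iota>_def sact_interval)
    next
      case 2
      then show ?thesis
        by (intro zero_mat_eq[of _ 0 "sdim ?M x"]) (use d in \<open>auto simp: sdim_interval intro!: carrier_matI\<close>)
    next
      case 3
      then show ?thesis
        by (intro zero_mat_eq[of _ "sdim ?Y (Suc x)" 0]) (use d in \<open>auto simp: sdim_interval intro!: carrier_matI\<close>)
    qed
  qed
  have \<iota>_inj: "linv (\<iota> x)" if "x \<le> n" for x
  proof (cases "i < x \<and> x \<le> j")
    case True
    then show ?thesis using bij_mat_one[of 1, where 'a = 'k] by (auto simp: \<iota>_def bij_mat_iff)
  next
    case False
    then have "0\<^sub>m 0 (sdim ?Y x) * \<iota> x = 1\<^sub>m 0" by (auto simp: \<iota>_def intro!: eq_matI)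
    then show ?thesis using False unfolding linv_def by (intro bexI[of _ "0\<^sub>m 0 (sdim ?Y x)"]) (auto simp: \<iota>_def)
  qed
  define f where "f x = \<iota> x * \<alpha> x" for x
  have f: "hom_fam n (Es ! p) ?Y f" unfolding f_def by (rule hom_fam_comp[OF E M Y ab(1) \<iota>])
  have "mono_in n (iso_along n (Before p)) (Es ! p) ?Y f"
    unfolding mono_in_def
  proof (intro conjI ballI allI impI)
    show "morphism n (Es ! p) ?Y f" by (rule hom_fam_morphism[OF f])
    fix Z u v assume uv: "morphism n Z (Es ! p) u \<and> morphism n Z (Es ! p) v \<and> mor_eq n (mor_comp f u) (mor_comp f v)"
    show "mor_eq n u v"
      unfolding mor_eq_def
    proof
      fix x assume x1: "x \<in> {1..n}"
      then have x: "x \<le> n" by simp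
      note d = hom_fam_dims[OF ab(1) x] hom_fam_dims[OF ab(2) x] hom_fam_dims[OF \<iota> x]
      have du: "dim_row (u x) = sdim (Es ! p) x" "dim_row (v x) = sdim (Es ! p) x"
        using uv x1 by (auto simp: morphism_def sdim_def)
      have "f x * u x = f x * v x" using uv x1 unfolding mor_eq_def mor_comp_def by blast
      then have "\<iota> x * (\<alpha> x * u x) = \<iota> x * (\<alpha> x * v x)"
        using d du by (simp add: f_def mult_assoc_dim)
      then have "\<alpha> x * u x = \<alpha> x * v x" by (rule linv_cancel[OF \<iota>_inj[OF x]]) (use d in auto)
      then have "\<beta> x * (\<alpha> x * u x) = \<beta> x * (\<alpha> x * v x)" by simp
      then show "u x = v x" using d du ab(3)[OF x] by (simp flip: mult_assoc_dim)
    qed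
  qed
  moreover have "morphism n (Es ! p) (Es ! p) (\<lambda>x. 1\<^sub>m (sdim (Es ! p) x))"
    by (rule hom_fam_morphism[OF hom_fam_one[OF E]])
  ultimately obtain h where h: "morphism n ?Y (Es ! p) h" "mor_eq n (mor_comp h f) (\<lambda>x. 1\<^sub>m (sdim (Es ! p) x))"
    using inj YC unfolding injective_in_def by blast
  define H where "H = h(0 := 0\<^sub>m 0 0)"
  have H: "hom_fam n ?Y (Es ! p) H" unfolding H_def by (rule morphism_hom_fam[OF Y E h(1)])
  define g where "g x = \<alpha> x * H x" for x
  have g: "hom_fam n ?Y ?M g" unfolding g_def by (rule hom_fam_comp[OF Y E M H ab(1)])
  \<comment> \<open>The contradiction sits on the arrow from \<open>i\<close> to
    \<open>Suc i\<close>: it is the identity in the larger module, but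
    \<open>interval_rep i j\<close> is zero at \<open>i\<close>, while the retraction
    \<open>g\<close> is the identity at \<open>Suc i\<close>.\<close>
  let ?x = "Suc i"
  have x: "?x \<le> n" "i < n" using ij by auto
  have kx: "k < ?x" "?x \<le> j" using ki ij by auto
  note d = hom_fam_dims[OF ab(1) x(1)] hom_fam_dims[OF ab(2) x(1)] hom_fam_dims[OF \<iota> x(1)] hom_fam_dims[OF H x(1)] hom_fam_dims[OF g x(1)]
  have "H ?x * (\<iota> ?x * \<alpha> ?x) = 1\<^sub>m (sdim (Es ! p) ?x)"
    using h(2) x by (simp add: mor_eq_def mor_comp_def f_def H_def)
  then have "\<alpha> ?x * (H ?x * (\<iota> ?x * \<alpha> ?x)) * \<beta> ?x = 1\<^sub>m (sdim ?M ?x)"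
    using d ab(4)[OF x(1)] by simp
  moreover have "\<alpha> ?x * (H ?x * (\<iota> ?x * \<alpha> ?x)) * \<beta> ?x = g ?x * (\<iota> ?x * (\<alpha> ?x * \<beta> ?x))"
    using d unfolding g_def by (simp add: mult_assoc_dim)
  ultimately have "g ?x * \<iota> ?x = 1\<^sub>m (sdim ?M ?x)" using d by (simp add: ab(4)[OF x(1)])
  then have g1: "g ?x = 1\<^sub>m 1" using d kx by (simp add: \<iota>_def sdim_interval)
  have "g ?x * sact ?Y i = sact ?M i * g i" by (rule hom_fam_commute[OF g x(2)])
  moreover have "sact ?Y i = 1\<^sub>m 1" using ki kx by (simp add: sact_interval)
  moreover have "sact ?M i * g i = 0\<^sub>m 1 1"
    using hom_fam_dims[OF g, of i] x ki kx by (simp add: sact_interval sdim_interval zero_mult_dim)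
  ultimately have "(1\<^sub>m 1 :: 'k mat) = 0\<^sub>m 1 1" using g1 by simp
  then have "(1\<^sub>m 1 :: 'k mat) $$ (0, 0) = 0\<^sub>m 1 1 $$ (0, 0)" by (rule arg_cong)
  then show False by simp
qed

end

section \<open>From exceptional sequences to strands, and the equivalence\<close>

lemma exceptional_strand_sequence:
  fixes Es :: "'k::field quiver_rep list"
  assumes exc: "exceptional_sequence n Es"
  obtains es where "strand_rep_sequence n es Es" "set es = strand_diagram n (set Es)"
proof -
  have len: "length Es = n" and ind: "\<And>p. p < n \<Longrightarrow> indecomposable_rep n (Es ! p)"
    using exc by (auto simp: exceptional_sequence_def)
  have rep: "is_rep n (Es ! p)" if "p < n" for p using ind[OF that] by (simp add: indecomposable_rep_def)
  define R where "R p e \<longleftrightarrow> fst e < snd e \<and> snd e \<le> n \<and> rep_iso n (Es ! p) (interval_rep (fst e) (snd e))" for p e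
  have "\<exists>e. R p e" if "p < n" for p
    using indecomposable_interval[OF ind[OF that]] by (auto simp: R_def)
  then obtain st where st: "\<And>p. p < n \<Longrightarrow> R p (st p)" by metis
  define es where "es = map st [0..<n]"
  have es: "es ! p = st p" if "p < n" for p using that by (simp add: es_def)
  have st': "i < j" "j \<le> n" "rep_iso n (Es ! p) (interval_rep i j)" if "p < n" "es ! p = (i, j)" for p i j
  proof -
    have "R p (i, j)" using st[OF that(1)] es[OF that(1)] that(2) by simp
    then show "i < j" "j \<le> n" "rep_iso n (Es ! p) (interval_rep i j)" by (simp_all add: R_def)
  qed
  have "strand_rep_sequence n es Es"
  proof
    show "length es = n" by (simp add: es_def)
    show "i < j \<and> j \<le> n" if "p < n" "es ! p = (i, j)" for p i j using st'[OF that] by simp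
    show "(i < k \<and> k \<le> j) = (i < l \<and> l \<le> j)"
      if q: "q < p" and p: "p < n" and e: "es ! p = (i, j)" "es ! q = (k, l)" for q p i j k l
    proof -
      have qn: "q < n" using q p by simp
      have kl: "k < l" "l \<le> n" using st'[OF qn e(2)] by auto
      let ?M = "interval_rep i j :: 'k quiver_rep"
      have "perp n (Es ! p) (Es ! q)"
        using exc q p hom_vanishes_iff[OF rep[OF p] rep[OF qn]] ext1_vanishes_iff[OF rep[OF p] rep[OF qn]]
        by (auto simp: perp_def exceptional_sequence_def)
      then have "perp n ?M (interval_rep k l)"
        using perp_iso[OF rep[OF p] is_rep_interval rep[OF qn] is_rep_interval st'(3)[OF p e(1)] st'(3)[OF qn e(2)]] by simp
      then have "bij_mat (tmap ?M k l)" using perp_interval[OF is_rep_interval kl] by blast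
      then have "sdim ?M k = 0 \<longleftrightarrow> sdim ?M l = 0"
        using bij_mat_zero_dims tmap_dims[OF is_rep_interval, of k l n i j] kl
        by (metis less_imp_le)
      then show ?thesis by (auto simp: sdim_interval split: if_splits)
    qed
    show "exceptional_sequence n Es" by (rule exc)
    show "rep_iso n (Es ! p) (interval_rep i j)" if "p < n" "es ! p = (i, j)" for p i j using st'[OF that] by simp
  qed
  moreover have "set es = strand_diagram n (set Es)"
  proof
    show "set es \<subseteq> strand_diagram n (set Es)"
    proof
      fix e assume "e \<in> set es"
      then obtain p where p: "p < n" "e = es ! p" by (auto simp: in_set_conv_nth es_def)
      obtain i j where e: "es ! p = (i, j)" by force
      show "e \<in> strand_diagram n (set Es)"
        using st'[OF p(1) e] p e len nth_mem[of p Es] by (auto simp: strand_diagram_def)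
    qed
    show "strand_diagram n (set Es) \<subseteq> set es"
    proof
      fix e assume "e \<in> strand_diagram n (set Es)"
      then obtain i j E where e: "e = (i, j)" "i < j" "j \<le> n" "E \<in> set Es" "rep_iso n E (interval_rep i j)"
        by (auto simp: strand_diagram_def)
      then obtain p where p: "p < n" "E = Es ! p" using len by (auto simp: in_set_conv_nth)
      obtain k l where kl: "es ! p = (k, l)" by force
      have "i = k \<and> j = l"
        using interval_iso_unique[OF rep[OF p(1)], of i j k l] e p st'[OF p(1) kl] by simp
      then have "e = es ! p" using e kl by simp
      then show "e \<in> set es" using p(1) by (simp add: es_def)
    qed
  qed
  ultimately show ?thesis using that by blast
qed

text \<open>The diagram and the labels depend on the set alone, relative injectivity on an ordering.
  Running the argument for an arbitrary ordering \<open>Es\<close> of \<open>S\<close> settles all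
  orderings together.\<close>

theorem theorem6p9:
  fixes n :: nat and S :: "'k::field quiver_rep set" and i j :: nat and w :: "letter list"
  assumes "n \<ge> 1"
    and "exceptional_set n S"
    and "tree_node (strand_diagram n S) w (i, j)"
  shows "\<forall>Es p. exceptional_sequence n Es \<and> set Es = S \<and> p < n \<and> rep_iso n (Es ! p) (interval_rep i j)
           \<longrightarrow> (relatively_injective n Es p \<longleftrightarrow> even (count_list w LB))"
proof (intro allI impI, elim conjE)
  fix Es p assume exc: "exceptional_sequence n Es" and S: "set Es = S" and p: "p < n"
    and iso: "rep_iso n (Es ! p) (interval_rep i j)"
  obtain es where es: "strand_rep_sequence n es Es" and D: "set es = strand_diagram n (set Es)"
    using exceptional_strand_sequence[OF exc] .
  interpret strand_rep_sequence n es Es by (rule es)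
  have node: "(i, j) \<in> set es" "parent i j \<longleftrightarrow> even (count_list w LB)"
    using tree_node_parity[of w "(i, j)"] assms(3) D S by auto
  obtain k l where kl: "es ! p = (k, l)" by force
  have "i = k \<and> j = l"
    using interval_iso_unique[OF rep[OF p] iso strand_iso[OF p kl]] strand[OF p kl] less[OF node(1)] bounded[OF node(1)]
    by simp
  then have "escapes p \<longleftrightarrow> parent i j" using escapes_iff_parent[OF p] kl by simp
  then show "relatively_injective n Es p \<longleftrightarrow> even (count_list w LB)"
    using node(2) escapes_relatively_injective[OF p] not_escapes_not_relatively_injective[OF p] by blast
qed

end
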